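(* Let $k$ be a positive integer, let $\{f(n)\}$, $\{f^{\ast}(n)\}$ be $k$-periodic sequences of complex numbers, and for an integer $\gamma$ let $A_\gamma=\{f(\gamma n)\}$, $B_\gamma=\{f^*(\gamma n)\}$. Let $\alpha,\beta$ be integers. Let $a,b,c,d$ be integers with $ad-bc=1$, $c>0$ and $a\equiv d\equiv 0\pmod k$, and $Vz=(az+b)/(cz+d)$. Let $r_1,r_2$ be real, $R_{1}=ar_{1}+cr_{2}$, $R_{2}=br_{1}+dr_{2}$, $\rho=\{R_{2}\}c-\{R_{1}\}d$, and for integers $j,\mu,v$ let \[ I_{j,\mu,v}(z,s)=\int_{C}u^{s-1}\frac{\exp\!\left(-\frac{c\mu+j-\{R_{1}\}}{ck}(cz+d)ku\right)}{\exp(-ku(cz+d))-1}\,\frac{\exp\!\left(\frac{v+\{(dj+\rho)/c\}}{k}ku\right)}{\exp(ku)-1}\,du, \] with branch $0<\arg u<2\pi$ and $C$ a loop beginning at $+\infty$, proceeding in the upper half-plane, encircling the origin positively so that $u=0$ is the only zero of $(\exp(-ku(cz+d))-1)(\exp(ku)-1)$ inside, and returning to $+\infty$ in the lower half-plane. Then for $z\in\mathbb{K}$ and all $s$, \begin{align*} &(cz+d)^{-s}\Gamma(s)G(Vz,s;B_{-\beta},A_{-\alpha};r_{1},r_{2})\\ &=\Gamma(s)G(z,s;A_{\alpha b},B_{\beta c};R_{1},R_{2})-2i\Gamma(s)\sin(\pi s)f(-\alpha bR_{1})\lambda_{R_1}L(s;B_{-\beta c};-R_{2})\\ &\quad+e(-s/2)\sum_{j=1}^{c}\sum_{\mu=0}^{k-1}\sum_{v=0}^{k-1}f\big(-\alpha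 b(\mu c+j+[R_{1}])\big)f^{\ast}\big(-\beta c([R_{2}+d(j-\{R_{1}\})/c]-v)\big)I_{j,\mu,v}(z,s). \end{align*}
   Context: For $k$-periodic sequences $C=\{g(n)\}$, $D=\{h(n)\}$, real $r_1,r_2$, $z\in\mathbb{H}$ and $\operatorname{Re}(s)>2$: $G(z,s;C,D;r_1,r_2)=\sum'_{m,n\in\mathbb{Z}} g(m)h(n)((m+r_1)z+n+r_2)^{-s}$, the prime meaning the pair $(m,n)=(-r_1,-r_2)$ is omitted if it is an integer pair; continued analytically in $s$. For a $k$-periodic $C=\{g(n)\}$ and real $\theta$, $L(s;C;\theta)=\sum_{n>-\theta}g(n)(n+\theta)^{-s}$ for $\operatorname{Re}(s)>1$, continued analytically. Powers $w^{-s}$ use $-\pi\le\arg w<\pi$. $\lambda_x=1$ if $x\in\mathbb{Z}$, else $0$ (products $f(x)\lambda_x$ are $0$ for $x\notin\mathbb{Z}$). $[x]$ is the floor, $\{x\}=x-[x]$, $e(z)=e^{2\pi iz}$, $\mathbb{K}=\{x+iy:x>-d/c,\ y>0\}$. The identity is understood via analytic continuation in $s$. *)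

theory Defs
  imports "HOL-Complex_Analysis.Complex_Analysis" "HOL-Number_Theory.Cong"
begin

text \<open>Powers use the argument in \<open>[-\<pi>, \<pi>)\<close>, whereas \<^const>\<open>Arg\<close> takes values in
  \<open>(-\<pi>, \<pi>]\<close>; they differ exactly on the negative real axis, where terms of the double series
  below do occur. Hence \<open>powr\<close> on the complex numbers cannot be used.\<close>

definition arg_lo :: "complex \<Rightarrow> real" where
  "arg_lo w = (if Arg w = pi then - pi else Arg w)"

definition cpow :: "complex \<Rightarrow> complex \<Rightarrow> complex" where
  "cpow w s = exp (s * (of_real (ln (cmod w)) + \<i> * of_real (arg_lo w)))"

text \<open>The power with branch \<open>0 < arg u < 2\<pi>\<close>, for \<open>u\<close> off the nonnegative real axis.\<close>

definition cpow_2pi :: "complex \<Rightarrow> complex \<Rightarrow> complex" where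
  "cpow_2pi u s = exp (s * (of_real (ln (cmod u)) + \<i> * of_real (Arg2pi u)))"

definition periodic_seq :: "int \<Rightarrow> (int \<Rightarrow> complex) \<Rightarrow> bool" where
  "periodic_seq k f \<longleftrightarrow> (\<forall>n. f (n + k) = f n)"

definition dil :: "(int \<Rightarrow> complex) \<Rightarrow> int \<Rightarrow> int \<Rightarrow> complex" where
  "dil f m = (\<lambda>n. f (m * n))"

text \<open>Analytic continuation in \<open>s\<close> from a half-plane \<open>Re s > \<sigma>\<close>: the continuations needed here
  are meromorphic on the whole plane. A nicely meromorphic function takes its limit value at every
  removable singularity and the value 0 at its poles, so the continuation is unique.\<close>

definition mero_cont :: "real \<Rightarrow> (complex \<Rightarrow> complex) \<Rightarrow> complex \<Rightarrow> complex" where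
  "mero_cont \<sigma> F =
     (THE H. H nicely_meromorphic_on UNIV \<and> (\<forall>s. Re s > \<sigma> \<longrightarrow> H s = F s))"

definition G_series ::
  "complex \<Rightarrow> (int \<Rightarrow> complex) \<Rightarrow> (int \<Rightarrow> complex) \<Rightarrow> real \<Rightarrow> real \<Rightarrow> complex \<Rightarrow> complex" where
  "G_series z g h r1 r2 s =
     (\<Sum>\<^sub>\<infinity>(m, n) \<in> {(m, n). (of_int m, of_int n) \<noteq> (- r1, - r2)}.
        g m * h n * cpow ((of_int m + of_real r1) * z + of_int n + of_real r2) (- s))"

definition G ::
  "complex \<Rightarrow> complex \<Rightarrow> (int \<Rightarrow> complex) \<Rightarrow> (int \<Rightarrow> complex) \<Rightarrow> real \<Rightarrow> real \<Rightarrow> complex" where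
  "G z s g h r1 r2 = mero_cont 2 (G_series z g h r1 r2) s"

definition L_series :: "(int \<Rightarrow> complex) \<Rightarrow> real \<Rightarrow> complex \<Rightarrow> complex" where
  "L_series g \<theta> s =
     (\<Sum>\<^sub>\<infinity>n \<in> {n. of_int n > - \<theta>}. g n * cpow (of_int n + of_real \<theta>) (- s))"

definition L :: "complex \<Rightarrow> (int \<Rightarrow> complex) \<Rightarrow> real \<Rightarrow> complex" where
  "L s g \<theta> = mero_cont 1 (L_series g \<theta>) s"

text \<open>The product \<open>f(m x) \<lambda>\<^sub>x\<close>, which is 0 by convention when \<open>x\<close> is not an integer.\<close>

definition f_lambda :: "(int \<Rightarrow> complex) \<Rightarrow> int \<Rightarrow> real \<Rightarrow> complex" where
  "f_lambda f m x = (if x \<in> \<int> then f (m * \<lfloor>x\<rfloor>) else 0)"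

text \<open>An infinite loop is a curve parametrised by the whole real line. Its truncation to
  \<open>[-T, T]\<close> is reparametrised to \<open>[0, 1]\<close>.\<close>

definition trunc_path :: "(real \<Rightarrow> complex) \<Rightarrow> real \<Rightarrow> real \<Rightarrow> complex" where
  "trunc_path \<gamma> T = (\<lambda>x. \<gamma> ((2 * x - 1) * T))"

text \<open>A loop from \<open>+\<infinity>\<close> (in the upper half-plane) to \<open>+\<infinity>\<close> (in the lower half-plane), avoiding
  the branch cut \<open>[0, \<infinity>)\<close> and the points of \<open>Z\<close>, and enclosing exactly the point 0 of \<open>Z\<close>.
  Approaching \<open>+\<infinity>\<close> means that the real part tends to infinity and the imaginary part
  remains bounded. Whether a point is enclosed is decided by the winding number of the truncated
  loop, closed up by the segment between its end points.\<close>

definition is_loop :: "complex set \<Rightarrow> (real \<Rightarrow> complex) \<Rightarrow> bool" where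
  "is_loop Z \<gamma> \<longleftrightarrow>
     (\<forall>T. \<gamma> piecewise_C1_differentiable_on {- T..T}) \<and>
     (\<forall>t. \<gamma> t \<notin> \<real>\<^sub>\<ge>\<^sub>0 \<and> \<gamma> t \<notin> Z) \<and>
     filterlim (\<lambda>t. Re (\<gamma> t)) at_top at_bot \<and> (\<forall>\<^sub>F t in at_bot. Im (\<gamma> t) > 0) \<and>
     filterlim (\<lambda>t. Re (\<gamma> t)) at_top at_top \<and> (\<forall>\<^sub>F t in at_top. Im (\<gamma> t) < 0) \<and>
     bounded (range (\<lambda>t. Im (\<gamma> t))) \<and>
     (\<forall>p \<in> insert 0 Z. \<forall>\<^sub>F T in at_top.
        winding_number (trunc_path \<gamma> T +++ linepath (\<gamma> T) (\<gamma> (- T))) p = (if p = 0 then 1 else 0))"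

definition loop_integral :: "(real \<Rightarrow> complex) \<Rightarrow> (complex \<Rightarrow> complex) \<Rightarrow> complex" where
  "loop_integral \<gamma> F = Lim at_top (\<lambda>T. contour_integral (trunc_path \<gamma> T) F)"

definition I_poles :: "int \<Rightarrow> int \<Rightarrow> int \<Rightarrow> complex \<Rightarrow> complex set" where
  "I_poles k c d z =
     {u. (exp (- of_int k * u * (of_int c * z + of_int d)) - 1) * (exp (of_int k * u) - 1) = 0}"

definition I_loop ::
  "(real \<Rightarrow> complex) \<Rightarrow> int \<Rightarrow> int \<Rightarrow> int \<Rightarrow> real \<Rightarrow> real \<Rightarrow> int \<Rightarrow> int \<Rightarrow> int \<Rightarrow> complex \<Rightarrow> complex \<Rightarrow> complex"
where
  "I_loop \<gamma> k c d R1 \<rho> j \<mu> v z s =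
     loop_integral \<gamma> (\<lambda>u. cpow_2pi u (s - 1)
       * (exp (- (of_real ((of_int (c * \<mu> + j) - frac R1) / of_int (c * k))
                   * (of_int c * z + of_int d) * of_int k * u))
            / (exp (- of_int k * u * (of_int c * z + of_int d)) - 1))
       * (exp (of_real ((of_int v + frac ((of_int (d * j) + \<rho>) / of_int c)) / of_int k)
                   * of_int k * u)
            / (exp (of_int k * u) - 1)))"

text \<open>An identity in \<open>s\<close> understood by analytic continuation: both sides are meromorphic
  functions; they agree literally outside the set \<open>E\<close> of points at which a factor may have a
  pole (and hence carries a dummy value), and at every point after removing singularities.\<close>

definition eq_by_continuation ::
  "complex set \<Rightarrow> (complex \<Rightarrow> complex) \<Rightarrow> (complex \<Rightarrow> complex) \<Rightarrow> bool" where
  "eq_by_continuation E F H \<longleftrightarrow>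
     F meromorphic_on UNIV \<and> H meromorphic_on UNIV \<and>
     (\<forall>s. s \<notin> E \<longrightarrow> F s = H s) \<and> (\<forall>s. remove_sings F s = remove_sings H s)"

end

theory Submission
  imports Defs
begin

text \<open>The substitution \<open>(M, N) = (a m + c n, b m + d n)\<close> turns the terms of \<open>G(Vz)\<close> into
  \<open>(w / (c z + d))\<^sup>-\<^sup>s\<close>, where \<open>w\<close> runs through the points of the shifted lattice that belongs to
  \<open>G(z)\<close>. Powers are multiplicative here up to a factor \<open>e(-s)\<close>, which occurs exactly if \<open>-w\<close> lies
  in the sector \<open>0 \<le> arg < arg (c z + d)\<close>. Hence \<open>G(Vz)\<close> and \<open>G(z)\<close> differ by \<open>2 i sin(\<pi>s)\<close> times
  the sum over that sector. Its lattice points on the real axis give the \<open>L\<close>-series; the others are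
  distributed over \<open>c k\<^sup>2\<close> translates of the cone generated by \<open>k (c z + d)\<close> and \<open>k\<close>, because \<open>d\<close> and
  the periods are divisible by \<open>k\<close>. Summing the Mellin transforms of the exponentials over such a
  translate gives \<open>\<Gamma>(s)\<close> times its contribution as the Mellin transform of a product of two geometric
  series, and folding the loop \<open>C\<close> onto the cut identifies this with \<open>I(z, s)\<close> up to the factor
  \<open>1 - e(s)\<close>.

  The continuation in \<open>s\<close> comes from the same loop integrals, which are entire: a half-plane of
  lattice points consists of two quadrants, and each is a finite union of such translates after a
  rotation. The poles of the two quadrants at \<open>s = 2\<close> cancel, so \<open>G\<close> has at most a simple pole at
  \<open>s = 1\<close>.\<close>

section \<open>Mellin transforms\<close>

text \<open>Three circumstances shape the proof. The loop is an arbitrary curve, known through its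
  ends and winding numbers only, so it is replaced by a fixed contour around the cut. Each geometric
  series has a simple pole at u = 0; therefore u^2 is split off from the product and the power
  u^(s-1) becomes u^(s-3), and what remains is holomorphic on a strip around the cut. Finally, the
  Mellin transforms require generators in the right half-plane: for k(cz+d) and k this is the
  condition z in K, for the quadrants it is achieved by the rotation, at the price of a factor
  exp(-i phi s). The constants fit together because e(-s/2) (1 - e(s)) = -2i sin(pi s) for the loop
  integrals and (e(-s) - 1) e(s/2) = -2i sin(pi s) for the sector, which is reflected at 0 before it
  is summed. The identity is established between entire functions, after multiplication by (s -
  1)/Gamma(s), so that its validity on a half-plane is enough.\<close>

lemma holomorphic_on_parametric_integral:
  fixes f :: "complex \<Rightarrow> 'a \<Rightarrow> complex"
  assumes U: "open U"
    and meas: "\<And>s. s \<in> U \<Longrightarrow> f s \<in> borel_measurable M"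
    and hol: "\<And>t. t \<in> space M \<Longrightarrow> (\<lambda>s. f s t) holomorphic_on U"
    and dom: "\<And>s0. s0 \<in> U \<Longrightarrow> \<exists>r>0. \<exists>g. integrable M g \<and> cball s0 r \<subseteq> U \<and>
        (\<forall>s\<in>cball s0 r. \<forall>t\<in>space M. norm (f s t) \<le> g t)"
  shows "(\<lambda>s. \<integral>t. f s t \<partial>M) holomorphic_on U"
proof -
  have "(\<lambda>s. \<integral>t. f s t \<partial>M) field_differentiable (at s0)" if s0: "s0 \<in> U" for s0
  proof -
    obtain r g where r: "r > 0" and g: "integrable M g" and sub: "cball s0 r \<subseteq> U"
      and le: "\<And>s t. s \<in> cball s0 r \<Longrightarrow> t \<in> space M \<Longrightarrow> norm (f s t) \<le> g t"
      using dom[OF s0] by blast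
    have int: "integrable M (f s)" if "s \<in> cball s0 r" for s
      using that sub le[OF that]
      by (intro Bochner_Integration.integrable_bound[OF g meas] AE_I2) fastforce+
    have deriv: "((\<lambda>s. f s t) has_field_derivative deriv (\<lambda>s. f s t) s) (at s)"
      if "t \<in> space M" "s \<in> U" for s t
      using holomorphic_derivI[OF hol[OF that(1)] U that(2)] .
    \<comment> \<open>Discs of radius r/2 about points of the half-size ball stay where
      \<open>g\<close> dominates, so Cauchy's inequality bounds all these derivatives by one
      integrable function.\<close>
    have dbound: "norm (deriv (\<lambda>s. f s t) s) \<le> g t / (r/2)"
      if t: "t \<in> space M" and s: "s \<in> ball s0 (r/2)" for s t
    proof -
      have sub2: "cball s (r/2) \<subseteq> cball s0 r"
        using s r by (simp add: cball_subset_cball_iff dist_commute)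
      have holb: "(\<lambda>s. f s t) holomorphic_on cball s (r/2)"
        using holomorphic_on_subset[OF hol[OF t]] sub sub2 by blast
      have "norm ((deriv ^^ 1) (\<lambda>s. f s t) s) \<le> fact 1 * g t / (r/2)^1"
      proof (rule Cauchy_inequality)
        show "(\<lambda>s. f s t) holomorphic_on ball s (r/2)"
          using holb holomorphic_on_subset ball_subset_cball by blast
        show "continuous_on (cball s (r/2)) (\<lambda>s. f s t)"
          using holb holomorphic_on_imp_continuous_on by blast
        show "norm (f x t) \<le> g t" if "norm (s - x) = r/2" for x
          using that sub2 by (intro le[OF _ t]) (auto simp: dist_norm)
      qed (use r in auto)
      then show ?thesis by simp
    qed
    \<comment> \<open>The mean value inequality passes the bound on to the difference
      quotients.\<close>
    have quot: "norm ((f s t - f s0 t) / (s - s0)) \<le> g t / (r/2)"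
      if t: "t \<in> space M" and s: "s \<in> ball s0 (r/2)" for s t
    proof -
      have "norm (f s t - f s0 t) \<le> g t / (r/2) * norm (s - s0)"
      proof (rule field_differentiable_bound[where S = "ball s0 (r/2)"])
        show "((\<lambda>s. f s t) has_field_derivative deriv (\<lambda>s. f s t) x) (at x within ball s0 (r/2))"
          if "x \<in> ball s0 (r/2)" for x
        proof -
          have "x \<in> U" using that r sub by (auto simp: subset_iff)
          then show ?thesis using deriv[OF t] has_field_derivative_at_within by blast
        qed
      qed (use dbound[OF t] s r in auto)
      moreover have "0 \<le> g t" using r t by (intro order_trans[OF norm_ge_zero le[of s0 t]]) auto
      ultimately show ?thesis
        using r by (cases "s = s0") (auto simp: norm_divide divide_le_eq)
    qed
    have "((\<lambda>s. ((\<integral>t. f s t \<partial>M) - (\<integral>t. f s0 t \<partial>M)) / (s - s0)) \<longlongrightarrow>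
            (\<integral>t. deriv (\<lambda>s. f s t) s0 \<partial>M)) (at s0)"
      unfolding tendsto_at_iff_sequentially
    proof (intro allI impI)
      fix X :: "nat \<Rightarrow> complex"
      assume X0: "\<forall>i. X i \<in> UNIV - {s0}" and X: "X \<longlonglongrightarrow> s0"
      \<comment> \<open>The quotients are dominated only near s0. The sequence is shifted until all
        its terms lie there, and \<open>LIMSEQ_offset\<close> undoes the shift.\<close>
      obtain N where N: "\<And>n. n \<ge> N \<Longrightarrow> X n \<in> ball s0 (r/2)"
        using tendstoD[OF X, of "r/2"] r by (auto simp: eventually_sequentially dist_commute)
      define Y where "Y = (\<lambda>n. X (n + N))"
      have Y: "Y \<longlonglongrightarrow> s0" and Y1: "\<And>n. Y n \<in> ball s0 (r/2)" and Y0: "\<And>n. Y n \<noteq> s0"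
        using X LIMSEQ_ignore_initial_segment[of X s0 N] N X0 by (auto simp: Y_def)
      have Y2: "Y n \<in> cball s0 r" for n
        using Y1[of n] r by auto
      have lim: "(\<lambda>n. (f (Y n) t - f s0 t) / (Y n - s0)) \<longlonglongrightarrow> deriv (\<lambda>s. f s t) s0"
        if t: "t \<in> space M" for t
      proof -
        have "((\<lambda>s. (f s t - f s0 t) / (s - s0)) \<longlongrightarrow> deriv (\<lambda>s. f s t) s0) (at s0)"
          using deriv[OF t s0] by (simp add: has_field_derivative_iff)
        then show ?thesis
          unfolding tendsto_at_iff_sequentially using Y Y0 by (auto simp: o_def)
      qed
      have "(\<lambda>n. \<integral>t. (f (Y n) t - f s0 t) / (Y n - s0) \<partial>M) \<longlonglongrightarrow>
              (\<integral>t. deriv (\<lambda>s. f s t) s0 \<partial>M)"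
      proof (rule integral_dominated_convergence[where w = "\<lambda>t. g t / (r/2)"])
        have m: "(\<lambda>t. (f (Y n) t - f s0 t) / (Y n - s0)) \<in> borel_measurable M" for n
          using meas[of "Y n"] meas[OF s0] Y2[of n] sub by auto
        then show "(\<lambda>t. (f (Y n) t - f s0 t) / (Y n - s0)) \<in> borel_measurable M" for n .
        show "(\<lambda>t. deriv (\<lambda>s. f s t) s0) \<in> borel_measurable M"
          by (rule borel_measurable_LIMSEQ_metric[OF m lim])
      qed (use g quot Y1 lim in auto)
      moreover have "(\<integral>t. (f (Y n) t - f s0 t) / (Y n - s0) \<partial>M) =
          ((\<integral>t. f (Y n) t \<partial>M) - (\<integral>t. f s0 t \<partial>M)) / (Y n - s0)" for n
        using int[OF Y2[of n]] int[of s0] r by simp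
      ultimately have "(\<lambda>n. ((\<integral>t. f (X (n + N)) t \<partial>M) - (\<integral>t. f s0 t \<partial>M)) / (X (n + N) - s0))
          \<longlonglongrightarrow> (\<integral>t. deriv (\<lambda>s. f s t) s0 \<partial>M)"
        by (simp only: Y_def)
      then show "((\<lambda>s. ((\<integral>t. f s t \<partial>M) - (\<integral>t. f s0 t \<partial>M)) / (s - s0)) \<circ> X)
          \<longlonglongrightarrow> (\<integral>t. deriv (\<lambda>s. f s t) s0 \<partial>M)"
        unfolding o_def by (rule LIMSEQ_offset)
    qed
    then show ?thesis
      unfolding field_differentiable_def has_field_derivative_iff by blast
  qed
  then show ?thesis
    unfolding holomorphic_on_def using field_differentiable_at_within by blast
qed

definition mellin :: "(real \<Rightarrow> complex) \<Rightarrow> complex \<Rightarrow> complex" where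
  "mellin \<phi> s = (LINT u:{0<..}|lborel. of_real u powr (s - 1) * \<phi> u)"

lemma set_integrable_powr_exp:
  fixes p \<delta> :: real
  assumes "p > 0" "\<delta> > 0"
  shows "set_integrable lborel {0<..} (\<lambda>u. u powr (p - 1) * exp (- \<delta> * u))"
proof -
  have "(\<lambda>t. complex_of_real t powr (of_real p - 1) / of_real (exp (\<delta> * t)))
          absolutely_integrable_on {0<..}"
    using assms by (intro absolutely_integrable_Gamma_integral) auto
  \<comment> \<open>The Gamma integral is available for Lebesgue measure; Borel measurability of the
    integrand carries it over to \<open>lborel\<close>.\<close>
  then have "set_integrable lborel {0<..} (\<lambda>t. complex_of_real t powr (of_real p - 1) / of_real (exp (\<delta> * t)))"
    unfolding set_integrable_def
    by (subst (asm) integrable_completion)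
       (auto intro!: borel_measurable_continuous_on_indicator continuous_intros)
  then have "set_integrable lborel {0<..} (\<lambda>t. norm (complex_of_real t powr (of_real p - 1) / of_real (exp (\<delta> * t))))"
    by (rule set_integrable_norm)
  moreover have "(\<lambda>t. indicat_real {0<..} t *\<^sub>R norm (complex_of_real t powr (of_real p - 1) / of_real (exp (\<delta> * t))))
      = (\<lambda>t. indicat_real {0<..} t *\<^sub>R (t powr (p - 1) * exp (- \<delta> * t)))"
    by (rule ext) (auto simp: indicator_def norm_divide norm_powr_real_powr exp_minus field_simps)
  ultimately show ?thesis
    by (simp only: set_integrable_def)
qed

text \<open>Below 1 the smallest exponent dominates, above 1 the largest; their sum is a majorant
  uniform in a compact range of Re s.\<close>

lemma powr_le_sum_powr:
  fixes u :: real
  assumes "u > 0" "a \<le> x" "x \<le> b"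
  shows "u powr x \<le> u powr a + u powr b"
proof (cases "u \<ge> 1")
  case True
  then have "u powr x \<le> u powr b" using assms by (intro powr_mono) auto
  then show ?thesis using powr_ge_zero[of u a] by linarith
next
  case False
  then have "u powr x \<le> u powr a" using assms by (intro powr_mono') auto
  then show ?thesis using powr_ge_zero[of u b] by linarith
qed

lemma mellin_integrand_measurable:
  assumes "continuous_on {0<..} \<phi>"
  shows "(\<lambda>u. indicator {0<..} u *\<^sub>R (of_real u powr (s - 1) * \<phi> u :: complex)) \<in> borel_measurable lborel"
  using assms by (auto intro!: borel_measurable_continuous_on_indicator continuous_intros)

lemma mellin_integrable:
  fixes p \<delta> C :: real
  assumes cont: "continuous_on {0<..} \<phi>" and d: "\<delta> > 0"
    and bound: "\<And>u. u > 0 \<Longrightarrow> norm (\<phi> u) \<le> C * u powr (- p) * exp (- \<delta> * u)"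
    and s: "Re s > p"
  shows "set_integrable lborel {0<..} (\<lambda>u. of_real u powr (s - 1) * \<phi> u)"
  unfolding set_integrable_def
proof (rule Bochner_Integration.integrable_bound[OF _ mellin_integrand_measurable[OF cont] AE_I2])
  show "integrable lborel (\<lambda>u. C * (indicator {0<..} u *\<^sub>R (u powr (Re s - p - 1) * exp (- \<delta> * u))))"
    using set_integrable_powr_exp[of "Re s - p" \<delta>] s d unfolding set_integrable_def by simp
  fix u :: real
  show "norm (indicator {0<..} u *\<^sub>R (of_real u powr (s - 1) * \<phi> u))
      \<le> norm (C * (indicator {0<..} u *\<^sub>R (u powr (Re s - p - 1) * exp (- \<delta> * u))))"
  proof (cases "u > 0")
    case True
    have "u powr (Re s - 1) * norm (\<phi> u) \<le> u powr (Re s - 1) * (C * u powr (- p) * exp (- \<delta> * u))"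
      using bound[OF True] by (intro mult_left_mono) auto
    also have "\<dots> = C * (u powr (Re s - p - 1) * exp (- \<delta> * u))"
      by (simp add: powr_add[symmetric] algebra_simps flip: powr_add)
    also have "\<dots> \<le> \<bar>\<dots>\<bar>" by simp
    finally show ?thesis
      using True by (simp add: norm_mult norm_powr_real_powr)
  qed auto
qed

lemma mellin_holomorphic:
  fixes p \<delta> C :: real
  assumes cont: "continuous_on {0<..} \<phi>" and d: "\<delta> > 0"
    and bound: "\<And>u. u > 0 \<Longrightarrow> norm (\<phi> u) \<le> C * u powr (- p) * exp (- \<delta> * u)"
  shows "mellin \<phi> holomorphic_on {s. Re s > p}"
  unfolding mellin_def set_lebesgue_integral_def
proof (rule holomorphic_on_parametric_integral)
  show "open {s. Re s > p}" by (rule open_halfspace_Re_gt)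
  show "(\<lambda>u. indicat_real {0<..} u *\<^sub>R (of_real u powr (s - 1) * \<phi> u)) \<in> borel_measurable lborel" for s
    by (rule mellin_integrand_measurable[OF cont])
  show "(\<lambda>s. indicat_real {0<..} t *\<^sub>R (of_real t powr (s - 1) * \<phi> t)) holomorphic_on {s. p < Re s}" for t
    by (cases "t > 0") (auto intro!: holomorphic_intros)
  have C: "C \<ge> 0"
  proof -
    have "0 \<le> norm (\<phi> 1)" by simp
    also have "\<dots> \<le> C * exp (- \<delta>)" using bound[of 1] by simp
    finally show ?thesis by (simp add: zero_le_mult_iff)
  qed
  fix s0 assume s0: "s0 \<in> {s. p < Re s}"
  \<comment> \<open>Half the distance to the boundary line, so that both extreme exponents on the
    disc stay above p and both majorants are integrable at 0.\<close>
  define r where "r = (Re s0 - p) / 2"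
  define A where "A = Re s0 - r - p" define B where "B = Re s0 + r - p"
  have r: "r > 0" "A > 0" "B > 0" using s0 by (auto simp: r_def A_def B_def field_simps)
  have reb: "\<bar>Re s - Re s0\<bar> \<le> r" if "s \<in> cball s0 r" for s
    using that abs_Re_le_cmod[of "s - s0"] by (simp add: dist_norm norm_minus_commute)
  define g where "g u = C * (indicator {0<..} u *\<^sub>R (u powr (A - 1) * exp (- \<delta> * u)))
      + C * (indicator {0<..} u *\<^sub>R (u powr (B - 1) * exp (- \<delta> * u)))" for u
  have "integrable lborel g"
    using set_integrable_powr_exp[of A \<delta>] set_integrable_powr_exp[of B \<delta>] r d
    unfolding set_integrable_def g_def by auto
  moreover have "cball s0 r \<subseteq> {s. p < Re s}"
  proof
    fix s assume "s \<in> cball s0 r"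
    from reb[OF this] show "s \<in> {s. p < Re s}" using r by (auto simp: A_def)
  qed
  moreover have "norm (indicat_real {0<..} u *\<^sub>R (of_real u powr (s - 1) * \<phi> u)) \<le> g u"
    if s: "s \<in> cball s0 r" for s u
  proof (cases "u > 0")
    case True
    have "u powr (Re s - 1) * norm (\<phi> u) \<le> u powr (Re s - 1) * (C * u powr (- p) * exp (- \<delta> * u))"
      using bound[OF True] by (intro mult_left_mono) auto
    also have "\<dots> = u powr (Re s - p - 1) * (C * exp (- \<delta> * u))"
      by (simp add: algebra_simps flip: powr_add)
    also have "\<dots> \<le> (u powr (A - 1) + u powr (B - 1)) * (C * exp (- \<delta> * u))"
      using reb[OF s] C True
      by (intro mult_right_mono powr_le_sum_powr) (auto simp: A_def B_def)
    finally show ?thesis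
      using True by (simp add: norm_mult norm_powr_real_powr g_def algebra_simps)
  qed (auto simp: g_def)
  ultimately show "\<exists>r>0. \<exists>g. integrable lborel g \<and> cball s0 r \<subseteq> {s. p < Re s} \<and>
      (\<forall>s\<in>cball s0 r. \<forall>t\<in>space lborel. norm (indicat_real {0<..} t *\<^sub>R (of_real t powr (s - 1) * \<phi> t)) \<le> g t)"
    using r by blast
qed

lemma mellin_exp_real:
  fixes w :: real
  assumes "Re s > 0" "w > 0"
  shows "mellin (\<lambda>u. exp (- of_real w * of_real u)) s = Gamma s * of_real w powr (- s)"
proof -
  \<comment> \<open>The indicator is kept inside \<open>f\<close> so that u -> w u can be
    substituted on the whole line; w > 0 preserves it.\<close>
  define f where "f u = indicat_real {0<..} u *\<^sub>R (of_real u powr (s - 1) * exp (- of_real u) :: complex)" for u :: real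
  have g: "((\<lambda>t. of_real t powr (s - 1) / of_real (exp t)) has_integral Gamma s) {0<..}"
    using Gamma_integral_complex'[OF assms(1)] .
  have si: "set_integrable lborel {0<..} (\<lambda>u. of_real u powr (s - 1) * exp (- of_real u :: complex))"
    using assms by (intro mellin_integrable[where p = 0 and \<delta> = 1 and C = 1])
      (auto intro!: continuous_intros)
  have "integral\<^sup>L lborel f = integral {0<..} (\<lambda>u. of_real u powr (s - 1) * exp (- of_real u :: complex))"
    using set_borel_integral_eq_integral(2)[OF si] by (simp add: f_def[abs_def] set_lebesgue_integral_def)
  also have "\<dots> = Gamma s"
    using g by (intro integral_unique) (simp add: exp_minus exp_of_real field_simps)
  finally have "integral\<^sup>L lborel f = Gamma s" .
  moreover have "integral\<^sup>L lborel f = \<bar>w\<bar> *\<^sub>R integral\<^sup>L lborel (\<lambda>x. f (0 + w * x))"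
    using assms by (intro lborel_integral_real_affine) auto
  ultimately have "Gamma s = w *\<^sub>R integral\<^sup>L lborel (\<lambda>x. f (w * x))"
    using assms by (simp only: add_0 abs_of_pos)
  also have "(\<lambda>x. f (w * x)) = (\<lambda>x. of_real w powr (s - 1) *
      (indicat_real {0<..} x *\<^sub>R (of_real x powr (s - 1) * exp (- of_real w * of_real x))))"
  proof
    fix x :: real
    show "f (w * x) = of_real w powr (s - 1) *
        (indicat_real {0<..} x *\<^sub>R (of_real x powr (s - 1) * exp (- of_real w * of_real x)))"
    proof (cases "x > 0")
      case True
      then have "complex_of_real (w * x) powr (s - 1) = of_real w powr (s - 1) * of_real x powr (s - 1)"
        using assms by (simp add: powr_times_real)
      then show ?thesis using True assms by (simp add: f_def)
    next
      case False
      then have "\<not> w * x > 0" using assms by (simp add: zero_less_mult_iff)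
      then show ?thesis using False by (simp add: f_def)
    qed
  qed
  also have "integral\<^sup>L lborel \<dots> = of_real w powr (s - 1) * mellin (\<lambda>u. exp (- of_real w * of_real u)) s"
    unfolding mellin_def set_lebesgue_integral_def by (rule integral_mult_right_zero)
  finally have "Gamma s = of_real w * of_real w powr (s - 1) * mellin (\<lambda>u. exp (- of_real w * of_real u)) s"
    by (simp add: scaleR_conv_of_real)
  then have 1: "Gamma s = (of_real w * of_real w powr (s - 1)) * mellin (\<lambda>u. exp (- of_real w * of_real u)) s" .
  have 2: "of_real w * of_real w powr (s - 1) = (of_real w powr s :: complex)"
    using assms by (simp add: powr_diff)
  have 3: "of_real w powr s * of_real w powr (- s) = (1 :: complex)"
    using assms by (simp add: powr_minus)
  have "Gamma s * of_real w powr (- s) =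
      (of_real w powr s * of_real w powr (- s)) * mellin (\<lambda>u. exp (- of_real w * of_real u)) s"
    unfolding 1 2 by (simp only: mult_ac)
  then show ?thesis
    unfolding 3 by simp
qed

text \<open>For complex w the substitution u -> w u would rotate the path of integration. Instead,
  both sides are holomorphic in w on the right half-plane and agree on the positive reals, which
  accumulate at 1.\<close>

lemma mellin_exp:
  assumes s: "Re s > 0" and w: "Re w > 0"
  shows "mellin (\<lambda>u. exp (- w * of_real u)) s = Gamma s * w powr (- s)"
proof -
  define U where "U = {w::complex. Re w > 0}"
  have U: "open U" "connected U" unfolding U_def
    by (auto simp: open_halfspace_Re_gt convex_halfspace_Re_gt intro!: convex_connected)
  have h1: "(\<lambda>w. mellin (\<lambda>u. exp (- w * of_real u)) s) holomorphic_on U"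
    unfolding mellin_def set_lebesgue_integral_def
  proof (rule holomorphic_on_parametric_integral[OF U(1)])
    show "(\<lambda>u. indicat_real {0<..} u *\<^sub>R (complex_of_real u powr (s - 1) * exp (- w * complex_of_real u))) \<in> borel_measurable lborel" for w
      by (intro mellin_integrand_measurable continuous_intros)
    show "(\<lambda>w. indicat_real {0<..} t *\<^sub>R (complex_of_real t powr (s - 1) * exp (- w * complex_of_real t))) holomorphic_on U" for t
      by (cases "t > 0") (auto intro!: holomorphic_intros)
    fix w0 assume w0: "w0 \<in> U"
    define r where "r = Re w0 / 2"
    have r: "r > 0" using w0 by (auto simp: r_def U_def)
    have reb: "Re w \<ge> r" if "w \<in> cball w0 r" for w
    proof -
      have "\<bar>Re w - Re w0\<bar> \<le> r" 
        using that abs_Re_le_cmod[of "w - w0"] by (simp add: dist_norm norm_minus_commute)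
      then have "Re w0 - Re w \<le> r" by linarith
      then show ?thesis by (simp add: r_def)
    qed
    define g where "g u = indicator {0<..} u *\<^sub>R (u powr (Re s - 1) * exp (- r * u))" for u :: real
    have "integrable lborel g"
      using set_integrable_powr_exp[of "Re s" r] s r unfolding set_integrable_def g_def by auto
    moreover have "cball w0 r \<subseteq> U" using reb r by (force simp: U_def)
    moreover have "norm (indicat_real {0<..} u *\<^sub>R (of_real u powr (s - 1) * exp (- w * of_real u))) \<le> g u"
      if "w \<in> cball w0 r" for w u
      using reb[OF that] by (cases "u > 0") (auto simp: g_def norm_mult norm_powr_real_powr)
    ultimately show "\<exists>r>0. \<exists>g. integrable lborel g \<and> cball w0 r \<subseteq> U \<and>
      (\<forall>w\<in>cball w0 r. \<forall>u\<in>space lborel. norm (indicat_real {0<..} u *\<^sub>R (of_real u powr (s - 1) * exp (- w * of_real u))) \<le> g u)"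
      using r by blast
  qed
  have h2: "(\<lambda>w. Gamma s * w powr (- s)) holomorphic_on U"
    by (intro holomorphic_intros) (auto simp: U_def complex_nonpos_Reals_iff)
  define f where "f w = mellin (\<lambda>u. exp (- w * of_real u)) s - Gamma s * w powr (- s)" for w
  have "f w = 0"
  proof (rule analytic_continuation[of f U "complex_of_real ` {0<..}" 1])
    show "f holomorphic_on U" unfolding f_def by (intro holomorphic_intros h1 h2)
    show "complex_of_real ` {0<..} \<subseteq> U" "1 \<in> U" "w \<in> U" using w by (auto simp: U_def)
    show "1 islimpt complex_of_real ` {0<..}"
      unfolding islimpt_approachable
    proof (intro allI impI)
      fix e :: real assume "e > 0"
      then have "complex_of_real (1 + e / 2) \<in> complex_of_real ` {0<..}"
        by (intro imageI) simp
      moreover have "dist (complex_of_real (1 + e / 2)) 1 = \<bar>e / 2\<bar>"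
        unfolding dist_norm by (subst norm_of_real[symmetric]) simp
      moreover have "complex_of_real (1 + e / 2) \<noteq> 1"
        using \<open>e > 0\<close> by (metis add_cancel_right_right divide_eq_0_iff less_irrefl of_real_eq_1_iff zero_neq_numeral)
      ultimately show "\<exists>x'\<in>complex_of_real ` {0<..}. x' \<noteq> 1 \<and> dist x' 1 < e"
        using \<open>e > 0\<close> by (intro bexI[of _ "complex_of_real (1 + e / 2)"] conjI) auto
    qed
  qed (use U mellin_exp_real[OF s] in \<open>auto simp: f_def\<close>)
  then show ?thesis by (simp add: f_def)
qed

lemma mellin_sum:
  assumes "finite A"
    and "\<And>i. i \<in> A \<Longrightarrow> set_integrable lborel {0<..} (\<lambda>u. of_real u powr (s - 1) * \<phi> i u)"
  shows "mellin (\<lambda>u. \<Sum>i\<in>A. \<phi> i u) s = (\<Sum>i\<in>A. mellin (\<phi> i) s)"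
proof -
  have "mellin (\<lambda>u. \<Sum>i\<in>A. \<phi> i u) s =
      (\<integral>u. (\<Sum>i\<in>A. indicat_real {0<..} u *\<^sub>R (of_real u powr (s - 1) * \<phi> i u)) \<partial>lborel)"
    unfolding mellin_def set_lebesgue_integral_def by (simp only: sum_distrib_left scaleR_sum_right)
  also have "\<dots> = (\<Sum>i\<in>A. mellin (\<phi> i) s)"
    unfolding mellin_def set_lebesgue_integral_def
    using assms(2) unfolding set_integrable_def by (rule Bochner_Integration.integral_sum)
  finally show ?thesis .
qed

lemma mellin_exp_integrable:
  assumes "Re s > 0" "Re w > 0"
  shows "set_integrable lborel {0<..} (\<lambda>u. of_real u powr (s - 1) * exp (- w * of_real u))"
  using assms by (intro mellin_integrable[where p = 0 and \<delta> = "Re w" and C = 1])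
    (auto intro!: continuous_intros)

lemma mellin_exp_sum:
  assumes "finite A" "Re s > 0" "\<And>i. i \<in> A \<Longrightarrow> Re (w i) > 0"
  shows "mellin (\<lambda>u. \<Sum>i\<in>A. exp (- w i * of_real u)) s = Gamma s * (\<Sum>i\<in>A. w i powr (- s))"
proof -
  have "mellin (\<lambda>u. \<Sum>i\<in>A. exp (- w i * of_real u)) s = (\<Sum>i\<in>A. mellin (\<lambda>u. exp (- w i * of_real u)) s)"
    using assms by (intro mellin_sum mellin_exp_integrable) auto
  also have "\<dots> = (\<Sum>i\<in>A. Gamma s * w i powr (- s))"
    using assms by (intro sum.cong refl mellin_exp) auto
  finally show ?thesis by (simp add: sum_distrib_left)
qed

section \<open>Sums over cones\<close>

text \<open>Since |w^(-s)| = exp(Im s * Arg w) |w|^(-Re s), the argument costs only a constant.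
  Absolute convergence of a sum over w is thereby reduced to real powers of Re w.\<close>

lemma norm_powr_le_Re_powr:
  assumes "Re w > 0" "Re s \<ge> 0"
  shows "norm (w powr (- s)) \<le> exp (\<bar>Im s\<bar> * pi) * Re w powr (- Re s)"
proof -
  have w: "w \<noteq> 0" using assms by auto
  have "norm (w powr (- s)) = exp (Re (- s * Ln w))"
    using w by (simp add: powr_def)
  also have "\<dots> = exp (Im s * Arg w) * norm w powr (- Re s)"
    using w by (simp add: powr_def Re_Ln Arg_def flip: exp_add)
  also have "\<dots> \<le> exp (\<bar>Im s\<bar> * pi) * Re w powr (- Re s)"
  proof (rule mult_mono)
    have "Im s * Arg w \<le> \<bar>Im s\<bar> * \<bar>Arg w\<bar>" by (metis abs_ge_self abs_mult)
    also have "\<dots> \<le> \<bar>Im s\<bar> * pi"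
      using Arg_bounded[of w] by (intro mult_left_mono) auto
    finally show "exp (Im s * Arg w) \<le> exp (\<bar>Im s\<bar> * pi)" by simp
    show "norm w powr (- Re s) \<le> Re w powr (- Re s)"
      using assms complex_Re_le_cmod[of w] by (intro powr_mono2') auto
  qed auto
  finally show ?thesis .
qed

text \<open>The majorant of the partial sums serves twice: with real parts and a real exponent it
  bounds the partial sums and gives absolute summability, and for the complex terms it permits
  dominated convergence under the Mellin integral. The exhaustion by finite sets turns the unordered
  sum into the limit of a sequence.\<close>

lemma mellin_has_sum:
  fixes w :: "'i \<Rightarrow> complex" and A :: "nat \<Rightarrow> 'i set" and C p \<delta> :: real
  assumes fin: "\<And>n. finite (A n)" and mono: "incseq A" and I: "(\<Union>n. A n) = I"
    and w: "\<And>i. i \<in> I \<Longrightarrow> Re (w i) > 0"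
    and lim: "\<And>u. u > 0 \<Longrightarrow> (\<lambda>n. \<Sum>i\<in>A n. exp (- w i * of_real u)) \<longlonglongrightarrow> \<phi> u"
    and dom: "\<And>u n. u > 0 \<Longrightarrow> (\<Sum>i\<in>A n. exp (- Re (w i) * u)) \<le> C * u powr (- p) * exp (- \<delta> * u)"
    and d: "\<delta> > 0" and p: "p \<ge> 0" and s: "Re s > p"
  shows "(\<lambda>i. norm (w i powr (- s))) summable_on I \<and>
         ((\<lambda>i. w i powr (- s)) has_sum (mellin \<phi> s / Gamma s)) I"
proof -
  define \<sigma> where "\<sigma> = Re s"
  have \<sigma>: "\<sigma> > p" "\<sigma> > 0" using s p by (auto simp: \<sigma>_def)
  have AI: "A n \<subseteq> I" for n using I by auto
  have wA: "Re (w i) > 0" if "i \<in> A n" for i n using w AI that by auto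
  define g where "g u = indicator {0<..} u *\<^sub>R (C * (u powr (\<sigma> - p - 1) * exp (- \<delta> * u)))" for u :: real
  have g: "integrable lborel g"
    using set_integrable_powr_exp[of "\<sigma> - p" \<delta>] \<sigma> d
    unfolding set_integrable_def g_def by (auto simp: scaleR_conv_of_real mult.left_commute[of _ C])
  have gle: "u powr (\<sigma> - 1) * (\<Sum>i\<in>A n. exp (- Re (w i) * u)) \<le> g u" if "u > 0" for u n
  proof -
    have "u powr (\<sigma> - 1) * (\<Sum>i\<in>A n. exp (- Re (w i) * u)) \<le> u powr (\<sigma> - 1) * (C * u powr (- p) * exp (- \<delta> * u))"
      using dom[OF that, of n] by (intro mult_left_mono) auto
    also have "\<dots> = g u"
      using that by (simp add: g_def algebra_simps flip: powr_add)
    finally show ?thesis .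
  qed
  \<comment> \<open>With Re w for w and Re s for s all terms are positive, and the finite Mellin
    formula yields a bound independent of n.\<close>
  have fin_bound: "(\<Sum>i\<in>A n. Re (w i) powr (- \<sigma>)) \<le> integral\<^sup>L lborel g / Gamma \<sigma>" for n
  proof -
    have "Gamma (of_real \<sigma>) * (\<Sum>i\<in>A n. complex_of_real (Re (w i)) powr (- of_real \<sigma>)) =
        mellin (\<lambda>u. \<Sum>i\<in>A n. exp (- of_real (Re (w i)) * of_real u)) (of_real \<sigma>)"
      using wA \<sigma> fin by (subst mellin_exp_sum) auto
    also have "norm \<dots> \<le> integral\<^sup>L lborel g"
      unfolding mellin_def set_lebesgue_integral_def
    proof (rule Bochner_Integration.integral_norm_bound_integral[OF _ g])
      show "integrable lborel (\<lambda>x. indicat_real {0<..} x *\<^sub>R (complex_of_real x powr (of_real \<sigma> - 1) *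
             (\<Sum>i\<in>A n. exp (- complex_of_real (Re (w i)) * complex_of_real x))))"
        using mellin_exp_integrable[of "of_real \<sigma>"] wA \<sigma> unfolding set_integrable_def
        by (auto simp: sum_distrib_left scaleR_sum_right)
      fix u :: real
      show "norm (indicat_real {0<..} u *\<^sub>R (complex_of_real u powr (of_real \<sigma> - 1) *
             (\<Sum>i\<in>A n. exp (- complex_of_real (Re (w i)) * complex_of_real u)))) \<le> g u"
      proof (cases "u > 0")
        case True
        have "norm (\<Sum>i\<in>A n. exp (- complex_of_real (Re (w i)) * complex_of_real u)) \<le> (\<Sum>i\<in>A n. exp (- Re (w i) * u))"
          by (intro sum_norm_le) simp
        then have "u powr (\<sigma> - 1) * norm (\<Sum>i\<in>A n. exp (- complex_of_real (Re (w i)) * complex_of_real u))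
            \<le> u powr (\<sigma> - 1) * (\<Sum>i\<in>A n. exp (- Re (w i) * u))"
          by (intro mult_left_mono) auto
        also have "\<dots> \<le> g u" by (rule gle[OF True])
        finally show ?thesis using True by (simp add: norm_mult norm_powr_real_powr)
      qed (auto simp: g_def)
    qed
    also have "norm (Gamma (complex_of_real \<sigma>) * (\<Sum>i\<in>A n. complex_of_real (Re (w i)) powr (- of_real \<sigma>)))
        = Gamma \<sigma> * (\<Sum>i\<in>A n. Re (w i) powr (- \<sigma>))"
    proof -
      have "(\<Sum>i\<in>A n. complex_of_real (Re (w i)) powr (- of_real \<sigma>)) = of_real (\<Sum>i\<in>A n. Re (w i) powr (- \<sigma>))"
        using wA[of _ n] by (simp add: less_imp_le flip: powr_of_real of_real_minus)
      moreover have "norm (complex_of_real (\<Sum>i\<in>A n. Re (w i) powr (- \<sigma>))) = (\<Sum>i\<in>A n. Re (w i) powr (- \<sigma>))"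
        by (subst norm_of_real) (simp add: sum_nonneg)
      ultimately show ?thesis
        using \<sigma> Gamma_real_pos[of \<sigma>] by (simp only: norm_mult Gamma_complex_of_real norm_of_real) simp
    qed
    finally show ?thesis using \<sigma> Gamma_real_pos[of \<sigma>] by (simp add: field_simps)
  qed
  have cofinal: "\<exists>N. F \<subseteq> A N" if "finite F" "F \<subseteq> I" for F
    using that
  proof induction
    case (insert i F)
    then obtain N where N: "F \<subseteq> A N" by auto
    from insert.prems I obtain M where "i \<in> A M" by auto
    then have "insert i F \<subseteq> A (max M N)"
      using N incseqD[OF mono, of M "max M N"] incseqD[OF mono, of N "max M N"] by auto
    then show ?case by blast
  qed auto
  have "(\<lambda>i. Re (w i) powr (- \<sigma>)) summable_on I"
  proof (rule nonneg_bdd_above_summable_on)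
    show "bdd_above (sum (\<lambda>i. Re (w i) powr - \<sigma>) ` {F. F \<subseteq> I \<and> finite F})"
    proof (rule bdd_aboveI2)
      fix F assume F: "F \<in> {F. F \<subseteq> I \<and> finite F}"
      then obtain N where "F \<subseteq> A N" using cofinal by blast
      then have "(\<Sum>i\<in>F. Re (w i) powr - \<sigma>) \<le> (\<Sum>i\<in>A N. Re (w i) powr - \<sigma>)"
        by (intro sum_mono2 fin) auto
      then show "(\<Sum>i\<in>F. Re (w i) powr - \<sigma>) \<le> integral\<^sup>L lborel g / Gamma \<sigma>"
        using fin_bound[of N] by linarith
    qed
  qed auto
  then have "(\<lambda>i. exp (\<bar>Im s\<bar> * pi) * Re (w i) powr (- \<sigma>)) summable_on I"
    by (rule summable_on_cmult_right)
  then have abs: "(\<lambda>i. norm (w i powr (- s))) summable_on I"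
    by (rule summable_on_comparison_test)
       (use w s p norm_powr_le_Re_powr in \<open>auto simp: \<sigma>_def\<close>)
  define S where "S = infsum (\<lambda>i. w i powr (- s)) I"
  have S: "((\<lambda>i. w i powr (- s)) has_sum S) I"
    using abs_summable_summable[OF abs] by (simp add: S_def)
  \<comment> \<open>\<open>A\<close> is cofinal among the finite subsets of \<open>I\<close>, so the
    unordered sum may be computed along it.\<close>
  have fl: "filterlim A (finite_subsets_at_top I) sequentially"
    unfolding filterlim_finite_subsets_at_top
  proof (intro allI impI)
    fix X assume X: "finite X \<and> X \<subseteq> I"
    then obtain N where "X \<subseteq> A N" using cofinal by blast
    then have "X \<subseteq> A n" if "n \<ge> N" for n using incseqD[OF mono that] by auto
    then show "\<forall>\<^sub>F n in sequentially. finite (A n) \<and> X \<subseteq> A n \<and> A n \<subseteq> I"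
      using fin AI by (auto simp: eventually_sequentially)
  qed
  have l1: "(\<lambda>n. \<Sum>i\<in>A n. w i powr (- s)) \<longlonglongrightarrow> S"
    using filterlim_compose[OF S[unfolded has_sum_def] fl] by (simp add: o_def)
  have l2: "(\<lambda>n. mellin (\<lambda>u. \<Sum>i\<in>A n. exp (- w i * of_real u)) s) \<longlonglongrightarrow> mellin \<phi> s"
    unfolding mellin_def set_lebesgue_integral_def
  proof (rule integral_dominated_convergence[OF _ _ g AE_I2 AE_I2])
    show m: "(\<lambda>u. indicat_real {0<..} u *\<^sub>R (of_real u powr (s - 1) * (\<Sum>i\<in>A n. exp (- w i * of_real u)))) \<in> borel_measurable lborel" for n
      by (rule mellin_integrand_measurable) (intro continuous_intros)
    show l: "(\<lambda>n. indicat_real {0<..} u *\<^sub>R (of_real u powr (s - 1) * (\<Sum>i\<in>A n. exp (- w i * of_real u))))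
        \<longlonglongrightarrow> indicat_real {0<..} u *\<^sub>R (of_real u powr (s - 1) * \<phi> u)" for u
      using lim[of u] by (cases "u > 0") (auto intro!: tendsto_mult tendsto_const)
    show "(\<lambda>u. indicat_real {0<..} u *\<^sub>R (of_real u powr (s - 1) * \<phi> u)) \<in> borel_measurable lborel"
      by (rule borel_measurable_LIMSEQ_metric[OF m l])
    show "norm (indicat_real {0<..} u *\<^sub>R (of_real u powr (s - 1) * (\<Sum>i\<in>A n. exp (- w i * of_real u)))) \<le> g u" for u n
    proof (cases "u > 0")
      case True
      have "norm (\<Sum>i\<in>A n. exp (- w i * of_real u)) \<le> (\<Sum>i\<in>A n. exp (- Re (w i) * u))"
        by (intro sum_norm_le) simp
      then have "u powr (\<sigma> - 1) * norm (\<Sum>i\<in>A n. exp (- w i * of_real u)) \<le> u powr (\<sigma> - 1) * (\<Sum>i\<in>A n. exp (- Re (w i) * u))"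
        by (intro mult_left_mono) auto
      also have "\<dots> \<le> g u" by (rule gle[OF True])
      finally show ?thesis using True by (simp add: norm_mult norm_powr_real_powr \<sigma>_def)
    qed (auto simp: g_def)
  qed
  have "(\<lambda>n. mellin (\<lambda>u. \<Sum>i\<in>A n. exp (- w i * of_real u)) s) = (\<lambda>n. Gamma s * (\<Sum>i\<in>A n. w i powr (- s)))"
    using s p wA fin by (intro ext mellin_exp_sum) auto
  then have "(\<lambda>n. Gamma s * (\<Sum>i\<in>A n. w i powr (- s))) \<longlonglongrightarrow> mellin \<phi> s" using l2 by simp
  moreover have "(\<lambda>n. Gamma s * (\<Sum>i\<in>A n. w i powr (- s))) \<longlonglongrightarrow> Gamma s * S"
    by (intro tendsto_intros l1)
  ultimately have "mellin \<phi> s = Gamma s * S" by (rule LIMSEQ_unique)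
  moreover have "Gamma s \<noteq> 0"
    using s p by (simp add: Gamma_eq_zero_iff) (metis nonpos_Ints_nonpos Re_complex_of_real nonpos_Ints_of_int linorder_not_le complex_nonpos_Reals_iff nonpos_Ints_subset_nonpos_Reals subsetD order_trans)
  ultimately have "mellin \<phi> s / Gamma s = S" by simp
  with S abs show ?thesis by simp
qed

text \<open>For Re (w u) > 0 this is the geometric series
  \<open>\<Sum>l. exp (- (l + x) * w * u)\<close> over l = 0, 1, 2, ...\<close>

definition geom_ker :: "real \<Rightarrow> complex \<Rightarrow> complex \<Rightarrow> complex" where
  "geom_ker x w u = exp (- of_real x * w * u) / (1 - exp (- w * u))"

section \<open>Majorants for geometric series\<close>

lemma geometric_inverse_le:
  fixes a u :: real
  assumes "a > 0" "u > 0"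
  shows "1 / (1 - exp (- a * u)) \<le> (1 + a * u) / (a * u)"
proof -
  have "1 + a * u \<le> exp (a * u)" using exp_ge_add_one_self[of "a * u"] by simp
  then have "exp (- a * u) \<le> 1 / (1 + a * u)"
    using assms by (simp add: exp_minus field_simps add_pos_pos)
  moreover have "a * u / (1 + a * u) = 1 - 1 / (1 + a * u)"
    using assms by (simp add: field_simps add_pos_pos less_imp_neq[symmetric])
  ultimately have "a * u / (1 + a * u) \<le> 1 - exp (- a * u)" by linarith
  then have "1 / (1 - exp (- a * u)) \<le> 1 / (a * u / (1 + a * u))"
    using assms by (intro divide_left_mono) (auto intro!: divide_pos_pos add_pos_pos mult_pos_pos)
  then show ?thesis by simp
qed

lemma linear_le_exp:
  fixes a e u :: real
  assumes "a > 0" "e > 0" "u > 0"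
  shows "1 + a * u \<le> (1 + a / e) * exp (e * u)"
proof -
  have "1 + a * u \<le> (1 + a / e) * (1 + e * u)"
    using assms by (simp add: field_simps)
  also have "\<dots> \<le> (1 + a / e) * exp (e * u)"
    using assms exp_ge_add_one_self[of "e * u"] by (intro mult_left_mono) (auto intro: add_nonneg_nonneg)
  finally show ?thesis .
qed

text \<open>Separates the simple pole at u = 0 from growth at an arbitrarily small rate e. In the
  applications e is a fraction of the exponential decay that is available.\<close>

lemma geom_inverse_bound:
  fixes a e u :: real
  assumes "a > 0" "e > 0" "u > 0"
  shows "1 / (1 - exp (- a * u)) \<le> (1 / a + 1 / e) * u powr (-1) * exp (e * u)"
proof -
  have "1 / (1 - exp (- a * u)) \<le> (1 + a * u) / (a * u)" using assms by (intro geometric_inverse_le)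
  also have "\<dots> \<le> ((1 + a / e) * exp (e * u)) / (a * u)"
    using assms by (intro divide_right_mono linear_le_exp) auto
  also have "\<dots> = (1 / a + 1 / e) * u powr (-1) * exp (e * u)"
    using assms by (simp add: field_simps powr_minus)
  finally show ?thesis .
qed

lemma sum_geom_real_le:
  fixes a u :: real
  assumes "a > 0" "u > 0"
  shows "(\<Sum>l<n. exp (- a * u) ^ l) \<le> 1 / (1 - exp (- a * u))"
proof -
  have "exp (- a * u) < 1" using assms by simp
  then have "(\<Sum>l<n. exp (- a * u) ^ l) = (1 - exp (- a * u) ^ n) / (1 - exp (- a * u))"
    using assms by (subst sum_gp_strict) auto
  also have "\<dots> \<le> 1 / (1 - exp (- a * u))"
    using \<open>exp (- a * u) < 1\<close> zero_le_power[OF exp_ge_zero, of "- a * u" n]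
    by (intro divide_right_mono) linarith+
  finally show ?thesis .
qed

lemma lim_geom:
  assumes "Re w > 0" "u > 0"
  shows "(\<lambda>n. \<Sum>l<n. exp (- w * of_real u) ^ l) \<longlonglongrightarrow> 1 / (1 - exp (- w * of_real u))"
proof -
  have "norm (exp (- w * of_real u)) < 1" using assms by simp
  then show ?thesis using geometric_sums unfolding sums_def by blast
qed

lemma cone_sum_1:
  assumes w: "Re \<omega> > 0" and y: "y > 0" and s: "Re s > 1"
  shows "(\<lambda>l::nat. norm (((of_nat l + of_real y) * \<omega>) powr (- s))) summable_on UNIV" (is ?A)
    and "((\<lambda>l::nat. ((of_nat l + of_real y) * \<omega>) powr (- s)) has_sum
            (mellin (\<lambda>u. geom_ker y \<omega> (of_real u)) s / Gamma s)) UNIV" (is ?B)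
proof -
  define a where "a = Re \<omega>"
  \<comment> \<open>Half of the decay rate \<open>a * y\<close> pays for the growth of the majorant,
    the other half is left for the integral.\<close>
  define \<delta> where "\<delta> = a * y / 2"
  have pos: "a > 0" "\<delta> > 0" using assms by (auto simp: a_def \<delta>_def)
  have fact: "exp (- ((of_nat l + of_real y) * \<omega>) * of_real u) = exp (- of_real y * \<omega> * of_real u) * exp (- \<omega> * of_real u) ^ l"
    for l :: nat and u :: real
    by (simp add: exp_of_nat_mult[symmetric] exp_add[symmetric] algebra_simps)
  have factr: "exp (- Re ((of_nat l + of_real y) * \<omega>) * u) = exp (- y * a * u) * exp (- a * u) ^ l"
    for l :: nat and u :: real
    by (simp add: exp_of_nat_mult[symmetric] exp_add[symmetric] algebra_simps a_def)
  have *: "?A \<and> ?B"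
  proof (rule mellin_has_sum[where A = "\<lambda>n. {..<n}" and p = 1 and \<delta> = \<delta> and C = "1 / a + 1 / \<delta>"])
    show "incseq (\<lambda>n::nat. {..<n})" by (auto simp: incseq_def)
    show "Re ((of_nat i + of_real y) * \<omega>) > 0" for i :: nat using w y by (simp add: add_nonneg_pos)
    show "(\<lambda>n. \<Sum>l<n. exp (- ((of_nat l + of_real y) * \<omega>) * of_real u)) \<longlonglongrightarrow> geom_ker y \<omega> (of_real u)" if "u > 0" for u
      unfolding fact sum_distrib_left[symmetric] geom_ker_def
      using tendsto_mult[OF tendsto_const lim_geom[OF w that]] by (simp add: divide_inverse)
    fix u :: real and n :: nat assume u: "u > 0"
    have "(\<Sum>l<n. exp (- Re ((of_nat l + of_real y) * \<omega>) * u)) = exp (- y * a * u) * (\<Sum>l<n. exp (- a * u) ^ l)"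
      unfolding factr sum_distrib_left ..
    also have "\<dots> \<le> exp (- y * a * u) * ((1 / a + 1 / \<delta>) * u powr (-1) * exp (\<delta> * u))"
      using sum_geom_real_le[OF pos(1) u] geom_inverse_bound[OF pos u]
      by (intro mult_left_mono) (auto intro: order_trans)
    also have "\<dots> = (1 / a + 1 / \<delta>) * u powr (-1) * (exp (- y * a * u) * exp (\<delta> * u))" by simp
    also have "exp (- y * a * u) * exp (\<delta> * u) = exp (- \<delta> * u)"
      by (simp add: exp_add[symmetric] \<delta>_def)
    finally show "(\<Sum>l<n. exp (- Re ((of_nat l + of_real y) * \<omega>) * u)) \<le> (1 / a + 1 / \<delta>) * u powr (-1) * exp (- \<delta> * u)" .
  qed (use pos s in auto)
  then show ?A ?B by auto
qed

text \<open>The exponentials of the points of a translated cone sum to a product of two geometric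
  series. One of x and y may vanish, as happens when an edge of a quadrant carries lattice points; x
  + y > 0 keeps the points away from 0.\<close>

lemma cone_sum_2:
  assumes w: "Re \<omega>1 > 0" "Re \<omega>2 > 0" and xy: "x \<ge> 0" "y \<ge> 0" "x + y > 0" and s: "Re s > 2"
  shows "(\<lambda>(l::nat, m::nat). norm (((of_nat l + of_real x) * \<omega>1 + (of_nat m + of_real y) * \<omega>2) powr (- s))) summable_on UNIV" (is ?A)
    and "((\<lambda>(l::nat, m::nat). ((of_nat l + of_real x) * \<omega>1 + (of_nat m + of_real y) * \<omega>2) powr (- s)) has_sum
            (mellin (\<lambda>u. geom_ker x \<omega>1 (of_real u) * geom_ker y \<omega>2 (of_real u)) s / Gamma s)) UNIV" (is ?B)
proof -
  define a b where "a = Re \<omega>1" and "b = Re \<omega>2"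
  have ab: "a > 0" "b > 0" using w by (auto simp: a_def b_def)
  \<comment> \<open>A third of the decay rate for each of the two geometric factors, and a third for
    the integral.\<close>
  define \<delta> where "\<delta> = (x * a + y * b) / 3"
  have "x * a + y * b > 0"
    using ab xy by (cases "x = 0") (auto intro: add_pos_nonneg)
  then have \<delta>: "\<delta> > 0" by (simp add: \<delta>_def)
  define W where "W = (\<lambda>(l::nat, m::nat). (of_nat l + of_real x) * \<omega>1 + (of_nat m + of_real y) * \<omega>2)"
  \<comment> \<open>Stated over semirings because it is applied both to the complex terms and to
    their real majorants.\<close>
  have cart: "(\<Sum>i\<in>{..<n} \<times> {..<n}. g i) = E * ((\<Sum>l<n. p l) * (\<Sum>m<n. q m))"
    if "\<And>l m. g (l, m) = E * (p l * q m)" for n and g :: "nat \<times> nat \<Rightarrow> 'b::comm_semiring_0" and E p q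
  proof -
    have "(\<Sum>i\<in>{..<n} \<times> {..<n}. g i) = (\<Sum>l<n. \<Sum>m<n. E * (p l * q m))"
      by (simp only: sum.cartesian_product' that)
    also have "\<dots> = E * (\<Sum>l<n. \<Sum>m<n. p l * q m)" by (simp only: sum_distrib_left)
    finally show ?thesis by (simp only: sum_product)
  qed
  have fact: "(\<Sum>i\<in>{..<n} \<times> {..<n}. exp (- W i * of_real u)) =
      (exp (- of_real x * \<omega>1 * of_real u) * exp (- of_real y * \<omega>2 * of_real u)) * ((\<Sum>l<n. exp (- \<omega>1 * of_real u) ^ l) * (\<Sum>m<n. exp (- \<omega>2 * of_real u) ^ m))"
    for n :: nat and u :: real
    by (rule cart) (simp add: W_def exp_of_nat_mult[symmetric] exp_add[symmetric] algebra_simps)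
  have factr: "(\<Sum>i\<in>{..<n} \<times> {..<n}. exp (- Re (W i) * u)) =
      exp (- (x * a + y * b) * u) * ((\<Sum>l<n. exp (- a * u) ^ l) * (\<Sum>m<n. exp (- b * u) ^ m))"
    for n :: nat and u :: real
    by (rule cart) (simp add: W_def exp_of_nat_mult[symmetric] exp_add[symmetric] algebra_simps a_def b_def)
  have reW: "Re (W i) > 0" for i
  proof -
    obtain l m where i: "i = (l, m)" by (cases i)
    have "Re (W i) = of_nat l * a + of_nat m * b + (x * a + y * b)"
      by (simp add: W_def i a_def b_def algebra_simps)
    then show ?thesis using \<open>x * a + y * b > 0\<close> ab by (simp add: add_nonneg_pos)
  qed
  define C where "C = (1 / a + 1 / \<delta>) * (1 / b + 1 / \<delta>)"
  have "(\<lambda>i. norm (W i powr (- s))) summable_on UNIV \<and> ((\<lambda>i. W i powr (- s)) has_sum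
            (mellin (\<lambda>u. geom_ker x \<omega>1 (of_real u) * geom_ker y \<omega>2 (of_real u)) s / Gamma s)) UNIV"
  proof (rule mellin_has_sum[where A = "\<lambda>n. {..<n} \<times> {..<n}" and p = 2 and \<delta> = \<delta> and C = C])
    show "incseq (\<lambda>n::nat. {..<n} \<times> {..<n})" by (auto simp: incseq_def)
    have "(l, m) \<in> (\<Union>n. {..<n} \<times> {..<n})" for l m :: nat
      by (intro UN_I[of "Suc (max l m)"]) auto
    then show "(\<Union>n::nat. {..<n} \<times> {..<n}) = UNIV" by auto
    show "(\<lambda>n. \<Sum>i\<in>{..<n} \<times> {..<n}. exp (- W i * of_real u)) \<longlonglongrightarrow> geom_ker x \<omega>1 (of_real u) * geom_ker y \<omega>2 (of_real u)" if "u > 0" for u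
    proof -
      have "geom_ker x \<omega>1 (of_real u) * geom_ker y \<omega>2 (of_real u) =
         (exp (- of_real x * \<omega>1 * of_real u) * exp (- of_real y * \<omega>2 * of_real u)) *
         ((1 / (1 - exp (- \<omega>1 * of_real u))) * (1 / (1 - exp (- \<omega>2 * of_real u))))"
        by (simp add: geom_ker_def)
      then show ?thesis
        unfolding fact using tendsto_mult[OF tendsto_const tendsto_mult[OF lim_geom[OF w(1) that] lim_geom[OF w(2) that]]]
        by (simp only:)
    qed
    fix u :: real and n :: nat assume u: "u > 0"
    have "(\<Sum>l<n. exp (- a * u) ^ l) * (\<Sum>m<n. exp (- b * u) ^ m)
       \<le> ((1 / a + 1 / \<delta>) * u powr (-1) * exp (\<delta> * u)) * ((1 / b + 1 / \<delta>) * u powr (-1) * exp (\<delta> * u))"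
      using ab \<delta> u
      by (intro mult_mono order_trans[OF sum_geom_real_le geom_inverse_bound]) (auto intro!: sum_nonneg mult_nonneg_nonneg add_nonneg_nonneg)
    also have "\<dots> = C * (u powr (-1) * u powr (-1)) * (exp (\<delta> * u) * exp (\<delta> * u))" by (simp add: C_def)
    also have "u powr (-1) * u powr (-1) = u powr (-2)" by (subst powr_add[symmetric]) simp
    finally have "(\<Sum>i\<in>{..<n} \<times> {..<n}. exp (- Re (W i) * u)) \<le> exp (- (x * a + y * b) * u) * (C * u powr (-2) * (exp (\<delta> * u) * exp (\<delta> * u)))"
      unfolding factr by (intro mult_left_mono) auto
    also have "\<dots> = C * u powr (-2) * (exp (- (3 * \<delta>) * u) * exp (\<delta> * u) * exp (\<delta> * u))" 
    proof -
      have "x * a + y * b = 3 * \<delta>" by (simp add: \<delta>_def)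
      then show ?thesis by simp
    qed
    also have "exp (- (3 * \<delta>) * u) * exp (\<delta> * u) * exp (\<delta> * u) = exp (- \<delta> * u)"
      by (simp add: exp_add[symmetric])
    finally show "(\<Sum>i\<in>{..<n} \<times> {..<n}. exp (- Re (W i) * u)) \<le> C * u powr (-2) * exp (- \<delta> * u)" .
  qed (use \<delta> s reW in auto)
  then show ?A ?B by (auto simp: W_def case_prod_unfold)
qed

section \<open>Loops around the cut\<close>

text \<open>In this form the branch 0 < arg u < 2 pi is visibly holomorphic off the cut, because -u
  avoids the negative axis, where \<open>Ln\<close> jumps.\<close>

lemma cpow_2pi_eq_Ln:
  assumes "u \<notin> \<real>\<^sub>\<ge>\<^sub>0"
  shows "cpow_2pi u s = exp (s * (Ln (- u) + \<i> * of_real pi))"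
proof -
  have u: "u \<noteq> 0" using assms by auto
  have "Arg2pi u \<noteq> 0"
    using assms by (auto simp: Arg2pi_eq_0 complex_nonneg_Reals_iff complex_is_Real_iff)
  then have "Arg2pi u > 0" using Arg2pi[of u] by linarith
  then have "Arg2pi u = Im (Ln (- u)) + pi" by (rule Arg2pi_Ln)
  moreover have "ln (cmod u) = Re (Ln (- u))" using u by simp
  ultimately have "of_real (ln (cmod u)) + \<i> * of_real (Arg2pi u) = Ln (- u) + \<i> * of_real pi"
    by (simp add: complex_eq_iff)
  then show ?thesis by (simp add: cpow_2pi_def)
qed

lemma norm_cpow_2pi_le:
  assumes "u \<noteq> 0"
  shows "norm (cpow_2pi u s) \<le> exp (2 * pi * \<bar>Im s\<bar>) * norm u powr Re s"
proof -
  have "norm (cpow_2pi u s) = exp (- Im s * Arg2pi u) * norm u powr Re s"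
    using assms by (simp add: cpow_2pi_def powr_def flip: exp_add)
  also have "- Im s * Arg2pi u \<le> \<bar>- Im s * Arg2pi u\<bar>" by simp
  also have "\<dots> = \<bar>Im s\<bar> * Arg2pi u" using Arg2pi[of u] by (simp add: abs_mult)
  also have "\<dots> \<le> \<bar>Im s\<bar> * (2 * pi)" using Arg2pi[of u] by (intro mult_left_mono) auto
  finally show ?thesis by (simp add: mult_ac mult_right_mono)
qed

lemma contour_integral_horizontal:
  assumes ab: "a < b" and f: "continuous_on (closed_segment (Complex a y) (Complex b y)) f"
  shows "contour_integral (linepath (Complex a y) (Complex b y)) f = (LINT t:{a..b}|lborel. f (Complex t y))"
proof -
  have cont: "continuous_on {a..b} (\<lambda>t. f (Complex t y))"
  proof (rule continuous_on_compose2[OF f])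
    show "continuous_on {a..b} (\<lambda>t. Complex t y)" by (intro continuous_intros)
    show "(\<lambda>t. Complex t y) ` {a..b} \<subseteq> closed_segment (Complex a y) (Complex b y)"
      using ab by (auto simp: closed_segment_same_Im closed_segment_eq_real_ivl)
  qed
  have si: "set_integrable lborel {a..b} (\<lambda>t. f (Complex t y))"
    by (intro borel_integrable_atLeastAtMost' cont)
  have "(f has_contour_integral contour_integral (linepath (Complex a y) (Complex b y)) f) (linepath (Complex a y) (Complex b y))"
    by (intro has_contour_integral_integral contour_integrable_continuous_linepath f)
  \<comment> \<open>The segment is translated to the real axis, where a contour integral is an
    ordinary integral.\<close>
  then have "((\<lambda>u. f (u + \<i> * of_real y)) has_contour_integral contour_integral (linepath (Complex a y) (Complex b y)) f)
      (linepath (of_real a) (of_real b))"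
    unfolding has_contour_integral_linepath
    by (rule has_integral_eq[rotated]) (simp add: linepath_def Complex_eq algebra_simps scaleR_conv_of_real)
  then have "((\<lambda>t. f (Complex t y)) has_integral contour_integral (linepath (Complex a y) (Complex b y)) f) {a..b}"
    using ab by (subst (asm) has_contour_integral_linepath_Reals_iff) (auto simp: Complex_eq)
  then show ?thesis
    using set_borel_integral_eq_integral(2)[OF si] by (metis integral_unique)
qed

section \<open>Closing up the loop along the cut\<close>

lemma closed_segment_Re_bounds:
  assumes "u \<in> closed_segment a b"
  shows "min (Re a) (Re b) \<le> Re u" "Re u \<le> max (Re a) (Re b)"
    "min (Im a) (Im b) \<le> Im u" "Im u \<le> max (Im a) (Im b)"
proof -
  have "Re u \<in> closed_segment (Re a) (Re b)" "Im u \<in> closed_segment (Im a) (Im b)"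
    using assms by (auto simp: closed_segment_def in_segment) 
  then show "min (Re a) (Re b) \<le> Re u" "Re u \<le> max (Re a) (Re b)"
    "min (Im a) (Im b) \<le> Im u" "Im u \<le> max (Im a) (Im b)"
    by (auto simp: closed_segment_eq_real_ivl split: if_splits)
qed

lemma trunc_path_facts:
  assumes "is_loop Z \<gamma>" "T > 0"
  shows "valid_path (trunc_path \<gamma> T)" "pathstart (trunc_path \<gamma> T) = \<gamma> (- T)"
    "pathfinish (trunc_path \<gamma> T) = \<gamma> T" "path_image (trunc_path \<gamma> T) \<subseteq> range \<gamma>"
proof -
  have "\<gamma> piecewise_C1_differentiable_on {- T..T}" using assms(1) by (auto simp: is_loop_def)
  moreover have "(\<lambda>x. (2 * T) * x + (- T)) ` {0..1} \<subseteq> {- T..T}"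
    using assms(2) by (auto simp: mult_left_le)
  ultimately have "\<gamma> piecewise_C1_differentiable_on ((\<lambda>x. (2 * T) * x + (- T)) ` {0..1})"
    by (rule piecewise_C1_differentiable_on_subset)
  then have "(\<gamma> \<circ> (\<lambda>x. (2 * T) *\<^sub>R x + (- T))) piecewise_C1_differentiable_on {0..1}"
    by (rule piecewise_C1_differentiable_affine)
  moreover have "\<gamma> \<circ> (\<lambda>x. (2 * T) *\<^sub>R x + (- T)) = trunc_path \<gamma> T"
    by (auto simp: trunc_path_def fun_eq_iff algebra_simps)
  ultimately show "valid_path (trunc_path \<gamma> T)" by (simp add: valid_path_def)
qed (auto simp: trunc_path_def pathstart_def pathfinish_def path_image_def)

text \<open>A segment from -1 to a point off the nonnegative axis misses that axis. Hence the slit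
  strip is simply connected, and closed curves in it do not wind about points of the cut or points
  outside the strip.\<close>

lemma starlike_slit_strip:
  assumes "B > 0"
  shows "starlike ({u. \<bar>Im u\<bar> \<le> B} - \<real>\<^sub>\<ge>\<^sub>0)"
  unfolding starlike_def
proof (intro bexI[of _ "-1"] ballI subsetI)
  show "-1 \<in> {u. \<bar>Im u\<bar> \<le> B} - \<real>\<^sub>\<ge>\<^sub>0" using assms by (auto simp: complex_nonneg_Reals_iff)
  fix x w assume x: "x \<in> {u. \<bar>Im u\<bar> \<le> B} - \<real>\<^sub>\<ge>\<^sub>0" and w: "w \<in> closed_segment (-1) x"
  from w obtain t where t: "0 \<le> t" "t \<le> 1" and w_eq: "w = (1 - t) *\<^sub>R (-1) + t *\<^sub>R x"
    by (auto simp: in_segment)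
  have im: "Im w = t * Im x" and re: "Re w = t - 1 + t * Re x" by (auto simp: w_eq algebra_simps)
  have "\<bar>Im w\<bar> \<le> 1 * \<bar>Im x\<bar>" unfolding im abs_mult using t by (intro mult_right_mono) auto
  moreover have "w \<notin> \<real>\<^sub>\<ge>\<^sub>0"
  proof
    assume "w \<in> \<real>\<^sub>\<ge>\<^sub>0"
    then have *: "Im w = 0" "Re w \<ge> 0" by (auto simp: complex_nonneg_Reals_iff)
    have "t \<noteq> 0" using * re by auto
    then have "Im x = 0" using * im by auto
    moreover have "t * Re x \<ge> 0" using * re t by linarith
    then have "Re x \<ge> 0" using \<open>t \<noteq> 0\<close> t by (simp add: zero_le_mult_iff)
    ultimately show False using x by (auto simp: complex_nonneg_Reals_iff)
  qed
  ultimately show "w \<in> {u. \<bar>Im u\<bar> \<le> B} - \<real>\<^sub>\<ge>\<^sub>0" using x by auto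
qed

lemma starlike_Un_convex:
  assumes "convex A" "convex B" "a \<in> A" "a \<in> B"
  shows "starlike (A \<union> B)"
  unfolding starlike_def using assms closed_segment_subset[of a A] closed_segment_subset[of a B]
  by (intro bexI[of _ a]) auto

text \<open>The margin is 2 \<eta>, so that the contour at distance \<eta> from the cut lies in the
  interior.\<close>

definition strip :: "real \<Rightarrow> complex set" where
  "strip \<eta> = {u. Re u > - (2 * \<eta>) \<and> \<bar>Im u\<bar> < 2 * \<eta>}"

lemma strip_alt: "strip \<eta> = {u. Re u > - (2 * \<eta>)} \<inter> {u. Im u < 2 * \<eta>} \<inter> {u. Im u > - (2 * \<eta>)}"
  by (auto simp: strip_def abs_less_iff)

lemma open_strip: "open (strip \<eta>)"
  unfolding strip_alt by (intro open_Int open_halfspace_Re_gt open_halfspace_Im_lt open_halfspace_Im_gt)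

lemma convex_strip: "convex (strip \<eta>)"
  unfolding strip_alt by (intro convex_Int convex_halfspace_Re_gt convex_halfspace_Im_lt convex_halfspace_Im_gt)

text \<open>The loop is closed up through the three-sided contour at distance \<open>\<eta>\<close> from the cut. The
  resulting closed curve has winding number 0 about every pole: the poles in the strip that the curve
  lies in are finitely many, and about these only the far right end of the curve matters.\<close>

theorem loop_tendsto:
  fixes f :: "complex \<Rightarrow> complex"
  assumes loop: "is_loop Z \<gamma>"
    and Z: "closed Z" and finZ: "\<And>B. finite (Z \<inter> {u. \<bar>Im u\<bar> \<le> B})"
    and \<eta>: "\<eta> > 0" and Z_strip: "Z \<inter> strip \<eta> \<subseteq> {0}"
    and hol: "f holomorphic_on - (Z \<union> \<real>\<^sub>\<ge>\<^sub>0)"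
    and decay: "\<And>B e. e > 0 \<Longrightarrow> \<exists>R. \<forall>u. Re u \<ge> R \<longrightarrow> \<bar>Im u\<bar> \<le> B \<longrightarrow> norm (f u) \<le> e"
    and up: "((\<lambda>X. contour_integral (linepath (Complex (- \<eta>) \<eta>) (Complex X \<eta>)) f) \<longlongrightarrow> Ju) at_top"
    and low: "((\<lambda>X. contour_integral (linepath (Complex (- \<eta>) (- \<eta>)) (Complex X (- \<eta>))) f) \<longlongrightarrow> Jl) at_top"
  shows "((\<lambda>T. contour_integral (trunc_path \<gamma> T) f) \<longlongrightarrow>
     Jl - Ju + contour_integral (linepath (Complex (- \<eta>) \<eta>) (Complex (- \<eta>) (- \<eta>))) f) at_top"
proof -
  define A where "A = Complex (- \<eta>) \<eta>"
  define A' where "A' = Complex (- \<eta>) (- \<eta>)"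
  define p where "p T = \<gamma> (- T)" for T
  define P where "P T = Complex (Re (p T)) \<eta>" for T
  define Q where "Q T = Complex (Re (\<gamma> T)) (- \<eta>)" for T
  define S where "S = - (Z \<union> \<real>\<^sub>\<ge>\<^sub>0)"
  have openS: "open S" unfolding S_def using Z by (intro open_Compl closed_Un closed_nonneg_Reals_complex)
  have contf: "continuous_on S f" using hol S_def holomorphic_on_imp_continuous_on by blast
  have g_off: "\<gamma> t \<notin> \<real>\<^sub>\<ge>\<^sub>0" "\<gamma> t \<notin> Z" for t using loop by (auto simp: is_loop_def)
  obtain B0 where B0: "\<And>t. \<bar>Im (\<gamma> t)\<bar> \<le> B0"
    using loop unfolding is_loop_def bounded_iff by auto
  \<comment> \<open>One horizontal strip for both the loop and the contour that closes it.\<close>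
  define B where "B = max B0 \<eta>"
  have B: "B > 0" "\<eta> \<le> B" "\<And>t. \<bar>Im (\<gamma> t)\<bar> \<le> B" using \<eta> B0 by (auto simp: B_def intro: max.coboundedI1)
  define Zf where "Zf = Z \<inter> {u. \<bar>Im u\<bar> \<le> B}"
  have "finite Zf" using finZ by (simp add: Zf_def)
  then have "finite (Re ` Zf)" by simp
  \<comment> \<open>To the right of R0 the strip contains no pole; inserting 0 also puts the
    vertical end pieces to the right of the origin.\<close>
  define R0 where "R0 = Max (insert 0 (Re ` Zf))"
  have R0: "R0 \<ge> 0" "\<And>w. w \<in> Zf \<Longrightarrow> Re w \<le> R0"
    unfolding R0_def using \<open>finite (Re ` Zf)\<close> by (auto intro!: Max_ge)
  have lim_p: "filterlim (\<lambda>T. Re (p T)) at_top at_top"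
    unfolding p_def using loop filterlim_compose[of "\<lambda>t. Re (\<gamma> t)" at_top at_bot "\<lambda>t. - t" at_top]
    by (auto simp: is_loop_def filterlim_uminus_at_bot_at_top)
  have lim_q: "filterlim (\<lambda>T. Re (\<gamma> T)) at_top at_top"
    using loop by (auto simp: is_loop_def)
  have im_p: "\<forall>\<^sub>F T in at_top. Im (p T) > 0"
    unfolding p_def using loop filterlim_uminus_at_bot_at_top
    by (auto simp: is_loop_def filterlim_iff)
  have im_q: "\<forall>\<^sub>F T in at_top. Im (\<gamma> T) < 0" using loop by (auto simp: is_loop_def)
  have "\<forall>w\<in>Zf - {0}. \<forall>\<^sub>F T in at_top. winding_number (trunc_path \<gamma> T +++ linepath (\<gamma> T) (p T)) w = 0"
  proof
    fix w assume w: "w \<in> Zf - {0}"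
    have "\<forall>p \<in> insert 0 Z. \<forall>\<^sub>F T in at_top.
        winding_number (trunc_path \<gamma> T +++ linepath (\<gamma> T) (\<gamma> (- T))) p = (if p = 0 then 1 else 0)"
      using loop unfolding is_loop_def by blast
    from bspec[OF this, of w] w
    show "\<forall>\<^sub>F T in at_top. winding_number (trunc_path \<gamma> T +++ linepath (\<gamma> T) (p T)) w = 0"
      by (simp add: Zf_def p_def)
  qed
  \<comment> \<open>The winding number condition holds eventually for each pole separately;
    finiteness makes it hold for all of them at once.\<close>
  then have wind: "\<forall>\<^sub>F T in at_top. \<forall>w\<in>Zf - {0}. winding_number (trunc_path \<gamma> T +++ linepath (\<gamma> T) (p T)) w = 0"
    using \<open>finite Zf\<close> by (intro eventually_ball_finite) auto
  define good where "good T \<longleftrightarrow> T > 0 \<and> Re (p T) > R0 \<and> Re (\<gamma> T) > R0 \<and> Im (p T) > 0 \<and> Im (\<gamma> T) < 0 \<and>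
      (\<forall>w\<in>Zf - {0}. winding_number (trunc_path \<gamma> T +++ linepath (\<gamma> T) (p T)) w = 0)" for T
  have good: "\<forall>\<^sub>F T in at_top. good T"
    unfolding good_def using lim_p lim_q im_p im_q wind
    by (intro eventually_conj) (auto simp: filterlim_at_top_dense eventually_gt_at_top)
  have seg_right: "closed_segment u v \<subseteq> S"
    if "Re u > R0" "Re v > R0" "\<bar>Im u\<bar> \<le> B" "\<bar>Im v\<bar> \<le> B" "Im u > 0 \<and> Im v > 0 \<or> Im u < 0 \<and> Im v < 0" for u v
  proof
    fix w assume w: "w \<in> closed_segment u v"
    have "Re w > R0" "\<bar>Im w\<bar> \<le> B" "Im w \<noteq> 0"
      using closed_segment_Re_bounds[OF w] that by (auto simp: min_def max_def split: if_splits)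
    then show "w \<in> S" using R0(2)[of w] by (auto simp: S_def Zf_def complex_nonneg_Reals_iff)
  qed
  have strip_S: "w \<in> S" if "w \<in> strip \<eta>" "w \<notin> \<real>\<^sub>\<ge>\<^sub>0" for w
    using that Z_strip by (auto simp: S_def)
  have seg_strip: "closed_segment u v \<subseteq> S \<inter> strip \<eta>"
    if "Re u \<ge> - \<eta>" "Re v \<ge> - \<eta>" "\<bar>Im u\<bar> \<le> \<eta>" "\<bar>Im v\<bar> \<le> \<eta>" "Im u = \<eta> \<and> Im v = \<eta> \<or> Im u = - \<eta> \<and> Im v = - \<eta> \<or> Re u = - \<eta> \<and> Re v = - \<eta>" for u v
  proof
    fix w assume w: "w \<in> closed_segment u v"
    have "Re w \<ge> - \<eta>" "\<bar>Im w\<bar> \<le> \<eta>" "Im w \<noteq> 0 \<or> Re w < 0"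
      using closed_segment_Re_bounds[OF w] that \<eta> by (auto simp: min_def max_def split: if_splits)
    then show "w \<in> S \<inter> strip \<eta>" using strip_S[of w] \<eta> by (auto simp: strip_def complex_nonneg_Reals_iff)
  qed
  have main: "contour_integral (trunc_path \<gamma> T) f =
      contour_integral (linepath A' (Q T)) f - contour_integral (linepath A (P T)) f
      + contour_integral (linepath A A') f
      - contour_integral (linepath (\<gamma> T) (Q T)) f - contour_integral (linepath (P T) (p T)) f"
    if "good T" for T
  proof -
    have T: "T > 0" "Re (p T) > R0" "Re (\<gamma> T) > R0" "Im (p T) > 0" "Im (\<gamma> T) < 0"
      "\<And>w. w \<in> Zf - {0} \<Longrightarrow> winding_number (trunc_path \<gamma> T +++ linepath (\<gamma> T) (p T)) w = 0"
      using that by (auto simp: good_def)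
    define q where "q = \<gamma> T"
    define t where "t = trunc_path \<gamma> T"
    have t: "valid_path t" "pathstart t = p T" "pathfinish t = q" "path_image t \<subseteq> range \<gamma>"
      using trunc_path_facts[OF loop T(1)] by (auto simp: t_def p_def q_def)
    \<comment> \<open>From the end of the loop vertically to the lower side, inwards along it, up
      the left side, outwards along the upper side, and vertically to the start of the loop.\<close>
    define l where "l = linepath q (Q T) +++ linepath (Q T) A' +++ linepath A' A +++ linepath A (P T) +++ linepath (P T) (p T)"
    have imB: "\<bar>Im (p T)\<bar> \<le> B" "\<bar>Im q\<bar> \<le> B" using B by (auto simp: p_def q_def)
    have s1: "closed_segment q (Q T) \<subseteq> S" "closed_segment (P T) (p T) \<subseteq> S"
      using T imB B(1,2) \<eta> by (intro seg_right; simp add: Q_def P_def q_def)+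
    have s2: "closed_segment (Q T) A' \<subseteq> S \<inter> strip \<eta>" "closed_segment A' A \<subseteq> S \<inter> strip \<eta>" "closed_segment A (P T) \<subseteq> S \<inter> strip \<eta>"
      using T R0(1) \<eta> by (intro seg_strip; simp add: Q_def P_def A_def A'_def)+
    have tS: "path_image t \<subseteq> S" using t(4) g_off by (auto simp: S_def)
    have lval: "valid_path l" "pathstart l = q" "pathfinish l = p T" by (auto simp: l_def)
    have limg: "path_image l = closed_segment q (Q T) \<union> closed_segment (Q T) A' \<union> closed_segment A' A \<union> closed_segment A (P T) \<union> closed_segment (P T) (p T)"
      by (simp add: l_def path_image_join Un_assoc)
    have lS: "path_image l \<subseteq> S" using limg s1 s2 by auto
    have lcl: "\<bar>Im w\<bar> \<le> B" if "w \<in> path_image l" for w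
    proof -
      have *: "\<bar>Im w\<bar> \<le> B" if "w \<in> closed_segment u v" "\<bar>Im u\<bar> \<le> B" "\<bar>Im v\<bar> \<le> B" for u v
        using closed_segment_Re_bounds[OF that(1)] that(2,3) by (auto simp: min_def max_def split: if_splits)
      have "\<bar>Im (Q T)\<bar> \<le> B" "\<bar>Im (P T)\<bar> \<le> B" "\<bar>Im A\<bar> \<le> B" "\<bar>Im A'\<bar> \<le> B"
        using B(1,2) \<eta> by (auto simp: Q_def P_def A_def A'_def)
      then show ?thesis using that imB unfolding limg by (auto intro: *)
    qed
    define K where "K = {u. \<bar>Im u\<bar> \<le> B} - \<real>\<^sub>\<ge>\<^sub>0"
    have tlK: "path_image (t +++ l) \<subseteq> K" "path_image (t +++ l) \<subseteq> S"
      using t lS tS lval lcl B g_off by (auto simp: path_image_join K_def S_def)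
    \<comment> \<open>The points outside \<open>S\<close> are the poles and the cut. Unless such a
      point is a pole in the slit strip \<open>K\<close>, the curve lies in the simply connected set
      \<open>K\<close> that omits it.\<close>
    have w0: "winding_number (t +++ l) w = 0" if "w \<notin> S" for w
    proof (cases "w \<in> K")
      case False
      have "simply_connected K" unfolding K_def by (intro starlike_imp_simply_connected starlike_slit_strip B)
      then show ?thesis
        using False tlK t lval by (intro simply_connected_imp_winding_number_zero) (auto intro: valid_path_imp_path)
    next
      case True
      then have w: "w \<in> Zf" "w \<noteq> 0" "w \<in> Z" using that by (auto simp: S_def K_def Zf_def)
      have Rew: "Re w \<le> R0" using R0 w by auto
      \<comment> \<open>The strip and a right half-plane form a simply connected set without the
        pole w. It contains the closing contour and the chord between the ends of the loop, so these
        together do not wind about w. Neither does the loop with the opposite chord, by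
        \<open>is_loop\<close>, and the chords cancel.\<close>
      define M where "M = strip \<eta> \<union> {u. Re u > R0}"
      have "simply_connected M" unfolding M_def
        using \<eta> R0(1) by (intro starlike_imp_simply_connected starlike_Un_convex[of _ _ "of_real (R0 + 1)"] convex_strip convex_halfspace_Re_gt)
          (auto simp: strip_def)
      moreover have wM: "w \<notin> M" using Rew Z_strip w by (auto simp: M_def)
      moreover have segr: "Re u > R0" if "u \<in> closed_segment q (p T)" for u
        using closed_segment_Re_bounds[OF that] T by (auto simp: q_def min_def split: if_splits)
      have segr2: "Re u > R0" if "u \<in> closed_segment q (Q T) \<union> closed_segment (P T) (p T)" for u
        using that closed_segment_Re_bounds T by (fastforce simp: q_def Q_def P_def min_def split: if_splits)
      have lM: "path_image l \<subseteq> M"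
        using limg s2 segr2 by (auto simp: M_def)
      have "path_image (linepath (p T) q +++ l) \<subseteq> M"
        using lM segr lval by (auto simp: path_image_join M_def closed_segment_commute)
      ultimately have "winding_number (linepath (p T) q +++ l) w = 0"
        using lval by (intro simply_connected_imp_winding_number_zero[of M]) (auto intro: valid_path_imp_path)
      moreover have wl: "w \<notin> path_image l" using lM wM by auto
      moreover have wseg: "w \<notin> closed_segment q (p T)" using segr Rew by force
      ultimately have 1: "winding_number (linepath (p T) q) w + winding_number l w = 0"
        using lval by (subst (asm) winding_number_join) (auto simp: closed_segment_commute valid_path_imp_path)
      have wt: "w \<notin> path_image t" using tS that by auto
      have 2: "winding_number t w + winding_number (linepath q (p T)) w = 0"
        using T(6)[of w] w wt wseg t winding_number_join[of t w "linepath q (p T)"]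
        by (auto simp: t_def q_def valid_path_imp_path)
      have 3: "winding_number (linepath (p T) q) w = - winding_number (linepath q (p T)) w"
        using winding_number_reversepath[of "linepath q (p T)" w] wseg by simp
      have "winding_number (t +++ l) w = winding_number t w + winding_number l w"
        using wt wl t lval by (intro winding_number_join) (auto simp: valid_path_imp_path)
      then show ?thesis using 1 2 3 by (simp add: add_eq_0_iff)
    qed
    \<comment> \<open>The homology form of Cauchy's theorem: the winding number vanishes about every
      point where f may fail to be holomorphic.\<close>
    have "(f has_contour_integral 0) (t +++ l)"
      using Cauchy_theorem_global[OF openS _ _ _ tlK(2) w0, of f] hol t lval by (auto simp: S_def)
    moreover have ct: "f contour_integrable_on t"
      using contour_integrable_holomorphic_simple[OF _ openS t(1) tS] hol by (simp add: S_def)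
    have cl: "f contour_integrable_on linepath u v" if "closed_segment u v \<subseteq> S" for u v
      using contf that by (intro contour_integrable_continuous_linepath) (rule continuous_on_subset)
    have ints: "f contour_integrable_on linepath q (Q T)" "f contour_integrable_on linepath (Q T) A'"
      "f contour_integrable_on linepath A' A" "f contour_integrable_on linepath A (P T)" "f contour_integrable_on linepath (P T) (p T)"
      using s1 s2 by (auto intro!: cl)
    have "contour_integral l f = contour_integral (linepath q (Q T)) f + contour_integral (linepath (Q T) A') f
       + contour_integral (linepath A' A) f + contour_integral (linepath A (P T)) f + contour_integral (linepath (P T) (p T)) f"
      unfolding l_def using ints by (simp add: contour_integrable_join)
    moreover have "f contour_integrable_on l"
      using contour_integrable_holomorphic_simple[OF _ openS lval(1) lS] hol by (simp add: S_def)
    ultimately have "contour_integral t f + (contour_integral (linepath q (Q T)) f + contour_integral (linepath (Q T) A') f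
       + contour_integral (linepath A' A) f + contour_integral (linepath A (P T)) f + contour_integral (linepath (P T) (p T)) f) = 0"
      using ct t lval by (metis contour_integral_join contour_integral_unique)
    moreover have "contour_integral (linepath (Q T) A') f = - contour_integral (linepath A' (Q T)) f"
      "contour_integral (linepath A' A) f = - contour_integral (linepath A A') f"
      using s2 contf by (auto intro!: contour_integral_reverse_linepath intro: continuous_on_subset)
    ultimately show ?thesis by (simp add: t_def q_def algebra_simps add_eq_0_iff)
  qed
  \<comment> \<open>The vertical end pieces have bounded length, while the integrand decays
    uniformly in the strip.\<close>
  have small: "((\<lambda>T. contour_integral (linepath (u T) (v T)) f) \<longlongrightarrow> 0) at_top"
    if ev: "\<forall>\<^sub>F T in at_top. closed_segment (u T) (v T) \<subseteq> S \<and> Re (u T) = x T \<and> Re (v T) = x T \<and> \<bar>Im (u T)\<bar> \<le> B \<and> \<bar>Im (v T)\<bar> \<le> B"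
      and x: "filterlim x at_top at_top" for u v :: "real \<Rightarrow> complex" and x
  proof (rule tendstoI)
    fix e :: real assume e: "e > 0"
    define e' where "e' = e / (4 * B)"
    have e': "e' > 0" using e B by (simp add: e'_def)
    obtain R where R: "\<And>u. Re u \<ge> R \<Longrightarrow> \<bar>Im u\<bar> \<le> B \<Longrightarrow> norm (f u) \<le> e'" using decay[OF e', of B] by blast
    have "\<forall>\<^sub>F T in at_top. x T \<ge> R" using x by (simp add: filterlim_at_top)
    with ev show "\<forall>\<^sub>F T in at_top. dist (contour_integral (linepath (u T) (v T)) f) 0 < e"
    proof eventually_elim
      case (elim T)
      have "norm (contour_integral (linepath (u T) (v T)) f) \<le> e' * norm (v T - u T)"
      proof (rule contour_integral_bound_linepath)
        show "f contour_integrable_on linepath (u T) (v T)"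
          using contf elim by (intro contour_integrable_continuous_linepath) (auto intro: continuous_on_subset)
        show "norm (f w) \<le> e'" if "w \<in> closed_segment (u T) (v T)" for w
          using closed_segment_Re_bounds[OF that] elim by (intro R) (auto simp: min_def max_def abs_le_iff split: if_splits)
      qed (use e' in auto)
      also have "norm (v T - u T) \<le> \<bar>Im (v T - u T)\<bar>"
        using elim cmod_le[of "v T - u T"] by simp
      also have "\<dots> \<le> 2 * B" using elim by (auto simp: abs_le_iff)
      finally have "norm (contour_integral (linepath (u T) (v T)) f) \<le> e' * (2 * B)" using e' by simp
      also have "\<dots> < e" using e B by (simp add: e'_def)
      finally show ?case by simp
    qed
  qed
  have sm1: "((\<lambda>T. contour_integral (linepath (\<gamma> T) (Q T)) f) \<longlongrightarrow> 0) at_top"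
  proof (rule small[OF _ lim_q])
    show "\<forall>\<^sub>F T in at_top. closed_segment (\<gamma> T) (Q T) \<subseteq> S \<and> Re (\<gamma> T) = Re (\<gamma> T) \<and> Re (Q T) = Re (\<gamma> T) \<and> \<bar>Im (\<gamma> T)\<bar> \<le> B \<and> \<bar>Im (Q T)\<bar> \<le> B"
      using good
    proof eventually_elim
      case (elim T)
      then show ?case
        using B(1,2) B(3)[of T] \<eta> by (intro conjI seg_right; simp add: good_def Q_def)
    qed
  qed
  have sm2: "((\<lambda>T. contour_integral (linepath (P T) (p T)) f) \<longlongrightarrow> 0) at_top"
  proof (rule small[OF _ lim_p])
    show "\<forall>\<^sub>F T in at_top. closed_segment (P T) (p T) \<subseteq> S \<and> Re (P T) = Re (p T) \<and> Re (p T) = Re (p T) \<and> \<bar>Im (P T)\<bar> \<le> B \<and> \<bar>Im (p T)\<bar> \<le> B"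
      using good
    proof eventually_elim
      case (elim T)
      then show ?case
        using B(1,2) B(3)[of "- T"] \<eta> by (intro conjI seg_right; simp add: good_def P_def p_def)
    qed
  qed
  have "((\<lambda>T. contour_integral (linepath A' (Q T)) f - contour_integral (linepath A (P T)) f
      + contour_integral (linepath A A') f
      - contour_integral (linepath (\<gamma> T) (Q T)) f - contour_integral (linepath (P T) (p T)) f) \<longlongrightarrow>
      Jl - Ju + contour_integral (linepath A A') f - 0 - 0) at_top"
    unfolding A_def A'_def P_def[abs_def] Q_def[abs_def]
    using sm1 sm2 filterlim_compose[OF up lim_p] filterlim_compose[OF low lim_q]
    by (intro tendsto_intros) (auto simp: P_def[abs_def] Q_def[abs_def])
  then have "((\<lambda>T. contour_integral (trunc_path \<gamma> T) f) \<longlongrightarrow> Jl - Ju + contour_integral (linepath A A') f - 0 - 0) at_top"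
    by (rule Lim_transform_eventually) (use good main in \<open>auto elim!: eventually_mono\<close>)
  then show ?thesis by (simp add: A_def A'_def)
qed

section \<open>Hankel integrals\<close>

lemma set_integrable_exp_Ici:
  fixes \<epsilon> a :: real
  assumes "\<epsilon> > 0"
  shows "set_integrable lborel {a..} (\<lambda>t. exp (- \<epsilon> * t))"
proof -
  have "(\<lambda>t. exp (- \<epsilon> * t)) absolutely_integrable_on {a..}"
    using assms by (intro nonnegative_absolutely_integrable_1 integrable_on_exp_minus_to_infinity) auto
  then show ?thesis
    unfolding set_integrable_def
    by (subst (asm) integrable_completion)
       (auto intro!: borel_measurable_continuous_on_indicator continuous_intros)
qed

lemma powr_le_exp:
  fixes a e m :: real
  assumes "e > 0" "m > 0"
  shows "\<exists>K\<ge>0. \<forall>y\<ge>m. y powr a \<le> K * exp (e * y)"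
proof (cases "a > 0")
  case True
  \<comment> \<open>The constant comes from ln t \<le> t - 1 at t = e y / a.\<close>
  show ?thesis
  proof (intro exI[of _ "exp (- a - a * ln (e / a))"] conjI allI impI)
    fix y assume y: "y \<ge> m"
    then have y0: "y > 0" using assms by linarith
    have "ln (e / a * y) \<le> e / a * y - 1"
      using True assms y0 by (intro ln_le_minus_one) auto
    moreover have "ln (e / a * y) = ln (e / a) + ln y"
      using True assms y0 by (intro ln_mult_pos) auto
    ultimately have "a * ln y \<le> a * (e / a * y - 1 - ln (e / a))"
      using True by (intro mult_left_mono) auto
    also have "\<dots> = - a - a * ln (e / a) + e * y"
      using True by (simp add: field_simps)
    finally have "a * ln y \<le> - a - a * ln (e / a) + e * y" .
    then show "y powr a \<le> exp (- a - a * ln (e / a)) * exp (e * y)"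
      using y0 by (simp add: powr_def flip: exp_add)
  qed auto
next
  case False
  show ?thesis
  proof (intro exI[of _ "m powr a"] conjI allI impI)
    fix y assume y: "y \<ge> m"
    have "y powr a \<le> m powr a" using False assms y by (intro powr_mono2') auto
    also have "\<dots> \<le> m powr a * exp (e * y)"
      using assms y by (intro mult_left_mono[of 1 "exp (e * y)" "m powr a", unfolded mult_1_right]) auto
    finally show "y powr a \<le> m powr a * exp (e * y)" .
  qed auto
qed

text \<open>In a horizontal strip bounded on the left, |u| exceeds Re u by at most a constant, so
  the bound for real arguments carries over.\<close>

lemma norm_powr_le_exp:
  fixes a e m B :: real
  assumes "e > 0" "m > 0"
  shows "\<exists>K\<ge>0. \<forall>u. m \<le> norm u \<and> - m \<le> Re u \<and> \<bar>Im u\<bar> \<le> B \<longrightarrow> norm u powr a \<le> K * exp (e * Re u)"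
proof -
  obtain K where K: "K \<ge> 0" "\<And>y. y \<ge> m \<Longrightarrow> y powr a \<le> K * exp (e * y)"
    using powr_le_exp[OF assms, of a] by blast
  show ?thesis
  proof (intro exI[of _ "K * exp (e * (2 * m + B))"] conjI allI impI)
    fix u assume u: "m \<le> norm u \<and> - m \<le> Re u \<and> \<bar>Im u\<bar> \<le> B"
    have "norm u powr a \<le> K * exp (e * norm u)" using K(2) u by auto
    also have "norm u \<le> Re u + (2 * m + B)"
      using cmod_le[of u] u assms by linarith
    then have "K * exp (e * norm u) \<le> K * exp (e * (Re u + (2 * m + B)))"
      using K(1) assms by (intro mult_left_mono) auto
    finally show "norm u powr a \<le> K * exp (e * (2 * m + B)) * exp (e * Re u)"
      by (simp add: exp_add[symmetric] algebra_simps)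
  qed (use K in auto)
qed

text \<open>The exponent is s - 3 and not s - 1 because \<psi> stands for u^2 times the kernel whose
  Mellin transform is taken; the factor clears a pole of order at most two at 0.\<close>

definition hankel_integrand :: "(complex \<Rightarrow> complex) \<Rightarrow> complex \<Rightarrow> complex \<Rightarrow> complex" where
  "hankel_integrand \<psi> s u = cpow_2pi u (s - 3) * \<psi> u"

text \<open>The orientation is inwards along the upper side, down the left side (whence -i), and
  outwards along the lower side. The sides are written as Lebesgue integrals so that holomorphy in s
  follows by differentiation under the integral.\<close>

definition hankel_integral :: "(complex \<Rightarrow> complex) \<Rightarrow> real \<Rightarrow> complex \<Rightarrow> complex" where
  "hankel_integral \<psi> \<eta> s =
     (LINT t:{- \<eta>..}|lborel. hankel_integrand \<psi> s (Complex t (- \<eta>)))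
   - (LINT t:{- \<eta>..}|lborel. hankel_integrand \<psi> s (Complex t \<eta>))
   - \<i> * (LINT t:{- \<eta>..\<eta>}|lborel. hankel_integrand \<psi> s (Complex (- \<eta>) t))"

text \<open>\<psi> is holomorphic across the cut, so that only the power jumps there.\<close>

locale hankel =
  fixes \<psi> :: "complex \<Rightarrow> complex" and \<eta> \<delta> C :: real
  assumes eta: "\<eta> > 0" and delta: "\<delta> > 0"
    and hol: "\<psi> holomorphic_on strip \<eta>"
    and bound: "\<And>u. u \<in> strip \<eta> \<Longrightarrow> norm (\<psi> u) \<le> C * exp (- \<delta> * Re u)"
begin

abbreviation "F \<equiv> hankel_integrand \<psi>"

lemma C_nonneg: "C \<ge> 0"
proof -
  have "0 \<le> norm (\<psi> 0)" by simp
  also have "\<dots> \<le> C" using bound[of 0] eta by (simp add: strip_def)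
  finally show ?thesis .
qed

lemma F_holomorphic: "F s holomorphic_on strip \<eta> - \<real>\<^sub>\<ge>\<^sub>0"
proof -
  have "(\<lambda>u. exp ((s - 3) * (Ln (- u) + \<i> * of_real pi)) * \<psi> u) holomorphic_on strip \<eta> - \<real>\<^sub>\<ge>\<^sub>0"
    by (intro holomorphic_intros holomorphic_on_subset[OF hol])
       (auto simp: complex_nonpos_Reals_iff complex_nonneg_Reals_iff)
  then show ?thesis
    by (rule holomorphic_transform) (auto simp: hankel_integrand_def cpow_2pi_eq_Ln)
qed

lemma F_entire: "(\<lambda>s. F s u) holomorphic_on UNIV"
  unfolding hankel_integrand_def cpow_2pi_def by (intro holomorphic_intros)

text \<open>Uniform for s in a box, as domination requires. Half of the decay of \<psi> absorbs the
  power of u, which cannot blow up because u keeps the distance \<eta> from 0.\<close>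

lemma F_bound:
  "\<exists>K\<ge>0. \<forall>s u. A \<le> Re s \<and> Re s \<le> B \<and> \<bar>Im s\<bar> \<le> D \<and> \<eta> \<le> norm u \<and> - \<eta> \<le> Re u \<and> \<bar>Im u\<bar> \<le> \<eta>
     \<longrightarrow> norm (F s u) \<le> K * exp (- (\<delta> / 2) * Re u)"
proof -
  obtain K1 where K1: "K1 \<ge> 0" "\<And>u. \<eta> \<le> norm u \<Longrightarrow> - \<eta> \<le> Re u \<Longrightarrow> \<bar>Im u\<bar> \<le> \<eta> \<Longrightarrow> norm u powr (A - 3) \<le> K1 * exp (\<delta> / 2 * Re u)"
    using norm_powr_le_exp[of "\<delta> / 2" \<eta> \<eta> "A - 3"] eta delta by auto
  obtain K2 where K2: "K2 \<ge> 0" "\<And>u. \<eta> \<le> norm u \<Longrightarrow> - \<eta> \<le> Re u \<Longrightarrow> \<bar>Im u\<bar> \<le> \<eta> \<Longrightarrow> norm u powr (B - 3) \<le> K2 * exp (\<delta> / 2 * Re u)"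
    using norm_powr_le_exp[of "\<delta> / 2" \<eta> \<eta> "B - 3"] eta delta by auto
  show ?thesis
  proof (intro exI[of _ "exp (2 * pi * D) * (K1 + K2) * C"] conjI allI impI)
    fix s u assume *: "A \<le> Re s \<and> Re s \<le> B \<and> \<bar>Im s\<bar> \<le> D \<and> \<eta> \<le> norm u \<and> - \<eta> \<le> Re u \<and> \<bar>Im u\<bar> \<le> \<eta>"
    then have u0: "norm u > 0" "u \<noteq> 0" using eta by auto
    have us: "u \<in> strip \<eta>" using * eta by (auto simp: strip_def)
    have "norm (cpow_2pi u (s - 3)) \<le> exp (2 * pi * \<bar>Im (s - 3)\<bar>) * norm u powr Re (s - 3)"
      using u0 by (intro norm_cpow_2pi_le)
    also have "\<dots> \<le> exp (2 * pi * D) * (norm u powr (A - 3) + norm u powr (B - 3))"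
      using * u0 by (intro mult_mono powr_le_sum_powr) auto
    also have "\<dots> \<le> exp (2 * pi * D) * ((K1 + K2) * exp (\<delta> / 2 * Re u))"
      using K1(2)[of u] K2(2)[of u] * by (intro mult_left_mono) (auto simp: algebra_simps)
    finally have "norm (F s u) \<le> (exp (2 * pi * D) * ((K1 + K2) * exp (\<delta> / 2 * Re u))) * (C * exp (- \<delta> * Re u))"
      unfolding hankel_integrand_def norm_mult using bound[OF us] K1(1) K2(1) by (intro mult_mono) auto
    also have "\<dots> = exp (2 * pi * D) * (K1 + K2) * C * (exp (\<delta> / 2 * Re u) * exp (- \<delta> * Re u))" by simp
    also have "exp (\<delta> / 2 * Re u) * exp (- \<delta> * Re u) = exp (- (\<delta> / 2) * Re u)"
      by (simp add: exp_add[symmetric])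
    finally show "norm (F s u) \<le> exp (2 * pi * D) * (K1 + K2) * C * exp (- (\<delta> / 2) * Re u)" .
  qed (use K1 K2 C_nonneg in auto)
qed

text \<open>Serves all three sides of the contour: what counts is the distance from 0, the position
  in the strip, and integrable decay along the curve.\<close>

lemma F_curve:
  assumes E: "E \<in> sets borel" and c: "continuous_on E c"
    and cin: "\<And>t. t \<in> E \<Longrightarrow> \<eta> \<le> norm (c t) \<and> - \<eta> \<le> Re (c t) \<and> \<bar>Im (c t)\<bar> \<le> \<eta> \<and> c t \<notin> \<real>\<^sub>\<ge>\<^sub>0"
    and int: "set_integrable lborel E (\<lambda>t. exp (- (\<delta> / 2) * Re (c t)))"
  shows "set_integrable lborel E (\<lambda>t. F s (c t))"
    and "(\<lambda>s. LINT t:E|lborel. F s (c t)) holomorphic_on UNIV"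
proof -
  have contF: "continuous_on E (\<lambda>t. F s (c t))" for s
    by (rule continuous_on_compose2[OF holomorphic_on_imp_continuous_on[OF F_holomorphic] c])
       (use cin eta in \<open>force simp: strip_def\<close>)
  have meas: "(\<lambda>t. indicat_real E t *\<^sub>R F s (c t)) \<in> borel_measurable lborel" for s
    using borel_measurable_continuous_on_indicator[OF E contF] by simp
  show "set_integrable lborel E (\<lambda>t. F s (c t))"
  proof -
    obtain K where K: "K \<ge> 0" "\<And>u. \<eta> \<le> norm u \<Longrightarrow> - \<eta> \<le> Re u \<Longrightarrow> \<bar>Im u\<bar> \<le> \<eta> \<Longrightarrow> norm (F s u) \<le> K * exp (- (\<delta> / 2) * Re u)"
      using F_bound[of "Re s" "Re s" "\<bar>Im s\<bar>"] by blast
    show ?thesis unfolding set_integrable_def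
    proof (rule Bochner_Integration.integrable_bound[OF _ meas AE_I2])
      show "integrable lborel (\<lambda>t. K * (indicat_real E t *\<^sub>R exp (- (\<delta> / 2) * Re (c t))))"
        using int unfolding set_integrable_def by simp
      show "norm (indicat_real E t *\<^sub>R F s (c t)) \<le> norm (K * (indicat_real E t *\<^sub>R exp (- (\<delta> / 2) * Re (c t))))" for t
        using K(2)[of "c t"] K(1) cin[of t] by (cases "t \<in> E") (auto simp: abs_mult)
    qed
  qed
  show "(\<lambda>s. LINT t:E|lborel. F s (c t)) holomorphic_on UNIV"
    unfolding set_lebesgue_integral_def
  proof (rule holomorphic_on_parametric_integral[OF open_UNIV])
    show "(\<lambda>t. indicat_real E t *\<^sub>R F s (c t)) \<in> borel_measurable lborel" for s by (rule meas)
    show "(\<lambda>s. indicat_real E t *\<^sub>R F s (c t)) holomorphic_on UNIV" for t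
      unfolding scaleR_conv_of_real by (intro holomorphic_intros F_entire)
    fix s0 :: complex
    obtain K where K: "K \<ge> 0" "\<And>s u. Re s0 - 1 \<le> Re s \<Longrightarrow> Re s \<le> Re s0 + 1 \<Longrightarrow> \<bar>Im s\<bar> \<le> \<bar>Im s0\<bar> + 1 \<Longrightarrow>
        \<eta> \<le> norm u \<Longrightarrow> - \<eta> \<le> Re u \<Longrightarrow> \<bar>Im u\<bar> \<le> \<eta> \<Longrightarrow> norm (F s u) \<le> K * exp (- (\<delta> / 2) * Re u)"
      using F_bound[of "Re s0 - 1" "Re s0 + 1" "\<bar>Im s0\<bar> + 1"] by blast
    have 1: "integrable lborel (\<lambda>t. K * (indicat_real E t *\<^sub>R exp (- (\<delta> / 2) * Re (c t))))"
      using int unfolding set_integrable_def by simp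
    have 2: "norm (indicat_real E t *\<^sub>R F s (c t)) \<le> K * (indicat_real E t *\<^sub>R exp (- (\<delta> / 2) * Re (c t)))"
      if "s \<in> cball s0 1" for s t
    proof (cases "t \<in> E")
      case True
      have "\<bar>Re (s - s0)\<bar> \<le> 1" "\<bar>Im (s - s0)\<bar> \<le> 1"
        using that abs_Re_le_cmod[of "s - s0"] abs_Im_le_cmod[of "s - s0"] by (auto simp: dist_norm norm_minus_commute)
      then have "Re s0 - 1 \<le> Re s" "Re s \<le> Re s0 + 1" "\<bar>Im s\<bar> \<le> \<bar>Im s0\<bar> + 1"
        by (auto simp: abs_le_iff)
      then show ?thesis using K(2)[of s "c t"] cin[OF True] True by auto
    qed auto
    show "\<exists>r>0. \<exists>g. integrable lborel g \<and> cball s0 r \<subseteq> UNIV \<and>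
      (\<forall>s\<in>cball s0 r. \<forall>t\<in>space lborel. norm (indicat_real E t *\<^sub>R F s (c t)) \<le> g t)"
      using 1 2 by (intro exI[of _ 1] conjI exI[of _ "\<lambda>t. K * (indicat_real E t *\<^sub>R exp (- (\<delta> / 2) * Re (c t)))"]) auto
  qed
qed

lemma F_horizontal:
  assumes "y = \<eta> \<or> y = - \<eta>"
  shows "set_integrable lborel {- \<eta>..} (\<lambda>t. F s (Complex t y))"
    and "(\<lambda>s. LINT t:{- \<eta>..}|lborel. F s (Complex t y)) holomorphic_on UNIV"
proof -
  have "\<eta> \<le> norm (Complex t y)" for t
    using abs_Im_le_cmod[of "Complex t y"] assms eta by auto
  then have *: "\<eta> \<le> norm (Complex t y) \<and> - \<eta> \<le> Re (Complex t y) \<and> \<bar>Im (Complex t y)\<bar> \<le> \<eta> \<and> Complex t y \<notin> \<real>\<^sub>\<ge>\<^sub>0"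
    if "t \<in> {- \<eta>..}" for t using that assms eta by (auto simp: complex_nonneg_Reals_iff)
  have int: "set_integrable lborel {- \<eta>..} (\<lambda>t. exp (- (\<delta> / 2) * Re (Complex t y)))"
    using set_integrable_exp_Ici[of "\<delta> / 2" "- \<eta>"] delta by simp
  have cont: "continuous_on {- \<eta>..} (\<lambda>t. Complex t y)" by (intro continuous_intros)
  show "set_integrable lborel {- \<eta>..} (\<lambda>t. F s (Complex t y))"
    by (rule F_curve(1)[where c = "\<lambda>t. Complex t y", OF _ cont * int]) auto
  show "(\<lambda>s. LINT t:{- \<eta>..}|lborel. F s (Complex t y)) holomorphic_on UNIV"
    by (rule F_curve(2)[where c = "\<lambda>t. Complex t y", OF _ cont * int]) auto
qed

lemma F_vertical:
  "(\<lambda>s. LINT t:{- \<eta>..\<eta>}|lborel. F s (Complex (- \<eta>) t)) holomorphic_on UNIV"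
proof (rule F_curve(2))
  fix t assume t: "t \<in> {- \<eta>..\<eta>}"
  have "\<eta> \<le> norm (Complex (- \<eta>) t)"
    using abs_Re_le_cmod[of "Complex (- \<eta>) t"] eta by auto
  then show "\<eta> \<le> norm (Complex (- \<eta>) t) \<and> - \<eta> \<le> Re (Complex (- \<eta>) t) \<and> \<bar>Im (Complex (- \<eta>) t)\<bar> \<le> \<eta> \<and> Complex (- \<eta>) t \<notin> \<real>\<^sub>\<ge>\<^sub>0"
    using t eta by (auto simp: complex_nonneg_Reals_iff)
qed (auto intro!: continuous_intros borel_integrable_atLeastAtMost')

text \<open>The contour never meets 0, so s is unrestricted; every continuation in s below rests on
  this.\<close>

theorem hankel_integral_entire: "hankel_integral \<psi> \<eta> holomorphic_on UNIV"
  unfolding hankel_integral_def[abs_def]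
  by (intro holomorphic_intros F_horizontal F_vertical) auto

lemma segment_off_cut:
  assumes "closed_segment u v \<subseteq> strip \<eta> - \<real>\<^sub>\<ge>\<^sub>0"
  shows "continuous_on (closed_segment u v) (F s)"
  using assms holomorphic_on_imp_continuous_on[OF F_holomorphic] continuous_on_subset by blast

lemma horizontal_segment:
  assumes "y = \<eta> \<or> y = - \<eta>" "X > - \<eta>"
  shows "closed_segment (Complex (- \<eta>) y) (Complex X y) \<subseteq> strip \<eta> - \<real>\<^sub>\<ge>\<^sub>0"
proof
  fix w assume w: "w \<in> closed_segment (Complex (- \<eta>) y) (Complex X y)"
  then show "w \<in> strip \<eta> - \<real>\<^sub>\<ge>\<^sub>0"
    using closed_segment_Re_bounds[OF w] assms eta by (auto simp: strip_def complex_nonneg_Reals_iff)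
qed

lemma horizontal_tendsto:
  assumes "y = \<eta> \<or> y = - \<eta>"
  shows "((\<lambda>X. contour_integral (linepath (Complex (- \<eta>) y) (Complex X y)) (F s)) \<longlongrightarrow>
           (LINT t:{- \<eta>..}|lborel. F s (Complex t y))) at_top"
proof (rule Lim_transform_eventually)
  show "((\<lambda>X. LINT t:{- \<eta>..X}|lborel. F s (Complex t y)) \<longlongrightarrow> (LINT t:{- \<eta>..}|lborel. F s (Complex t y))) at_top"
    by (intro tendsto_set_lebesgue_integral_at_top F_horizontal assms) auto
  show "\<forall>\<^sub>F X in at_top. (LINT t:{- \<eta>..X}|lborel. F s (Complex t y)) = contour_integral (linepath (Complex (- \<eta>) y) (Complex X y)) (F s)"
    using eventually_gt_at_top[of "- \<eta>"]
    by eventually_elim (simp add: contour_integral_horizontal segment_off_cut horizontal_segment assms)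
qed

lemma left_segment: "closed_segment (Complex (- \<eta>) \<eta>) (Complex (- \<eta>) (- \<eta>)) \<subseteq> strip \<eta> - \<real>\<^sub>\<ge>\<^sub>0"
proof
  fix w assume w: "w \<in> closed_segment (Complex (- \<eta>) \<eta>) (Complex (- \<eta>) (- \<eta>))"
  then show "w \<in> strip \<eta> - \<real>\<^sub>\<ge>\<^sub>0"
    using closed_segment_Re_bounds[OF w] eta by (auto simp: strip_def complex_nonneg_Reals_iff)
qed

lemma left_integral:
  "contour_integral (linepath (Complex (- \<eta>) \<eta>) (Complex (- \<eta>) (- \<eta>))) (F s)
     = - \<i> * (LINT t:{- \<eta>..\<eta>}|lborel. F s (Complex (- \<eta>) t))"
proof -
  let ?a = "Complex (- \<eta>) (- \<eta>)" and ?b = "Complex (- \<eta>) \<eta>"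
  have cont: "continuous_on (closed_segment ?b ?a) (F s)"
    by (intro segment_off_cut left_segment)
  have si: "set_integrable lborel {- \<eta>..\<eta>} (\<lambda>t. F s (Complex (- \<eta>) t))"
  proof (rule borel_integrable_atLeastAtMost')
    show "continuous_on {- \<eta>..\<eta>} (\<lambda>t. F s (Complex (- \<eta>) t))"
      by (rule continuous_on_compose2[OF holomorphic_on_imp_continuous_on[OF F_holomorphic]])
         (use eta in \<open>auto intro!: continuous_intros simp: strip_def complex_nonneg_Reals_iff\<close>)
  qed
  have "(F s has_contour_integral contour_integral (linepath ?a ?b) (F s)) (linepath ?a ?b)"
    using cont by (intro has_contour_integral_integral contour_integrable_continuous_linepath) (simp add: closed_segment_commute)
  then have "((\<lambda>t. F s (Complex (- \<eta>) t)) has_integral (- \<i> * contour_integral (linepath ?a ?b) (F s))) {- \<eta>..\<eta>}"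
    using eta by (subst (asm) has_contour_integral_linepath_same_Re_iff[where c = "- \<eta>" and a = "- \<eta>" and b = \<eta>]) auto
  then have "(LINT t:{- \<eta>..\<eta>}|lborel. F s (Complex (- \<eta>) t)) = - \<i> * contour_integral (linepath ?a ?b) (F s)"
    using set_borel_integral_eq_integral(2)[OF si] by (metis integral_unique)
  moreover have "contour_integral (linepath ?b ?a) (F s) = - contour_integral (linepath ?a ?b) (F s)"
    by (rule contour_integral_reverse_linepath[OF cont])
  ultimately show ?thesis by (simp add: algebra_simps)
qed

lemma hankel_integral_eq:
  "hankel_integral \<psi> \<eta> s = (LINT t:{- \<eta>..}|lborel. F s (Complex t (- \<eta>)))
     - (LINT t:{- \<eta>..}|lborel. F s (Complex t \<eta>))
     + contour_integral (linepath (Complex (- \<eta>) \<eta>) (Complex (- \<eta>) (- \<eta>))) (F s)"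
  by (simp add: hankel_integral_def left_integral)

end

section \<open>The two boundary values of the power on the cut\<close>

lemma Ln_upper_branch:
  assumes "Im u \<ge> 0" "u \<notin> \<real>\<^sub>\<ge>\<^sub>0"
  shows "Ln (- u) + \<i> * of_real pi = Ln (- \<i> * u) + \<i> * of_real (pi / 2)"
proof -
  define D where "D = Ln (- \<i> * u) - \<i> * of_real (pi / 2)"
  have u: "u \<noteq> 0" using assms by auto
  have b: "\<bar>Im (Ln (- \<i> * u))\<bar> \<le> pi / 2"
    using u assms by (subst Re_Ln_pos_le) auto
  have e: "exp (\<i> * of_real (pi / 2)) = \<i>" by (simp add: exp_eq_polar)
  have eD: "exp D = - u" using u by (simp only: D_def exp_diff e) (simp add: field_simps)
  \<comment> \<open>Only this value would fall outside the range of \<open>Ln\<close>, and it would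
    put u on the positive axis.\<close>
  have "Im D \<noteq> - pi"
  proof
    assume "Im D = - pi"
    then have "exp D = - of_real (exp (Re D))"
      by (subst exp_eq_polar) (simp add: complex_eq_iff)
    then have "u = of_real (exp (Re D))" using eD by simp
    then show False using assms(2) by simp
  qed
  then have "- pi < Im D" "Im D \<le> pi" using b by (auto simp: D_def abs_le_iff)
  then have "Ln (- u) = D" using Ln_exp[of D] eD by simp
  then have "Ln (- u) + \<i> * of_real pi = Ln (- \<i> * u) - \<i> * of_real (pi / 2) + \<i> * of_real pi"
    by (simp only: D_def)
  moreover have "- \<i> * of_real (pi / 2) + \<i> * of_real pi = \<i> * of_real (pi / 2)"
    by (simp add: complex_eq_iff)
  ultimately show ?thesis by (simp only: diff_conv_add_uminus add.assoc mult_minus_left)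
qed

text \<open>Turning the cut of the logarithm to the positive imaginary axis continues the branch
  from the lower half-plane across the positive axis, just as the negative imaginary axis was used
  for the upper half-plane.\<close>

lemma Ln_lower_branch:
  assumes "Im u \<le> 0" "u \<notin> \<real>\<^sub>\<ge>\<^sub>0"
  shows "Ln (- u) + \<i> * of_real pi = Ln (\<i> * u) + \<i> * of_real (3 * pi / 2)"
proof -
  define D where "D = Ln (\<i> * u) + \<i> * of_real (pi / 2)"
  have u: "u \<noteq> 0" using assms by auto
  have b: "\<bar>Im (Ln (\<i> * u))\<bar> \<le> pi / 2"
    using u assms by (subst Re_Ln_pos_le) auto
  have e: "exp (\<i> * of_real (pi / 2)) = \<i>" by (simp add: exp_eq_polar)
  have eD: "exp D = - u" using u by (simp only: D_def exp_add e) (simp add: mult.commute[of _ \<i>])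
  have "Im D = Im (Ln (\<i> * u)) + pi / 2" by (simp add: D_def)
  then have "- pi < Im D" "Im D \<le> pi" using b pi_gt_zero by linarith+
  then have "Ln (- u) = D" using Ln_exp[of D] eD by simp
  then have "Ln (- u) + \<i> * of_real pi = Ln (\<i> * u) + \<i> * of_real (pi / 2) + \<i> * of_real pi"
    by (simp only: D_def)
  moreover have "\<i> * of_real (pi / 2) + \<i> * of_real pi = \<i> * of_real (3 * pi / 2)"
  proof -
    have "3 * pi / 2 = pi / 2 + pi" by simp
    then show ?thesis by (simp only: of_real_add distrib_left)
  qed
  ultimately show ?thesis by (simp only: add.assoc)
qed

context hankel
begin

text \<open>With c = -i, \<theta> = pi/2 and with c = i, \<theta> = 3 pi/2 this continues the
  integrand from the upper and from the lower half-plane up to the positive axis. The value 0 at 0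
  is the limit there for Re s > 3.\<close>

definition side :: "complex \<Rightarrow> real \<Rightarrow> complex \<Rightarrow> complex \<Rightarrow> complex" where
  "side c \<theta> s u = (if u = 0 then 0 else exp ((s - 3) * (Ln (c * u) + \<i> * of_real \<theta>)) * \<psi> u)"

lemma side_norm_le:
  assumes "u \<in> strip \<eta>" "u \<noteq> 0" "norm c = 1"
  shows "norm (side c \<theta> s u) \<le> exp (\<bar>Im s\<bar> * (pi + \<bar>\<theta>\<bar>)) * norm u powr (Re s - 3) * norm (\<psi> u)"
proof -
  have cu: "c * u \<noteq> 0" using assms by auto
  have "Re ((s - 3) * (Ln (c * u) + \<i> * of_real \<theta>)) = (Re s - 3) * ln (norm u) - Im s * (Im (Ln (c * u)) + \<theta>)"
    using cu assms by (simp add: norm_mult)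
  moreover have "- (Im s * (Im (Ln (c * u)) + \<theta>)) \<le> \<bar>Im s\<bar> * (pi + \<bar>\<theta>\<bar>)"
  proof -
    have "- (Im s * (Im (Ln (c * u)) + \<theta>)) \<le> \<bar>Im s\<bar> * \<bar>Im (Ln (c * u)) + \<theta>\<bar>"
      by (metis abs_ge_minus_self abs_mult)
    also have "\<dots> \<le> \<bar>Im s\<bar> * (pi + \<bar>\<theta>\<bar>)"
      using Im_Ln_le_pi[OF cu] mpi_less_Im_Ln[OF cu] by (intro mult_left_mono) auto
    finally show ?thesis .
  qed
  ultimately have "norm (exp ((s - 3) * (Ln (c * u) + \<i> * of_real \<theta>))) \<le> exp ((Re s - 3) * ln (norm u) + \<bar>Im s\<bar> * (pi + \<bar>\<theta>\<bar>))"
    by (simp only: norm_exp_eq_Re exp_le_cancel_iff)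
  also have "\<dots> = exp (\<bar>Im s\<bar> * (pi + \<bar>\<theta>\<bar>)) * norm u powr (Re s - 3)"
    using assms by (simp add: powr_def exp_add mult.commute)
  finally show ?thesis
    using assms by (simp add: side_def norm_mult mult_right_mono)
qed

text \<open>For Re s > 3 the integrand tends to 0 at the origin, so paths may run through it:
  Cauchy's theorem on a convex set tolerates a single point where only continuity is known.\<close>

lemma side_cauchy:
  assumes c: "norm c = 1" and s: "Re s > 3"
  defines "H \<equiv> strip \<eta> \<inter> {u. Re (c * u) \<ge> 0}"
  shows side_continuous: "continuous_on H (side c \<theta> s)"
    and "valid_path g \<Longrightarrow> pathfinish g = pathstart g \<Longrightarrow> path_image g \<subseteq> H \<Longrightarrow> (side c \<theta> s has_contour_integral 0) g"
proof -
  have conv: "convex H"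
  proof -
    have "{u. Re (c * u) \<ge> 0} = {u. inner (cnj c) u \<ge> 0}"
      by (auto simp: inner_complex_def)
    then show ?thesis unfolding H_def by (auto intro!: convex_Int convex_strip convex_halfspace_ge)
  qed
  \<comment> \<open>The cut of the logarithm lies in the half-plane opposite to \<open>H\<close> and
    can meet \<open>H\<close> in 0 only.\<close>
  define W where "W = strip \<eta> \<inter> {u. c * u \<notin> \<real>\<^sub>\<le>\<^sub>0}"
  have "W = strip \<eta> \<inter> (\<lambda>u. c * u) -` (- \<real>\<^sub>\<le>\<^sub>0)" by (auto simp: W_def)
  then have "open W"
    by (simp only:) (intro open_Int open_strip continuous_open_vimage open_Compl closed_nonpos_Reals_complex continuous_intros)
  have "(\<lambda>u. exp ((s - 3) * (Ln (c * u) + \<i> * of_real \<theta>)) * \<psi> u) holomorphic_on W"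
    by (intro holomorphic_intros holomorphic_on_subset[OF hol]) (auto simp: W_def)
  then have holW: "side c \<theta> s holomorphic_on W"
    by (rule holomorphic_transform) (auto simp: side_def W_def)
  have HW: "u \<in> W" if u: "u \<in> H" "u \<noteq> 0" for u
  proof -
    have "c * u \<notin> \<real>\<^sub>\<le>\<^sub>0"
    proof
      assume "c * u \<in> \<real>\<^sub>\<le>\<^sub>0"
      then have "Re (c * u) \<le> 0" "Im (c * u) = 0" by (auto simp: complex_nonpos_Reals_iff)
      moreover have "Re (c * u) \<ge> 0" using u by (auto simp: H_def)
      ultimately have "c * u = 0" by (simp add: complex_eq_iff)
      then show False using u c by auto
    qed
    then show ?thesis using u by (auto simp: W_def H_def)
  qed
  have diff: "side c \<theta> s field_differentiable at u" if "u \<in> H" "u \<noteq> 0" for u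
    using holomorphic_on_imp_differentiable_at[OF holW \<open>open W\<close> HW[OF that]] .
  have "continuous (at u within H) (side c \<theta> s)" if u: "u \<in> H" for u
  proof (cases "u = 0")
    case False
    then show ?thesis
      using diff[OF u] field_differentiable_imp_continuous_at continuous_at_imp_continuous_at_within by blast
  next
    case True
    define K where "K = exp (\<bar>Im s\<bar> * (pi + \<bar>\<theta>\<bar>)) * (C * exp (2 * \<delta> * \<eta>))"
    have "(side c \<theta> s \<longlongrightarrow> 0) (at 0 within H)"
    proof (rule Lim_null_comparison)
      show "\<forall>\<^sub>F u in at 0 within H. norm (side c \<theta> s u) \<le> norm u powr (Re s - 3) * K"
        unfolding eventually_at_filter
      proof (intro always_eventually allI impI)
        fix u assume u: "u \<noteq> 0" "u \<in> H"
        then have us: "u \<in> strip \<eta>" by (auto simp: H_def)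
        have "norm (\<psi> u) \<le> C * exp (- \<delta> * Re u)" by (rule bound[OF us])
        also have "\<delta> * (- Re u) \<le> \<delta> * (2 * \<eta>)"
          using us delta by (intro mult_left_mono) (auto simp: strip_def)
        then have "C * exp (- \<delta> * Re u) \<le> C * exp (2 * \<delta> * \<eta>)"
          using C_nonneg by (intro mult_left_mono) (auto simp: mult_ac)
        finally have "norm (side c \<theta> s u) \<le> exp (\<bar>Im s\<bar> * (pi + \<bar>\<theta>\<bar>)) * norm u powr (Re s - 3) * (C * exp (2 * \<delta> * \<eta>))"
          by (intro order_trans[OF side_norm_le[OF us u(1) c]] mult_left_mono) auto
        then show "norm (side c \<theta> s u) \<le> norm u powr (Re s - 3) * K"
          by (simp add: K_def mult_ac)
      qed
      have "((\<lambda>u::complex. norm u powr (Re s - 3)) \<longlongrightarrow> 0) (at 0 within H)"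
        using s by (intro tendsto_zero_powrI[of _ _ _ "Re s - 3"] tendsto_norm_zero tendsto_ident_at tendsto_const) auto
      then show "((\<lambda>u::complex. norm u powr (Re s - 3) * K) \<longlongrightarrow> 0) (at 0 within H)"
        by (rule tendsto_mult_left_zero)
    qed
    then show ?thesis using True by (simp add: continuous_within side_def)
  qed
  then show cont: "continuous_on H (side c \<theta> s)"
    by (simp add: continuous_on_eq_continuous_within)
  show "(side c \<theta> s has_contour_integral 0) g"
    if g: "valid_path g" "pathfinish g = pathstart g" "path_image g \<subseteq> H"
  proof (rule Cauchy_theorem_convex[OF cont conv _ _ g(1) g(3) g(2)])
    show "finite {0::complex}" by simp
    show "side c \<theta> s field_differentiable at x" if "x \<in> interior H - {0}" for x
      using that interior_subset by (intro diff) auto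
  qed
qed

text \<open>Both halves of the three-sided contour are pushed onto the real axis; there the two branches
  of the power differ by the factor \<open>e(s)\<close>.\<close>

lemma half_contour:
  assumes c: "norm c = 1" and s: "Re s > 3" and X: "X > 0"
    and y: "y = \<eta> \<or> y = - \<eta>"
    and ypos: "\<And>x t. t \<in> closed_segment 0 y \<Longrightarrow> Re (c * Complex x t) \<ge> 0"
  shows "contour_integral (linepath (Complex (- \<eta>) y) (Complex X y)) (side c \<theta> s) =
     contour_integral (linepath (Complex (- \<eta>) y) (- of_real \<eta>)) (side c \<theta> s)
   + contour_integral (linepath (- of_real \<eta>) 0) (side c \<theta> s)
   + contour_integral (linepath 0 (of_real X)) (side c \<theta> s)
   + contour_integral (linepath (of_real X) (Complex X y)) (side c \<theta> s)"
proof -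
  define H where "H = strip \<eta> \<inter> {u. Re (c * u) \<ge> 0}"
  have cont: "continuous_on H (side c \<theta> s)"
    unfolding H_def by (rule side_continuous[OF c s])
  let ?A = "Complex (- \<eta>) y" and ?B = "- complex_of_real \<eta>" and ?D = "complex_of_real X" and ?E = "Complex X y"
  have segH: "closed_segment u v \<subseteq> H"
    if "Re u \<ge> - \<eta>" "Re v \<ge> - \<eta>" "Im u = 0 \<or> Im u = y" "Im v = 0 \<or> Im v = y" for u v
  proof
    fix w assume w: "w \<in> closed_segment u v"
    have "Im w \<in> closed_segment 0 y"
      using closed_segment_Re_bounds(3,4)[OF w] that y eta
      by (auto simp: closed_segment_eq_real_ivl min_def max_def split: if_splits)
    moreover from this have "\<bar>Im w\<bar> \<le> \<eta>" using y eta by (auto simp: closed_segment_eq_real_ivl)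
    moreover have "Re w \<ge> - \<eta>"
      using closed_segment_Re_bounds(1)[OF w] that by auto
    ultimately show "w \<in> H"
      using ypos[of "Im w" "Re w"] eta by (auto simp: H_def strip_def)
  qed
  have ci: "side c \<theta> s contour_integrable_on linepath u v" if "closed_segment u v \<subseteq> H" for u v
    using cont that by (intro contour_integrable_continuous_linepath) (rule continuous_on_subset)
  \<comment> \<open>The boundary of the rectangle between one side and the real axis. Its base is
    divided at 0 because the contributions of the negative part will cancel and those of the
    positive part will not.\<close>
  define g where "g = linepath ?A ?B +++ linepath ?B 0 +++ linepath 0 ?D +++ linepath ?D ?E +++ linepath ?E ?A"
  have segs: "closed_segment ?A ?B \<subseteq> H" "closed_segment ?B 0 \<subseteq> H" "closed_segment 0 ?D \<subseteq> H"
    "closed_segment ?D ?E \<subseteq> H" "closed_segment ?E ?A \<subseteq> H"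
    using eta X by (intro segH; simp)+
  have g: "valid_path g" "pathfinish g = pathstart g" by (auto simp: g_def)
  have "path_image g \<subseteq> H" using segs by (simp add: g_def path_image_join)
  then have "(side c \<theta> s has_contour_integral 0) g"
    using side_cauchy(2)[OF c s g] by (simp add: H_def)
  then have "contour_integral g (side c \<theta> s) = 0" by (rule contour_integral_unique)
  moreover have "contour_integral g (side c \<theta> s) = contour_integral (linepath ?A ?B) (side c \<theta> s)
      + contour_integral (linepath ?B 0) (side c \<theta> s) + contour_integral (linepath 0 ?D) (side c \<theta> s)
      + contour_integral (linepath ?D ?E) (side c \<theta> s) + contour_integral (linepath ?E ?A) (side c \<theta> s)"
    unfolding g_def using segs by (simp add: ci contour_integrable_join)
  moreover have "contour_integral (linepath ?E ?A) (side c \<theta> s) = - contour_integral (linepath ?A ?E) (side c \<theta> s)"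
    using segs(5) cont by (intro contour_integral_reverse_linepath) (auto intro: continuous_on_subset)
  ultimately show ?thesis by simp
qed

lemma side_upper_eq: "Im u \<ge> 0 \<Longrightarrow> u \<notin> \<real>\<^sub>\<ge>\<^sub>0 \<Longrightarrow> side (- \<i>) (pi / 2) s u = F s u"
  using Ln_upper_branch[of u] by (auto simp: side_def hankel_integrand_def cpow_2pi_eq_Ln)

lemma side_lower_eq: "Im u \<le> 0 \<Longrightarrow> u \<notin> \<real>\<^sub>\<ge>\<^sub>0 \<Longrightarrow> side \<i> (3 * pi / 2) s u = F s u"
  using Ln_lower_branch[of u] by (auto simp: side_def hankel_integrand_def cpow_2pi_eq_Ln)

lemma side_upper_real:
  assumes "x > 0" shows "side (- \<i>) (pi / 2) s (of_real x) = of_real x powr (s - 3) * \<psi> (of_real x)"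
proof -
  have "Ln (- \<i> * of_real x) = of_real (ln x) - \<i> * of_real (pi / 2)"
    using assms Ln_times_of_real[of x "- \<i>"] by (simp add: mult.commute Ln_of_real)
  then show ?thesis using assms by (simp add: side_def powr_def Ln_of_real mult.commute)
qed

text \<open>From below, the positive axis has argument 2 pi. As 6 pi i is a period of the
  exponential, the exponent s - 3 still produces e(s).\<close>

lemma side_lower_real:
  assumes "x > 0" shows "side \<i> (3 * pi / 2) s (of_real x) = exp (2 * of_real pi * \<i> * s) * (of_real x powr (s - 3) * \<psi> (of_real x))"
proof -
  have "Ln (\<i> * of_real x) = of_real (ln x) + \<i> * of_real (pi / 2)"
    using assms Ln_times_of_real[of x "\<i>"] by (simp add: mult.commute Ln_of_real)
  then have "side \<i> (3 * pi / 2) s (of_real x) = exp ((s - 3) * (of_real (ln x) + 2 * of_real pi * \<i>)) * \<psi> (of_real x)"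
    using assms by (simp add: side_def algebra_simps)
  also have "exp ((s - 3) * (of_real (ln x) + 2 * of_real pi * \<i>)) = of_real x powr (s - 3) * exp (2 * of_real pi * \<i> * s - 6 * of_real pi * \<i>)"
    using assms by (simp add: powr_def Ln_of_real algebra_simps flip: exp_add)
  also have "exp (2 * of_real pi * \<i> * s - 6 * of_real pi * \<i>) = exp (2 * of_real pi * \<i> * s)"
    using exp_integer_2pi[of 3] by (simp add: exp_diff mult_ac)
  finally show ?thesis by simp
qed

lemma vertical_end_tendsto:
  assumes "norm c = 1" "y = \<eta> \<or> y = - \<eta>" "Re s > 3"
    and ypos: "\<And>x t. t \<in> closed_segment 0 y \<Longrightarrow> Re (c * Complex x t) \<ge> 0"
  shows "((\<lambda>X. contour_integral (linepath (of_real X) (Complex X y)) (side c \<theta> s)) \<longlongrightarrow> 0) at_top"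
proof -
  define r where "r = Re s - 3"
  define M where "M = exp (\<bar>Im s\<bar> * (pi + \<bar>\<theta>\<bar>)) * C"
  have d2: "\<delta> / 2 > 0" using delta by simp
  from norm_powr_le_exp[OF d2 eta, of \<eta> r]
  obtain K where K: "K \<ge> 0" "\<forall>u. \<eta> \<le> norm u \<and> - \<eta> \<le> Re u \<and> \<bar>Im u\<bar> \<le> \<eta> \<longrightarrow> norm u powr r \<le> K * exp (\<delta> / 2 * Re u)"
    by (elim exE conjE)
  show ?thesis
  proof (rule Lim_null_comparison)
  show "\<forall>\<^sub>F X in at_top. norm (contour_integral (linepath (of_real X) (Complex X y)) (side c \<theta> s)) \<le> (M * K * exp (- (\<delta> / 2) * X)) * \<eta>"
    using eventually_gt_at_top[of \<eta>]
  proof eventually_elim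
    case (elim X)
    have w: "Re w = X" "\<bar>Im w\<bar> \<le> \<eta>" "Im w \<in> closed_segment 0 y" if "w \<in> closed_segment (of_real X) (Complex X y)" for w
      using closed_segment_Re_bounds[OF that] assms(2) eta
      by (auto simp: closed_segment_eq_real_ivl min_def max_def split: if_splits)
    have wH: "w \<in> strip \<eta> \<inter> {u. Re (c * u) \<ge> 0}" if "w \<in> closed_segment (of_real X) (Complex X y)" for w
      using w[OF that] eta elim ypos[of "Im w" "Re w"] by (auto simp: strip_def)
    have "norm (contour_integral (linepath (of_real X) (Complex X y)) (side c \<theta> s)) \<le> (M * K * exp (- (\<delta> / 2) * X)) * norm (Complex X y - of_real X)"
    proof (rule contour_integral_bound_linepath)
      show "side c \<theta> s contour_integrable_on linepath (of_real X) (Complex X y)"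
        using side_continuous[OF assms(1,3)] wH
        by (intro contour_integrable_continuous_linepath) (auto intro: continuous_on_subset)
      fix u assume u: "u \<in> closed_segment (of_real X) (Complex X y)"
      have nu: "\<eta> \<le> norm u" "u \<noteq> 0" using w(1)[OF u] complex_Re_le_cmod[of u] elim eta by auto
      have us: "u \<in> strip \<eta>" using wH[OF u] by auto
      have "norm (side c \<theta> s u) \<le> exp (\<bar>Im s\<bar> * (pi + \<bar>\<theta>\<bar>)) * norm u powr r * norm (\<psi> u)"
        unfolding r_def by (rule side_norm_le[OF us nu(2) assms(1)])
      also have "\<dots> \<le> exp (\<bar>Im s\<bar> * (pi + \<bar>\<theta>\<bar>)) * (K * exp (\<delta> / 2 * Re u)) * (C * exp (- \<delta> * Re u))"
      proof (intro mult_mono mult_left_mono)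
        show "norm u powr r \<le> K * exp (\<delta> / 2 * Re u)"
          using K(2)[rule_format, of u] nu w[OF u] elim eta by simp
        show "norm (\<psi> u) \<le> C * exp (- \<delta> * Re u)" by (rule bound[OF us])
      qed (use K(1) in auto)
      also have "\<dots> = M * K * (exp (\<delta> / 2 * X) * exp (- \<delta> * X))" using w(1)[OF u] by (simp add: M_def)
      also have "exp (\<delta> / 2 * X) * exp (- \<delta> * X) = exp (- (\<delta> / 2) * X)" by (simp flip: exp_add)
      finally show "norm (side c \<theta> s u) \<le> M * K * exp (- (\<delta> / 2) * X)" .
    qed (use K C_nonneg in \<open>auto simp: M_def\<close>)
    moreover have "norm (Complex X y - of_real X) = \<eta>"
      using assms(2) eta by (auto simp: Complex_eq norm_mult)
    ultimately show ?case by simp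
  qed
  have "((\<lambda>X. exp (- (\<delta> / 2) * X)) \<longlongrightarrow> 0) at_top"
    using delta by (intro filterlim_compose[OF exp_at_bot] filterlim_tendsto_neg_mult_at_bot[OF tendsto_const _ filterlim_ident]) auto
  then have "((\<lambda>X. M * K * exp (- (\<delta> / 2) * X) * \<eta>) \<longlongrightarrow> M * K * 0 * \<eta>) at_top"
    by (intro tendsto_intros)
  then show "((\<lambda>X. M * K * exp (- (\<delta> / 2) * X) * \<eta>) \<longlongrightarrow> 0) at_top" by simp
  qed
qed

lemma mellin_bound:
  assumes "u > 0"
  shows "norm (\<psi> (of_real u) / (of_real u)\<^sup>2) \<le> C * u powr (- 2) * exp (- \<delta> * u)"
proof -
  have "norm (\<psi> (of_real u)) \<le> C * exp (- \<delta> * u)"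
    using bound[of "of_real u"] assms eta by (auto simp: strip_def)
  then have "norm (\<psi> (of_real u)) / u\<^sup>2 \<le> (C * exp (- \<delta> * u)) / u\<^sup>2"
    by (intro divide_right_mono) auto
  also have "\<dots> = C * u powr (- 2) * exp (- \<delta> * u)"
    using assms by (simp add: powr_minus divide_inverse mult_ac flip: powr_numeral)
  finally show ?thesis using assms by (simp add: norm_divide norm_power)
qed

lemma psi_continuous_real: "continuous_on {0<..} (\<lambda>u. \<psi> (of_real u))"
  by (rule continuous_on_compose2[OF holomorphic_on_imp_continuous_on[OF hol]])
     (use eta in \<open>auto intro!: continuous_intros simp: strip_def\<close>)

lemma mellin_continuous: "continuous_on {0<..} (\<lambda>u. \<psi> (of_real u) / (of_real u)\<^sup>2)"
  by (intro continuous_intros psi_continuous_real) auto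

lemma mellin_holo: "mellin (\<lambda>u. \<psi> (of_real u) / (of_real u)\<^sup>2) holomorphic_on {s. Re s > 2}"
  by (rule mellin_holomorphic[OF mellin_continuous delta mellin_bound])

lemma upper_axis_tendsto:
  assumes s: "Re s > 3"
  shows "((\<lambda>X. contour_integral (linepath 0 (of_real X)) (side (- \<i>) (pi / 2) s)) \<longlongrightarrow>
            mellin (\<lambda>u. \<psi> (of_real u) / (of_real u)\<^sup>2) s) at_top"
proof -
  \<comment> \<open>The value 0 at 0 agrees with \<open>side\<close>; for the integral it concerns a
    null set.\<close>
  define h where "h u = (if u = 0 then 0 else of_real u powr (s - 1) * (\<psi> (of_real u) / (of_real u)\<^sup>2))" for u :: real
  have side_h: "side (- \<i>) (pi / 2) s (of_real u) = h u" if "u \<ge> 0" for u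
  proof (cases "u = 0")
    case False
    have "complex_of_real u powr (s - 1) = of_real u powr (s - 3) * (of_real u)\<^sup>2"
      using False powr_add[of "complex_of_real u" "s - 3" 2] by (simp add: powr_numeral)
    then show ?thesis using False that side_upper_real[of u s] by (simp add: h_def)
  qed (simp add: side_def h_def)
  have ae: "(LINT u:{0..}|lborel. h u) = (LINT u:{0<..}|lborel. h u)" "set_integrable lborel {0..} h"
  proof -
    show "(LINT u:{0..}|lborel. h u) = (LINT u:{0<..}|lborel. h u)"
      by (rule set_integral_discrete_difference[of "{0}"]) auto
    have si: "set_integrable lborel {0<..} (\<lambda>u. of_real u powr (s - 1) * (\<psi> (of_real u) / (of_real u)\<^sup>2))"
      using s by (intro mellin_integrable[OF mellin_continuous delta mellin_bound]) auto
    have "(\<lambda>u. indicat_real {0<..} u *\<^sub>R (of_real u powr (s - 1) * (\<psi> (of_real u) / (of_real u)\<^sup>2)))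
        = (\<lambda>u. indicat_real {0..} u *\<^sub>R h u)"
      by (auto simp: fun_eq_iff indicator_def h_def)
    then show "set_integrable lborel {0..} h" using si unfolding set_integrable_def by (simp only:)
  qed
  have "((\<lambda>X. LINT u:{0..X}|lborel. h u) \<longlongrightarrow> (LINT u:{0..}|lborel. h u)) at_top"
    by (intro tendsto_set_lebesgue_integral_at_top ae) auto
  also have "(LINT u:{0..}|lborel. h u) = mellin (\<lambda>u. \<psi> (of_real u) / (of_real u)\<^sup>2) s"
    unfolding ae(1) mellin_def by (rule set_lebesgue_integral_cong) (auto simp: h_def)
  finally show ?thesis
  proof (rule Lim_transform_eventually)
    show "\<forall>\<^sub>F X in at_top. (LINT u:{0..X}|lborel. h u) = contour_integral (linepath 0 (of_real X)) (side (- \<i>) (pi / 2) s)"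
      using eventually_gt_at_top[of 0]
    proof eventually_elim
      case (elim X)
      have sub: "closed_segment 0 (complex_of_real X) \<subseteq> strip \<eta> \<inter> {u. Re (- \<i> * u) \<ge> 0}"
      proof
        fix w assume w: "w \<in> closed_segment 0 (complex_of_real X)"
        show "w \<in> strip \<eta> \<inter> {u. Re (- \<i> * u) \<ge> 0}"
          using closed_segment_Re_bounds[OF w] eta elim by (auto simp: strip_def)
      qed
      have "continuous_on (closed_segment 0 (of_real X)) (side (- \<i>) (pi / 2) s)"
        using side_continuous[of "- \<i>" s] s sub by (auto intro: continuous_on_subset)
      then have "contour_integral (linepath 0 (of_real X)) (side (- \<i>) (pi / 2) s) = (LINT t:{0..X}|lborel. side (- \<i>) (pi / 2) s (of_real t))"
        using contour_integral_horizontal[of 0 X 0] elim by (simp add: Complex_eq zero_complex.code[symmetric])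
      also have "\<dots> = (LINT t:{0..X}|lborel. h t)"
        by (rule set_lebesgue_integral_cong) (auto simp: side_h)
      finally show ?case by simp
    qed
  qed
qed

text \<open>On the negative axis the two branches agree and the two passages cancel. On the positive
  axis they run in opposite directions and leave e(s) - 1 times the Mellin integral, while the
  vertical ends vanish in the limit.\<close>

theorem hankel_integral_eq_mellin:
  assumes s: "Re s > 3"
  shows "hankel_integral \<psi> \<eta> s = (exp (2 * of_real pi * \<i> * s) - 1) * mellin (\<lambda>u. \<psi> (of_real u) / (of_real u)\<^sup>2) s"
proof -
  define up where "up = side (- \<i>) (pi / 2) s"
  define lo where "lo = side \<i> (3 * pi / 2) s"
  define m where "m = mellin (\<lambda>u. \<psi> (of_real u) / (of_real u)\<^sup>2) s"
  define E where "E = exp (2 * of_real pi * \<i> * s)"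
  define J where "J X = contour_integral (linepath (Complex (- \<eta>) (- \<eta>)) (Complex X (- \<eta>))) (F s)
     - contour_integral (linepath (Complex (- \<eta>) \<eta>) (Complex X \<eta>)) (F s)
     + contour_integral (linepath (Complex (- \<eta>) \<eta>) (Complex (- \<eta>) (- \<eta>))) (F s)" for X
  define Eu where "Eu X = contour_integral (linepath (of_real X) (Complex X \<eta>)) up" for X
  define El where "El X = contour_integral (linepath (of_real X) (Complex X (- \<eta>))) lo" for X
  have J1: "(J \<longlongrightarrow> hankel_integral \<psi> \<eta> s) at_top"
    unfolding J_def[abs_def] hankel_integral_eq by (intro tendsto_intros horizontal_tendsto) auto
  have reU: "Re (- \<i> * Complex x t) \<ge> 0" if "t \<in> closed_segment 0 \<eta>" for x t
    using that eta by (auto simp: closed_segment_eq_real_ivl)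
  have reL: "Re (\<i> * Complex x t) \<ge> 0" if "t \<in> closed_segment 0 (- \<eta>)" for x t
    using that eta by (auto simp: closed_segment_eq_real_ivl)
  have J2: "J X = (E - 1) * contour_integral (linepath 0 (of_real X)) up + El X - Eu X" if X: "X > 0" for X
  proof -
    let ?A = "Complex (- \<eta>) \<eta>" and ?A' = "Complex (- \<eta>) (- \<eta>)" and ?B = "- complex_of_real \<eta>"
    have cong: "contour_integral (linepath u v) g = contour_integral (linepath u v) g'"
      if "\<And>w. w \<in> closed_segment u v \<Longrightarrow> g w = g' w" for u v g g'
      using that by (intro contour_integral_cong) auto
    have 1: "contour_integral (linepath ?A (Complex X \<eta>)) (F s) = contour_integral (linepath ?A (Complex X \<eta>)) up"
    proof (rule cong)
      fix w assume w: "w \<in> closed_segment ?A (Complex X \<eta>)"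
      show "F s w = up w" unfolding up_def
        by (rule side_upper_eq[symmetric]) (use closed_segment_Re_bounds[OF w] eta in \<open>auto simp: complex_nonneg_Reals_iff\<close>)
    qed
    have 2: "contour_integral (linepath ?A' (Complex X (- \<eta>))) (F s) = contour_integral (linepath ?A' (Complex X (- \<eta>))) lo"
    proof (rule cong)
      fix w assume w: "w \<in> closed_segment ?A' (Complex X (- \<eta>))"
      show "F s w = lo w" unfolding lo_def
        by (rule side_lower_eq[symmetric]) (use closed_segment_Re_bounds[OF w] eta in \<open>auto simp: complex_nonneg_Reals_iff\<close>)
    qed
    have 3: "contour_integral (linepath ?A ?B) (F s) = contour_integral (linepath ?A ?B) up"
    proof (rule cong)
      fix w assume w: "w \<in> closed_segment ?A ?B"
      show "F s w = up w" unfolding up_def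
        by (rule side_upper_eq[symmetric]) (use closed_segment_Re_bounds[OF w] eta in \<open>auto simp: complex_nonneg_Reals_iff\<close>)
    qed
    have 4: "contour_integral (linepath ?A' ?B) (F s) = contour_integral (linepath ?A' ?B) lo"
    proof (rule cong)
      fix w assume w: "w \<in> closed_segment ?A' ?B"
      show "F s w = lo w" unfolding lo_def
        by (rule side_lower_eq[symmetric]) (use closed_segment_Re_bounds[OF w] eta in \<open>auto simp: complex_nonneg_Reals_iff\<close>)
    qed
    have 5: "contour_integral (linepath ?B 0) up = contour_integral (linepath ?B 0) lo"
    proof (rule cong)
      fix w assume w: "w \<in> closed_segment ?B 0"
      have im: "Im w = 0" and re: "Re w \<le> 0" using closed_segment_Re_bounds[OF w] eta by auto
      show "up w = lo w"
      proof (cases "w = 0")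
        case True then show ?thesis by (simp add: up_def lo_def side_def)
      next
        case False
        then have "w \<notin> \<real>\<^sub>\<ge>\<^sub>0" using im re by (auto simp: complex_nonneg_Reals_iff complex_eq_iff)
        then show ?thesis unfolding up_def lo_def using im by (simp add: side_upper_eq side_lower_eq)
      qed
    qed
    have 6: "contour_integral (linepath 0 (of_real X)) lo = E * contour_integral (linepath 0 (of_real X)) up"
    proof -
      have "contour_integral (linepath 0 (of_real X)) lo = contour_integral (linepath 0 (of_real X)) (\<lambda>w. E * up w)"
      proof (rule cong)
        fix w assume w: "w \<in> closed_segment 0 (complex_of_real X)"
        have im: "Im w = 0" and re: "Re w \<ge> 0" using closed_segment_Re_bounds[OF w] X by auto
        then have "w = of_real (Re w)" by (simp add: complex_eq_iff)
        then show "lo w = E * up w"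
          using side_lower_real[of "Re w" s] side_upper_real[of "Re w" s] re
          by (cases "Re w = 0") (auto simp: up_def lo_def E_def side_def[of _ _ _ 0])
      qed
      also have "\<dots> = E * contour_integral (linepath 0 (of_real X)) up"
      proof (rule contour_integral_lmul)
        have "closed_segment 0 (complex_of_real X) \<subseteq> strip \<eta> \<inter> {u. Re (- \<i> * u) \<ge> 0}"
        proof
          fix w assume w: "w \<in> closed_segment 0 (complex_of_real X)"
          show "w \<in> strip \<eta> \<inter> {u. Re (- \<i> * u) \<ge> 0}"
            using closed_segment_Re_bounds[OF w] eta X by (auto simp: strip_def)
        qed
        then show "up contour_integrable_on linepath 0 (of_real X)"
          using side_continuous[of "- \<i>" s] s unfolding up_def
          by (intro contour_integrable_continuous_linepath) (auto intro: continuous_on_subset)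
      qed
      finally show ?thesis .
    qed
    have cAA: "continuous_on (closed_segment ?A ?A') (F s)" by (intro segment_off_cut left_segment)
    \<comment> \<open>The left side is cut at its midpoint -\<eta>, so that each half lies in one
      closed half-plane and belongs to one branch.\<close>
    have mid: "?B = (1 - 1/2) *\<^sub>R ?A + (1/2) *\<^sub>R ?A'" by (simp add: complex_eq_iff)
    have "?B \<in> closed_segment ?A ?A'" unfolding in_segment mid by (intro exI[of _ "1/2"]) auto
    then have 7: "contour_integral (linepath ?A ?A') (F s) = contour_integral (linepath ?A ?B) (F s) + contour_integral (linepath ?B ?A') (F s)"
      using cAA by (intro contour_integral_split_linepath)
    have 8: "contour_integral (linepath ?B ?A') (F s) = - contour_integral (linepath ?A' ?B) (F s)"
    proof (rule contour_integral_reverse_linepath, rule continuous_on_subset[OF cAA])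
      show "closed_segment ?B ?A' \<subseteq> closed_segment ?A ?A'"
        using \<open>?B \<in> closed_segment ?A ?A'\<close> by (simp add: subset_closed_segment)
    qed
    have hu: "contour_integral (linepath ?A (Complex X \<eta>)) up = contour_integral (linepath ?A ?B) up
        + contour_integral (linepath ?B 0) up + contour_integral (linepath 0 (of_real X)) up + Eu X"
      unfolding up_def Eu_def using s X reU by (intro half_contour) auto
    have hl: "contour_integral (linepath ?A' (Complex X (- \<eta>))) lo = contour_integral (linepath ?A' ?B) lo
        + contour_integral (linepath ?B 0) lo + contour_integral (linepath 0 (of_real X)) lo + El X"
      unfolding lo_def El_def using s X reL by (intro half_contour) auto
    show ?thesis
      unfolding J_def 1 2 7 8 3 4 hu hl 5 6 by (simp add: algebra_simps)
  qed
  have "(Eu \<longlongrightarrow> 0) at_top" unfolding Eu_def[abs_def] up_def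
    using s reU by (intro vertical_end_tendsto) auto
  moreover have "(El \<longlongrightarrow> 0) at_top" unfolding El_def[abs_def] lo_def
    using s reL by (intro vertical_end_tendsto) auto
  moreover have "((\<lambda>X. contour_integral (linepath 0 (of_real X)) up) \<longlongrightarrow> m) at_top"
    unfolding up_def m_def by (rule upper_axis_tendsto[OF s])
  ultimately have "((\<lambda>X. (E - 1) * contour_integral (linepath 0 (of_real X)) up + El X - Eu X) \<longlongrightarrow> (E - 1) * m + 0 - 0) at_top"
    by (intro tendsto_intros)
  then have "(J \<longlongrightarrow> (E - 1) * m + 0 - 0) at_top"
    by (rule Lim_transform_eventually) (rule eventually_mono[OF eventually_gt_at_top[of 0]], simp add: J2)
  then have "hankel_integral \<psi> \<eta> s = (E - 1) * m + 0 - 0"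
    using J1 by (intro tendsto_unique[OF _ J1]) auto
  then show ?thesis by (simp add: E_def m_def)
qed

end

section \<open>Continuation of Mellin transforms of geometric series\<close>

lemma connected_halfplane: "connected {s. Re s > (a::real)}"
  by (simp add: convex_connected convex_halfspace_Re_gt)

lemma halfplane_continuation:
  assumes "f holomorphic_on {s. Re s > a}" "g holomorphic_on {s. Re s > a}"
    and "\<And>s. Re s > b \<Longrightarrow> f s = g s" and "Re s > a"
  shows "f s = g s"
proof (rule analytic_continuation_open[of "{s. Re s > max a b}" "{s. Re s > a}" f g s])
  show "open {s. Re s > max a b}" "open {s. Re s > a}" by (rule open_halfspace_Re_gt)+
  have "of_real (max a b + 1) \<in> {s. Re s > max a b}" by (simp add: max_def)
  then show "{s. Re s > max a b} \<noteq> {}" by blast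
qed (use assms in \<open>auto simp: connected_halfplane\<close>)

lemma strip_norm_le_exp:
  assumes "\<epsilon> > 0" "\<eta> > 0"
  shows "\<exists>K\<ge>0. \<forall>u\<in>strip \<eta>. norm u \<le> K * exp (\<epsilon> * Re u)"
proof -
  have "norm u \<le> (6 * \<eta> + 1 + 1 / \<epsilon>) * exp (\<epsilon> * 2 * \<eta>) * exp (\<epsilon> * Re u)" if u: "u \<in> strip \<eta>" for u
  proof -
    define x where "x = Re u + 2 * \<eta>"
    have x: "x > 0" using u by (auto simp: strip_def x_def)
    have "norm u \<le> \<bar>Re u\<bar> + \<bar>Im u\<bar>" by (rule cmod_le)
    also have "\<dots> \<le> x + 6 * \<eta>" using u assms by (auto simp: strip_def x_def abs_if)
    also have "\<dots> \<le> (6 * \<eta> + 1 + 1 / \<epsilon>) * (1 + \<epsilon> * x)"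
      using x assms by (simp add: field_simps)
    also have "\<dots> \<le> (6 * \<eta> + 1 + 1 / \<epsilon>) * exp (\<epsilon> * x)"
      using assms exp_ge_add_one_self[of "\<epsilon> * x"] by (intro mult_left_mono) (auto intro!: add_nonneg_nonneg)
    also have "exp (\<epsilon> * x) = exp (\<epsilon> * 2 * \<eta>) * exp (\<epsilon> * Re u)"
      by (simp add: x_def algebra_simps flip: exp_add)
    finally show ?thesis by (simp add: mult.assoc)
  qed
  then show ?thesis using assms
    by (intro exI[of _ "(6 * \<eta> + 1 + 1 / \<epsilon>) * exp (\<epsilon> * 2 * \<eta>)"]) (auto intro!: mult_nonneg_nonneg add_nonneg_nonneg)
qed

context hankel
begin

abbreviation "\<phi> \<equiv> (\<lambda>u. \<psi> (of_real u) / (of_real u)\<^sup>2)"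

text \<open>The bound Re s > 3 came from the path through 0. Both sides are holomorphic for Re s >
  2, where the Mellin integral converges, so the identity persists.\<close>

lemma hankel_integral_eq_mellin':
  assumes "Re s > 2"
  shows "hankel_integral \<psi> \<eta> s = (exp (2 * of_real pi * \<i> * s) - 1) * mellin \<phi> s"
proof (rule halfplane_continuation[where a = 2 and b = 3 and f = "hankel_integral \<psi> \<eta>"
    and g = "\<lambda>s. (exp (2 * of_real pi * \<i> * s) - 1) * mellin \<phi> s"])
  show "hankel_integral \<psi> \<eta> holomorphic_on {s. 2 < Re s}"
    using hankel_integral_entire holomorphic_on_subset by blast
  show "(\<lambda>s. (exp (2 * of_real pi * \<i> * s) - 1) * mellin \<phi> s) holomorphic_on {s. 2 < Re s}"
    by (intro holomorphic_intros mellin_holo)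
qed (use assms hankel_integral_eq_mellin in auto)

text \<open>Subtracting \<psi>(0) e^(-u) lowers the order of the pole at 0 from two to one. The
  Mellin transform of the remainder then reaches beyond s = 2, and the value there is decided by the
  explicit part.\<close>

lemma subtracted_bound:
  "\<exists>C2 d2. d2 > 0 \<and> (\<forall>u>0. norm ((\<psi> (of_real u) - \<psi> 0 * exp (- of_real u)) / (of_real u)\<^sup>2) \<le> C2 * u powr (- 1) * exp (- d2 * u))"
proof -
  define g where "g u = \<psi> u - \<psi> 0 * exp (- u)" for u
  have hg: "g holomorphic_on strip \<eta>" unfolding g_def by (intro holomorphic_intros hol)
  have seg: "closed_segment 0 1 \<subseteq> strip \<eta>"
    using convex_strip eta by (intro closed_segment_subset) (auto simp: strip_def)
  have "deriv g holomorphic_on strip \<eta>" using hg open_strip by (rule holomorphic_deriv)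
  then have "continuous_on (closed_segment 0 1) (deriv g)"
    using seg holomorphic_on_imp_continuous_on continuous_on_subset by blast
  then have "compact (deriv g ` closed_segment 0 1)" by (intro compact_continuous_image) auto
  then have "bounded (deriv g ` closed_segment 0 1)" by (rule compact_imp_bounded)
  then obtain K where K: "\<And>u. u \<in> closed_segment 0 1 \<Longrightarrow> norm (deriv g u) \<le> K"
    by (auto simp: bounded_iff)
  have K0: "K \<ge> 0" by (rule order_trans[OF norm_ge_zero K[of 0]]) simp
  \<comment> \<open>Both \<psi> and the subtracted e^(-u) have to decay at this rate.\<close>
  define d2 where "d2 = min \<delta> 1"
  define C2 where "C2 = K * exp d2 + (C + norm (\<psi> 0))"
  have d2: "d2 > 0" "d2 \<le> \<delta>" "d2 \<le> 1" using delta by (auto simp: d2_def)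
  have "norm (g (of_real u) / (of_real u)\<^sup>2) \<le> C2 * u powr (- 1) * exp (- d2 * u)" if u: "u > 0" for u :: real
  proof (cases "u \<le> 1")
    case True
    have "norm (g (of_real u) - g 0) \<le> K * norm (complex_of_real u - 0)"
    proof (rule field_differentiable_bound[where S = "closed_segment 0 1"])
      show "(g has_field_derivative deriv g z) (at z within closed_segment 0 1)" if "z \<in> closed_segment 0 1" for z
        using holomorphic_derivI[OF hg open_strip] seg that has_field_derivative_at_within by blast
      show "complex_of_real u \<in> closed_segment 0 1"
        using u True unfolding in_segment by (intro exI[of _ u]) (auto simp: scaleR_conv_of_real)
    qed (use K in auto)
    moreover have "g 0 = 0" by (simp add: g_def)
    ultimately have "norm (g (of_real u)) \<le> K * u" using u by simp
    then have "norm (g (of_real u)) / u\<^sup>2 \<le> K * u / u\<^sup>2" by (intro divide_right_mono) auto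
    also have "\<dots> = K * u powr (- 1) * 1" using u by (simp add: power2_eq_square powr_minus field_simps)
    also have "\<dots> \<le> K * u powr (- 1) * (exp d2 * exp (- d2 * u))"
      using K0 True d2 u by (intro mult_left_mono) (auto simp flip: exp_add simp: mult_left_le)
    also have "\<dots> \<le> C2 * u powr (- 1) * exp (- d2 * u)"
    proof -
      have "K * exp d2 * (u powr (- 1) * exp (- d2 * u)) \<le> C2 * (u powr (- 1) * exp (- d2 * u))"
        using C_nonneg by (intro mult_right_mono) (auto simp: C2_def)
      then show ?thesis by (simp add: mult_ac)
    qed
    finally show ?thesis using u by (simp add: norm_divide norm_power)
  next
    case False
    have us: "of_real u \<in> strip \<eta>" using u eta by (auto simp: strip_def)
    have "norm (g (of_real u)) \<le> norm (\<psi> (of_real u)) + norm (\<psi> 0) * exp (- u)"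
      unfolding g_def using norm_triangle_ineq4[of "\<psi> (of_real u)" "\<psi> 0 * exp (- of_real u)"] by (simp add: norm_mult)
    also have "\<dots> \<le> C * exp (- d2 * u) + norm (\<psi> 0) * exp (- d2 * u)"
    proof (intro add_mono mult_left_mono)
      have "norm (\<psi> (of_real u)) \<le> C * exp (- \<delta> * u)" using bound[OF us] by simp
      also have "\<dots> \<le> C * exp (- d2 * u)" using C_nonneg d2 u by (intro mult_left_mono) auto
      finally show "norm (\<psi> (of_real u)) \<le> C * exp (- d2 * u)" .
    qed (use d2 u in auto)
    also have "\<dots> = (C + norm (\<psi> 0)) * exp (- d2 * u)" by (simp add: algebra_simps)
    also have "\<dots> \<le> C2 * exp (- d2 * u)" using K0 by (intro mult_right_mono) (auto simp: C2_def)
    finally have gb: "norm (g (of_real u)) \<le> C2 * exp (- d2 * u)" .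
    have "norm (g (of_real u)) / u\<^sup>2 \<le> norm (g (of_real u)) / u"
      using False by (intro divide_left_mono) (auto simp: power2_eq_square)
    also have "\<dots> \<le> C2 * exp (- d2 * u) / u" using gb u by (intro divide_right_mono) auto
    finally show ?thesis using u by (simp add: norm_divide norm_power powr_minus field_simps)
  qed
  then show ?thesis using d2 by (auto simp: g_def)
qed

text \<open>For Re s > 2 the function is given directly. Elsewhere the loop integral is divided by
  e(s) - 1 and by Gamma(s), and the reflection formula rewrites the quotient with Gamma(3 - s),
  whose poles 3, 4, ... lie in the region of the direct formula. The factors s - 1 and s - 2 are
  what turns Gamma(1 - s) into Gamma(3 - s).\<close>

theorem entire_continuation:
  "\<exists>H. H holomorphic_on UNIV \<and> (\<forall>s. Re s > 2 \<longrightarrow> (s - 1) * (s - 2) * (mellin \<phi> s / Gamma s) = H s) \<and> H 2 = \<psi> 0"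
proof -
  define D where "D s = (s - 1) * (s - 2) * (mellin \<phi> s * rGamma s)" for s
  define Q where "Q s = Gamma (3 - s) * exp (- \<i> * of_real pi * s) * hankel_integral \<psi> \<eta> s / (2 * of_real pi * \<i>)" for s
  define H where "H s = (if Re s > 2 then D s else Q s)" for s
  define A where "A = {s. Re s > (2::real)}"
  define B where "B = {s::complex. 3 - s \<notin> \<int>\<^sub>\<le>\<^sub>0}"
  have openA: "open A" unfolding A_def by (rule open_halfspace_Re_gt)
  have "B = (\<lambda>s. 3 - s) -` (- \<int>\<^sub>\<le>\<^sub>0)" by (auto simp: B_def)
  then have openB: "open B"
    by (simp only:) (intro continuous_open_vimage open_Compl closed_nonpos_Ints continuous_intros)
  have AB: "A \<union> B = UNIV"
  proof -
    have "s \<in> B" if "s \<notin> A" for s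
    proof -
      have "Re (3 - s) > 0" using that by (auto simp: A_def)
      have "3 - s \<notin> \<int>\<^sub>\<le>\<^sub>0"
      proof
        assume "3 - s \<in> \<int>\<^sub>\<le>\<^sub>0"
        then obtain n :: int where n: "3 - s = of_int n" "n \<le> 0" by (elim nonpos_Ints_cases)
        have "Re (3 - s) \<le> 0" unfolding n(1) using n(2) by simp
        with \<open>Re (3 - s) > 0\<close> show False by linarith
      qed
      then show ?thesis by (simp add: B_def)
    qed
    then show ?thesis by blast
  qed
  have DQ: "D s = Q s" if s: "s \<in> A" "s \<in> B" for s
  proof -
    have s2: "Re s > 2" using s by (simp add: A_def)
    \<comment> \<open>For Re s > 2 every integer is a pole of Gamma(3 - s); so s is no integer here,
      and the reflection formula involves no vanishing sine.\<close>
    have nint: "s \<notin> \<int>"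
    proof
      assume "s \<in> \<int>"
      then obtain n where n: "s = of_int n" by (auto elim: Ints_cases)
      then have "n \<ge> 3" using s2 by simp
      then have "(3 - s) \<in> \<int>\<^sub>\<le>\<^sub>0" using n by (auto simp: nonpos_Ints_def intro!: exI[of _ "3 - n"])
      then show False using s by (simp add: B_def)
    qed
    have np: "s \<notin> \<int>\<^sub>\<le>\<^sub>0" "1 - s \<notin> \<int>\<^sub>\<le>\<^sub>0" "2 - s \<notin> \<int>\<^sub>\<le>\<^sub>0"
    proof -
      have *: "of_int m - s \<notin> \<int>\<^sub>\<le>\<^sub>0" for m :: int
      proof
        assume "of_int m - s \<in> \<int>\<^sub>\<le>\<^sub>0"
        then have "of_int m - (of_int m - s) \<in> \<int>" using nonpos_Ints_subset_Ints by (intro Ints_diff) auto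
        then show False using nint by simp
      qed
      show "1 - s \<notin> \<int>\<^sub>\<le>\<^sub>0" "2 - s \<notin> \<int>\<^sub>\<le>\<^sub>0" using *[of 1] *[of 2] by simp_all
      show "s \<notin> \<int>\<^sub>\<le>\<^sub>0" using nint nonpos_Ints_subset_Ints by auto
    qed
    have G0: "Gamma s \<noteq> 0" "Gamma (1 - s) \<noteq> 0" using np by (simp_all add: Gamma_eq_zero_iff)
    have sin0: "sin (of_real pi * s) \<noteq> 0"
    proof
      assume "sin (of_real pi * s) = 0"
      then have "Gamma s * Gamma (1 - s) = 0" by (simp add: Gamma_reflection_complex)
      then show False using G0 by simp
    qed
    have "Gamma (3 - s) = (2 - s) * Gamma (2 - s)"
      using Gamma_plus1[OF np(3)] by (simp add: algebra_simps)
    also have "Gamma (2 - s) = (1 - s) * Gamma (1 - s)"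
      using Gamma_plus1[OF np(2)] by (simp add: algebra_simps)
    also have "Gamma (1 - s) = of_real pi / sin (of_real pi * s) * rGamma s"
    proof -
      have "Gamma (1 - s) = (Gamma s * Gamma (1 - s)) / Gamma s" using G0 by simp
      then show ?thesis unfolding Gamma_reflection_complex by (simp only: rGamma_inverse_Gamma divide_inverse)
    qed
    finally have "Gamma (3 - s) = (2 - s) * ((1 - s) * (of_real pi / sin (of_real pi * s) * rGamma s))" .
    moreover have "(2 - s) * ((1 - s) * X) = (s - 1) * (s - 2) * X" for X by (simp add: algebra_simps)
    ultimately have g: "Gamma (3 - s) = (s - 1) * (s - 2) * (of_real pi / sin (of_real pi * s) * rGamma s)"
      by simp
    define E where "E = exp (\<i> * of_real pi * s)"
    have "E \<noteq> 0" by (simp add: E_def)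
    have Em: "exp (- \<i> * of_real pi * s) = 1 / E" by (simp add: E_def exp_minus divide_inverse)
    have E2: "exp (2 * of_real pi * \<i> * s) = E * E" by (simp add: E_def mult_ac flip: exp_add)
    have sinE: "sin (of_real pi * s) = (E - 1 / E) / (2 * \<i>)"
    proof -
      have "exp (- (\<i> * (of_real pi * s))) = 1 / E"
        by (simp only: E_def exp_minus divide_inverse mult.assoc mult_1_left)
      then show ?thesis unfolding sin_exp_eq E_def by (simp only: mult.assoc)
    qed
    have e: "exp (- \<i> * of_real pi * s) * (exp (2 * of_real pi * \<i> * s) - 1) = 2 * \<i> * sin (of_real pi * s)"
    proof -
      have "1 / E * (E * E - 1) = E - 1 / E" using \<open>E \<noteq> 0\<close> by (simp add: right_diff_distrib)
      then show ?thesis unfolding Em E2 sinE by simp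
    qed
    have "Q s = Gamma (3 - s) * (exp (- \<i> * of_real pi * s) * (exp (2 * of_real pi * \<i> * s) - 1)) * mellin \<phi> s / (2 * of_real pi * \<i>)"
      by (simp add: Q_def hankel_integral_eq_mellin'[OF s2])
    also have "\<dots> = D s"
      unfolding g e D_def using sin0 by (simp add: field_simps)
    finally show ?thesis by simp
  qed
  have holD: "D holomorphic_on A"
    unfolding D_def A_def by (intro holomorphic_intros mellin_holo)
  have holQ: "Q holomorphic_on B"
    unfolding Q_def B_def by (intro holomorphic_intros holomorphic_on_subset[OF hankel_integral_entire]) auto
  have "H holomorphic_on A" by (rule holomorphic_transform[OF holD]) (auto simp: H_def A_def)
  moreover have "H holomorphic_on B" by (rule holomorphic_transform[OF holQ]) (use DQ in \<open>auto simp: H_def A_def\<close>)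
  ultimately have holH: "H holomorphic_on UNIV"
    using holomorphic_on_Un[OF _ _ openA openB] AB by metis
  obtain C2 d2 where d2: "d2 > 0" and b2: "\<And>u. u > 0 \<Longrightarrow>
      norm ((\<psi> (of_real u) - \<psi> 0 * exp (- of_real u)) / (of_real u)\<^sup>2) \<le> C2 * u powr (- 1) * exp (- d2 * u)"
    using subtracted_bound by blast
  define \<phi>2 where "\<phi>2 u = (\<psi> (of_real u) - \<psi> 0 * exp (- of_real u)) / (of_real u)\<^sup>2" for u :: real
  have cont2: "continuous_on {0<..} \<phi>2"
    unfolding \<phi>2_def by (intro continuous_intros psi_continuous_real) auto
  have bound2: "norm (\<phi>2 u) \<le> C2 * u powr (- 1) * exp (- d2 * u)" if "u > 0" for u
    using b2[OF that] by (simp add: \<phi>2_def)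
  have hol2: "mellin \<phi>2 holomorphic_on {s. Re s > 1}"
    by (rule mellin_holomorphic[OF cont2 d2 bound2])
  have D2: "D s = \<psi> 0 + (s - 1) * (s - 2) * (mellin \<phi>2 s * rGamma s)" if s: "Re s > 2" for s
  proof -
    have i1: "set_integrable lborel {0<..} (\<lambda>u. of_real u powr (s - 2 - 1) * exp (- 1 * of_real u))"
      using s by (intro mellin_exp_integrable) auto
    have i2: "set_integrable lborel {0<..} (\<lambda>u. of_real u powr (s - 1) * \<phi>2 u)"
      using s by (intro mellin_integrable[OF cont2 d2 bound2]) auto
    have "mellin \<phi> s = (LINT u:{0<..}|lborel. \<psi> 0 * (of_real u powr (s - 2 - 1) * exp (- 1 * of_real u)) + of_real u powr (s - 1) * \<phi>2 u)"
      unfolding mellin_def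
    proof (rule set_lebesgue_integral_cong)
      show "\<forall>u. u \<in> {0<..} \<longrightarrow> of_real u powr (s - 1) * \<phi> u = \<psi> 0 * (of_real u powr (s - 2 - 1) * exp (- 1 * of_real u)) + of_real u powr (s - 1) * \<phi>2 u"
      proof (intro allI impI)
        fix u :: real assume u: "u \<in> {0<..}"
        have "complex_of_real u powr (s - 2 - 1) = of_real u powr (s - 1) / (of_real u)\<^sup>2"
          using u powr_diff[of "complex_of_real u" "s - 1" 2] by (simp add: powr_numeral algebra_simps)
        then show "of_real u powr (s - 1) * \<phi> u = \<psi> 0 * (of_real u powr (s - 2 - 1) * exp (- 1 * of_real u)) + of_real u powr (s - 1) * \<phi>2 u"
          by (simp add: \<phi>2_def diff_divide_distrib algebra_simps)
      qed
    qed auto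
    also have "\<dots> = \<psi> 0 * mellin (\<lambda>u. exp (- 1 * of_real u)) (s - 2) + mellin \<phi>2 s"
      unfolding mellin_def using i1 i2 by (subst set_integral_add) auto
    also have "mellin (\<lambda>u. exp (- 1 * of_real u)) (s - 2) = Gamma (s - 2)"
      using s by (subst mellin_exp) auto
    finally have m: "mellin \<phi> s = \<psi> 0 * Gamma (s - 2) + mellin \<phi>2 s" .
    have "(s - 1) * (s - 2) * (Gamma (s - 2) * rGamma s) = 1"
    proof -
      have np: "s - 2 \<notin> \<int>\<^sub>\<le>\<^sub>0" "s - 1 \<notin> \<int>\<^sub>\<le>\<^sub>0" "s \<notin> \<int>\<^sub>\<le>\<^sub>0"
        using s by (auto elim!: nonpos_Ints_cases simp: complex_eq_iff)
      have "Gamma s = (s - 1) * Gamma (s - 1)" using Gamma_plus1[of "s - 1"] np by simp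
      also have "Gamma (s - 1) = (s - 2) * Gamma (s - 2)" using Gamma_plus1[of "s - 2"] np by simp
      finally have G: "Gamma s = (s - 1) * (s - 2) * Gamma (s - 2)" by (simp only: mult.assoc)
      have G0: "Gamma s \<noteq> 0" using np by (simp add: Gamma_eq_zero_iff)
      have "(s - 1) * (s - 2) * (Gamma (s - 2) * rGamma s) = Gamma s * rGamma s"
        unfolding G by (simp only: mult.assoc)
      also have "\<dots> = 1" using G0 by (simp add: rGamma_inverse_Gamma)
      finally show ?thesis .
    qed
    then have "\<psi> 0 * ((s - 1) * (s - 2) * (Gamma (s - 2) * rGamma s)) = \<psi> 0" by simp
    then show ?thesis unfolding D_def m by (simp add: algebra_simps)
  qed
  \<comment> \<open>The direct formula stops at Re s > 2. After the subtraction it extends to Re s >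
    1, and at s = 2 the remainder is killed by the factor s - 2.\<close>
  have "H 2 = \<psi> 0 + (2 - 1) * (2 - 2) * (mellin \<phi>2 2 * rGamma 2)"
  proof (rule halfplane_continuation[where a = 1 and b = 2 and f = H
      and g = "\<lambda>s. \<psi> 0 + (s - 1) * (s - 2) * (mellin \<phi>2 s * rGamma s)"])
    show "H holomorphic_on {s. 1 < Re s}" using holH holomorphic_on_subset by blast
    show "(\<lambda>s. \<psi> 0 + (s - 1) * (s - 2) * (mellin \<phi>2 s * rGamma s)) holomorphic_on {s. 1 < Re s}"
      by (intro holomorphic_intros hol2)
  qed (auto simp: H_def D2)
  then have "H 2 = \<psi> 0" by simp
  moreover have "(s - 1) * (s - 2) * (mellin \<phi> s / Gamma s) = H s" if "Re s > 2" for s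
    using that by (simp add: H_def D_def rGamma_inverse_Gamma divide_inverse)
  ultimately show ?thesis using holH by blast
qed

end

section \<open>Holomorphy and decay of the kernels near the cut\<close>

definition geom_ker0 :: "real \<Rightarrow> complex \<Rightarrow> complex \<Rightarrow> complex" where
  "geom_ker0 x w u = (if u = 0 then 1 / w else u * geom_ker x w u)"

text \<open>A quarter of the vertical spacing 2 pi Re w / |w|^2 of the zeros of 1 - e^(-wu). A strip
  of half-height 2 \<eta> then reaches at most halfway to the next zero.\<close>

definition strip_width :: "complex \<Rightarrow> real" where
  "strip_width w = pi * Re w / (2 * (norm w)\<^sup>2)"

lemma strip_width_pos: "Re w > 0 \<Longrightarrow> strip_width w > 0"
  by (auto simp: strip_width_def intro!: divide_pos_pos)

lemma exp_eq_1_points: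
  assumes w: "Re w > 0" and e: "exp (- w * u) = 1"
  shows "\<exists>n::int. u = - (of_int (2 * n) * of_real pi * \<i>) / w \<and> \<bar>Im u\<bar> = \<bar>real_of_int n\<bar> * (4 * strip_width w)"
proof -
  have w0: "w \<noteq> 0" using w by auto
  from e obtain n :: int where "Re (- w * u) = 0" "Im (- w * u) = of_int (2 * n) * pi"
    unfolding exp_eq_1 by blast
  then have n: "- w * u = of_int (2 * n) * of_real pi * \<i>"
    by (simp only: complex_eq_iff) simp
  have "u = - (- w * u) / w" using w0 by simp
  then have u: "u = - (of_int (2 * n) * of_real pi * \<i>) / w" unfolding n .
  also have "\<dots> = - (of_real (2 * n * pi) * \<i> * cnj w) / (of_real ((norm w)\<^sup>2))"
  proof -
    have nw: "of_real ((norm w)\<^sup>2) = w * cnj w" by (simp only: complex_norm_square)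
    show ?thesis unfolding nw using w0 by (simp add: field_simps)
  qed
  finally have "Im u = - (2 * n * pi * Re w) / (norm w)\<^sup>2"
    by (simp add: Im_divide_of_real)
  then have "\<bar>Im u\<bar> = \<bar>real_of_int n\<bar> * (4 * strip_width w)"
    using w by (simp add: strip_width_def abs_mult abs_divide)
  with u show ?thesis by blast
qed

lemma exp_eq_1_strip:
  assumes w: "Re w > 0" and e: "exp (- w * u) = 1" and u: "\<bar>Im u\<bar> \<le> 2 * strip_width w"
  shows "u = 0"
proof -
  from exp_eq_1_points[OF w e] obtain n :: int
    where n: "u = - (of_int (2 * n) * of_real pi * \<i>) / w" "\<bar>Im u\<bar> = \<bar>real_of_int n\<bar> * (4 * strip_width w)"
    by blast
  then have "\<bar>real_of_int n\<bar> * (4 * strip_width w) \<le> 1/2 * (4 * strip_width w)"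
    using u by simp
  then have "\<bar>real_of_int n\<bar> \<le> 1/2"
    using strip_width_pos[OF w] by (subst (asm) mult_le_cancel_right) auto
  then have "n = 0" by linarith
  then show ?thesis using n(1) by simp
qed

text \<open>The imaginary parts of these points are integer multiples of a fixed positive number.
  This supplies the finiteness of the poles in a horizontal strip that the deformation of the loop
  relies on.\<close>

lemma finite_exp_eq_1:
  assumes w: "Re w > 0"
  shows "finite ({u. exp (- w * u) = 1} \<inter> {u. \<bar>Im u\<bar> \<le> B})"
proof (rule finite_subset)
  define N where "N = \<lceil>B / (4 * strip_width w)\<rceil>"
  show "finite ((\<lambda>n::int. - (of_int (2 * n) * of_real pi * \<i>) / w) ` {- N..N})" by simp
  show "{u. exp (- w * u) = 1} \<inter> {u. \<bar>Im u\<bar> \<le> B} \<subseteq> (\<lambda>n::int. - (of_int (2 * n) * of_real pi * \<i>) / w) ` {- N..N}"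
  proof
    fix u assume u: "u \<in> {u. exp (- w * u) = 1} \<inter> {u. \<bar>Im u\<bar> \<le> B}"
    then have e: "exp (- w * u) = 1" by simp
    from exp_eq_1_points[OF w e] obtain n :: int
      where n: "u = - (of_int (2 * n) * of_real pi * \<i>) / w" "\<bar>Im u\<bar> = \<bar>real_of_int n\<bar> * (4 * strip_width w)"
      by blast
    have "\<bar>real_of_int n\<bar> \<le> B / (4 * strip_width w)"
      using n(2) u strip_width_pos[OF w] by (simp add: pos_le_divide_eq)
    then have "\<bar>n\<bar> \<le> N" unfolding N_def by linarith
    then show "u \<in> (\<lambda>n::int. - (of_int (2 * n) * of_real pi * \<i>) / w) ` {- N..N}"
      using n(1) by (intro image_eqI[of _ _ n]) auto
  qed
qed

text \<open>The denominator divided by u is entire and has no zero in the strip, which gives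
  holomorphy. For the bound, compactness covers the left part; far to the right the denominator
  stays away from 0, and the remaining factor u is absorbed by the \<epsilon> in the
  exponent.\<close>

lemma geom_ker0_strip:
  assumes w: "Re w > 0" and \<eta>: "0 < \<eta>" "\<eta> \<le> strip_width w"
  shows "geom_ker0 x w holomorphic_on strip \<eta>"
    and "\<epsilon> > 0 \<Longrightarrow> \<exists>C\<ge>0. \<forall>u\<in>strip \<eta>. norm (geom_ker0 x w u) \<le> C * exp ((\<epsilon> - x * Re w) * Re u)"
proof -
  have w0: "w \<noteq> 0" using w by auto
  \<comment> \<open>The difference quotient of 1 - e^(-wu) at 0, completed by the derivative and
    therefore entire.\<close>
  define q where "q u = (if u = 0 then w else (1 - exp (- w * u)) / u)" for u
  have "(\<lambda>u. if u = 0 then deriv (\<lambda>u. 1 - exp (- w * u)) 0 else ((1 - exp (- w * u)) - (1 - exp (- w * 0))) / (u - 0)) holomorphic_on UNIV"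
    by (intro pole_lemma_open holomorphic_intros) auto
  moreover have d: "deriv (\<lambda>u. 1 - exp (- w * u)) 0 = w"
    by (intro DERIV_imp_deriv) (auto intro!: derivative_eq_intros)
  have "(\<lambda>u. if u = 0 then deriv (\<lambda>u. 1 - exp (- w * u)) 0 else ((1 - exp (- w * u)) - (1 - exp (- w * 0))) / (u - 0)) = q"
    by (rule ext) (simp only: d q_def, simp)
  ultimately have holq: "q holomorphic_on UNIV" by simp
  have q0: "q u \<noteq> 0" if "\<bar>Im u\<bar> \<le> 2 * \<eta>" for u
    using exp_eq_1_strip[OF w, of u] that \<eta> w0 by (auto simp: q_def)
  have strip_q0: "q u \<noteq> 0" if "u \<in> strip \<eta>" for u using that by (intro q0) (auto simp: strip_def)
  have ker: "geom_ker0 x w u = exp (- of_real x * w * u) / q u" for u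
    by (simp add: geom_ker0_def geom_ker_def q_def)
  show "geom_ker0 x w holomorphic_on strip \<eta>"
    unfolding ker[abs_def] using strip_q0 by (intro holomorphic_intros holomorphic_on_subset[OF holq]) auto
  assume eps: "\<epsilon> > 0"
  \<comment> \<open>Chosen so that Re (w u) \<ge> 1 in the strip to the right of R, whence |e^(-wu)|
    \<le> 1/2 there.\<close>
  define R where "R = (1 + \<bar>Im w\<bar> * (2 * \<eta>)) / Re w"
  have R: "R > 0" using w \<eta> by (auto simp: R_def intro!: divide_pos_pos add_pos_nonneg)
  define K where "K = cbox (Complex (- (2 * \<eta>)) (- (2 * \<eta>))) (Complex R (2 * \<eta>))"
  have "continuous_on K (\<lambda>u. 1 / q u)"
    by (intro continuous_intros holomorphic_on_imp_continuous_on holomorphic_on_subset[OF holq])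
       (use q0 in \<open>auto simp: K_def in_cbox_complex_iff abs_le_iff\<close>)
  then have "compact ((\<lambda>u. 1 / q u) ` K)" by (intro compact_continuous_image) (auto simp: K_def)
  then have "bounded ((\<lambda>u. 1 / q u) ` K)" by (rule compact_imp_bounded)
  then obtain C1 where C1: "\<And>u. u \<in> K \<Longrightarrow> norm (1 / q u) \<le> C1"
    by (auto simp: bounded_iff)
  obtain C2 where C2: "C2 \<ge> 0" "\<And>u. u \<in> strip \<eta> \<Longrightarrow> norm u \<le> C2 * exp (\<epsilon> * Re u)"
    using strip_norm_le_exp[OF eps \<eta>(1)] by blast
  define C3 where "C3 = max C1 0 * exp (\<epsilon> * (2 * \<eta>)) + 2 * C2"
  have C3: "C3 \<ge> 0" using C2 by (auto simp: C3_def)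
  have qb: "norm (1 / q u) \<le> C3 * exp (\<epsilon> * Re u)" if u: "u \<in> strip \<eta>" for u
  proof (cases "Re u \<le> R")
    case True
    then have "u \<in> K" using u by (auto simp: K_def in_cbox_complex_iff strip_def)
    then have "norm (1 / q u) \<le> max C1 0 * 1" using C1[of u] by auto
    also have "\<dots> \<le> max C1 0 * (exp (\<epsilon> * (2 * \<eta>)) * exp (\<epsilon> * Re u))"
    proof (intro mult_left_mono)
      have "0 \<le> \<epsilon> * (2 * \<eta> + Re u)" using eps u by (intro mult_nonneg_nonneg) (auto simp: strip_def)
      then show "1 \<le> exp (\<epsilon> * (2 * \<eta>)) * exp (\<epsilon> * Re u)" by (simp add: algebra_simps flip: exp_add)
    qed auto
    also have "\<dots> \<le> C3 * exp (\<epsilon> * Re u)" using C2(1) by (simp add: C3_def algebra_simps)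
    finally show ?thesis .
  next
    case False
    then have u0: "u \<noteq> 0" using R by auto
    have "Re w * Re u \<ge> 1 + \<bar>Im w\<bar> * (2 * \<eta>)"
      using False w by (simp add: R_def field_simps)
    moreover have "Im w * Im u \<le> \<bar>Im w\<bar> * (2 * \<eta>)"
    proof -
      have "Im w * Im u \<le> \<bar>Im w\<bar> * \<bar>Im u\<bar>" by (metis abs_ge_self abs_mult)
      also have "\<dots> \<le> \<bar>Im w\<bar> * (2 * \<eta>)" using u by (intro mult_left_mono) (auto simp: strip_def)
      finally show ?thesis .
    qed
    ultimately have "Re (w * u) \<ge> 1" by simp
    then have "norm (exp (- w * u)) \<le> exp (-1)" by simp
    also have "\<dots> \<le> 1/2" using exp_ge_add_one_self[of 1] by (simp add: exp_minus field_simps)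
    finally have "norm (1 - exp (- w * u)) \<ge> 1/2"
      using norm_triangle_ineq2[of 1 "exp (- w * u)"] by simp
    then have "norm u / norm (1 - exp (- w * u)) \<le> norm u / (1/2)"
      by (intro divide_left_mono) auto
    then have "norm (1 / q u) \<le> 2 * norm u" using u0 by (simp add: q_def norm_divide)
    also have "\<dots> \<le> 2 * C2 * exp (\<epsilon> * Re u)" using C2(2)[OF u] by simp
    also have "\<dots> \<le> C3 * exp (\<epsilon> * Re u)" by (intro mult_right_mono) (auto simp: C3_def)
    finally show ?thesis .
  qed
  define C4 where "C4 = exp (\<bar>x\<bar> * (\<bar>Im w\<bar> * (2 * \<eta>)))"
  have eb: "norm (exp (- of_real x * w * u)) \<le> C4 * exp (- (x * Re w) * Re u)" if u: "u \<in> strip \<eta>" for u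
  proof -
    have "x * (Im w * Im u) \<le> \<bar>x\<bar> * (\<bar>Im w\<bar> * \<bar>Im u\<bar>)" by (metis abs_ge_self abs_mult)
    also have "\<dots> \<le> \<bar>x\<bar> * (\<bar>Im w\<bar> * (2 * \<eta>))" using u by (intro mult_left_mono) (auto simp: strip_def)
    finally have "- x * Re (w * u) \<le> \<bar>x\<bar> * (\<bar>Im w\<bar> * (2 * \<eta>)) + (- (x * Re w) * Re u)" by (simp add: algebra_simps)
    moreover have "norm (exp (- of_real x * w * u)) = exp (- x * Re (w * u))"
      by (simp add: mult.assoc)
    ultimately show ?thesis unfolding C4_def by (simp only: exp_add[symmetric] exp_le_cancel_iff)
  qed
  have "norm (geom_ker0 x w u) \<le> (C4 * C3) * exp ((\<epsilon> - x * Re w) * Re u)" if u: "u \<in> strip \<eta>" for u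
  proof -
    have "norm (geom_ker0 x w u) = norm (exp (- of_real x * w * u)) * norm (1 / q u)"
      by (simp add: ker norm_divide)
    also have "\<dots> \<le> (C4 * exp (- (x * Re w) * Re u)) * (C3 * exp (\<epsilon> * Re u))"
      using eb[OF u] qb[OF u] by (intro mult_mono) (auto simp: C4_def)
    also have "\<dots> = (C4 * C3) * (exp (- (x * Re w) * Re u) * exp (\<epsilon> * Re u))" by simp
    also have "exp (- (x * Re w) * Re u) * exp (\<epsilon> * Re u) = exp ((\<epsilon> - x * Re w) * Re u)"
      by (simp add: algebra_simps flip: exp_add)
    finally show ?thesis .
  qed
  then show "\<exists>C\<ge>0. \<forall>u\<in>strip \<eta>. norm (geom_ker0 x w u) \<le> C * exp ((\<epsilon> - x * Re w) * Re u)"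
    using C3 by (intro exI[of _ "C4 * C3"]) (auto simp: C4_def)
qed

lemma hankel_cone_2:
  assumes w: "Re \<omega>1 > 0" "Re \<omega>2 > 0" and xy: "x \<ge> 0" "y \<ge> 0" "x + y > 0"
    and \<eta>: "0 < \<eta>" "\<eta> \<le> strip_width \<omega>1" "\<eta> \<le> strip_width \<omega>2"
  shows "\<exists>\<delta> C. hankel (\<lambda>u. geom_ker0 x \<omega>1 u * geom_ker0 y \<omega>2 u) \<eta> \<delta> C"
proof -
  \<comment> \<open>Of the total decay rate 2 \<delta> each kernel gives up \<delta>/2 to absorb its
    factor u.\<close>
  define \<delta> where "\<delta> = (x * Re \<omega>1 + y * Re \<omega>2) / 2"
  have "x * Re \<omega>1 + y * Re \<omega>2 > 0"
    using w xy by (cases "x = 0") (auto intro: add_pos_nonneg)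
  then have \<delta>: "\<delta> > 0" by (simp add: \<delta>_def)
  then have \<epsilon>: "\<delta> / 2 > 0" by simp
  obtain C1 where C1: "C1 \<ge> 0" "\<And>u. u \<in> strip \<eta> \<Longrightarrow> norm (geom_ker0 x \<omega>1 u) \<le> C1 * exp ((\<delta> / 2 - x * Re \<omega>1) * Re u)"
    using geom_ker0_strip(2)[OF w(1) \<eta>(1,2) \<epsilon>] by blast
  obtain C2 where C2: "C2 \<ge> 0" "\<And>u. u \<in> strip \<eta> \<Longrightarrow> norm (geom_ker0 y \<omega>2 u) \<le> C2 * exp ((\<delta> / 2 - y * Re \<omega>2) * Re u)"
    using geom_ker0_strip(2)[OF w(2) \<eta>(1,3) \<epsilon>] by blast
  have "hankel (\<lambda>u. geom_ker0 x \<omega>1 u * geom_ker0 y \<omega>2 u) \<eta> \<delta> (C1 * C2)"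
  proof
    show "(\<lambda>u. geom_ker0 x \<omega>1 u * geom_ker0 y \<omega>2 u) holomorphic_on strip \<eta>"
      by (intro holomorphic_intros geom_ker0_strip w \<eta>)
    fix u assume u: "u \<in> strip \<eta>"
    have "norm (geom_ker0 x \<omega>1 u * geom_ker0 y \<omega>2 u) \<le> (C1 * exp ((\<delta> / 2 - x * Re \<omega>1) * Re u)) * (C2 * exp ((\<delta> / 2 - y * Re \<omega>2) * Re u))"
      unfolding norm_mult using C1(2)[OF u] C2(2)[OF u] C1(1) by (intro mult_mono) auto
    also have "\<dots> = C1 * C2 * (exp ((\<delta> / 2 - x * Re \<omega>1) * Re u) * exp ((\<delta> / 2 - y * Re \<omega>2) * Re u))" by simp
    also have "exp ((\<delta> / 2 - x * Re \<omega>1) * Re u) * exp ((\<delta> / 2 - y * Re \<omega>2) * Re u) = exp (- \<delta> * Re u)"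
    proof -
      have "x * Re \<omega>1 + y * Re \<omega>2 = 2 * \<delta>" by (simp add: \<delta>_def)
      then have "(\<delta> / 2 - x * Re \<omega>1) + (\<delta> / 2 - y * Re \<omega>2) = - \<delta>" by linarith
      then show ?thesis by (simp only: exp_add[symmetric] distrib_right[symmetric])
    qed
    finally show "norm (geom_ker0 x \<omega>1 u * geom_ker0 y \<omega>2 u) \<le> C1 * C2 * exp (- \<delta> * Re u)" .
  qed (use \<eta> \<delta> in auto)
  then show ?thesis by blast
qed

text \<open>A single kernel has only a simple pole, so u^2 times it vanishes at 0. The
  one-dimensional case thus becomes an instance of the same locale, with \<psi>(0) = 0.\<close>

lemma hankel_cone_1:
  assumes w: "Re \<omega> > 0" and y: "y > 0" and \<eta>: "0 < \<eta>" "\<eta> \<le> strip_width \<omega>"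
  shows "\<exists>\<delta> C. hankel (\<lambda>u. u * geom_ker0 y \<omega> u) \<eta> \<delta> C"
proof -
  define \<delta> where "\<delta> = y * Re \<omega> / 2"
  have \<delta>: "\<delta> > 0" using w y by (simp add: \<delta>_def)
  then have \<epsilon>: "\<delta> / 2 > 0" by simp
  obtain C1 where C1: "C1 \<ge> 0" "\<And>u. u \<in> strip \<eta> \<Longrightarrow> norm u \<le> C1 * exp (\<delta> / 2 * Re u)"
    using strip_norm_le_exp[OF \<epsilon> \<eta>(1)] by blast
  obtain C2 where C2: "C2 \<ge> 0" "\<And>u. u \<in> strip \<eta> \<Longrightarrow> norm (geom_ker0 y \<omega> u) \<le> C2 * exp ((\<delta> / 2 - y * Re \<omega>) * Re u)"
    using geom_ker0_strip(2)[OF w \<eta> \<epsilon>] by blast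
  have "hankel (\<lambda>u. u * geom_ker0 y \<omega> u) \<eta> \<delta> (C1 * C2)"
  proof
    show "(\<lambda>u. u * geom_ker0 y \<omega> u) holomorphic_on strip \<eta>"
      by (intro holomorphic_intros geom_ker0_strip w \<eta>)
    fix u assume u: "u \<in> strip \<eta>"
    have "norm (u * geom_ker0 y \<omega> u) \<le> (C1 * exp (\<delta> / 2 * Re u)) * (C2 * exp ((\<delta> / 2 - y * Re \<omega>) * Re u))"
      unfolding norm_mult using C1(2)[OF u] C2(2)[OF u] C1(1) by (intro mult_mono) auto
    also have "\<dots> = C1 * C2 * (exp (\<delta> / 2 * Re u) * exp ((\<delta> / 2 - y * Re \<omega>) * Re u))" by simp
    also have "exp (\<delta> / 2 * Re u) * exp ((\<delta> / 2 - y * Re \<omega>) * Re u) = exp (- \<delta> * Re u)"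
    proof -
      have "\<delta> / 2 + (\<delta> / 2 - y * Re \<omega>) = - \<delta>" by (simp add: \<delta>_def)
      then show ?thesis by (simp only: exp_add[symmetric] distrib_right[symmetric])
    qed
    finally show "norm (u * geom_ker0 y \<omega> u) \<le> C1 * C2 * exp (- \<delta> * Re u)" .
  qed (use \<eta> \<delta> in auto)
  then show ?thesis by blast
qed

text \<open>The value at 2 does not depend on the apex of the cone, that is, on x and y; this is
  what later lets whole quadrants cancel.\<close>

lemma cone_entire_2:
  assumes w: "Re \<omega>1 > 0" "Re \<omega>2 > 0" and xy: "x \<ge> 0" "y \<ge> 0" "x + y > 0"
  shows "\<exists>H. H holomorphic_on UNIV \<and> H 2 = 1 / (\<omega>1 * \<omega>2) \<and>
     (\<forall>s. Re s > 2 \<longrightarrow> (s - 1) * (s - 2) * (mellin (\<lambda>u. geom_ker x \<omega>1 (of_real u) * geom_ker y \<omega>2 (of_real u)) s / Gamma s) = H s)"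
proof -
  define \<eta> where "\<eta> = min (strip_width \<omega>1) (strip_width \<omega>2)"
  have \<eta>: "\<eta> > 0" "\<eta> \<le> strip_width \<omega>1" "\<eta> \<le> strip_width \<omega>2"
    using strip_width_pos w by (auto simp: \<eta>_def)
  obtain \<delta> C where "hankel (\<lambda>u. geom_ker0 x \<omega>1 u * geom_ker0 y \<omega>2 u) \<eta> \<delta> C"
    using hankel_cone_2[OF w xy \<eta>] by blast
  from hankel.entire_continuation[OF this] obtain H where H: "H holomorphic_on UNIV"
    "\<And>s. Re s > 2 \<Longrightarrow> (s - 1) * (s - 2) * (mellin (\<lambda>u. geom_ker0 x \<omega>1 (of_real u) * geom_ker0 y \<omega>2 (of_real u) / (of_real u)\<^sup>2) s / Gamma s) = H s"
    "H 2 = geom_ker0 x \<omega>1 0 * geom_ker0 y \<omega>2 0" by blast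
  have "mellin (\<lambda>u. geom_ker0 x \<omega>1 (of_real u) * geom_ker0 y \<omega>2 (of_real u) / (of_real u)\<^sup>2) s
      = mellin (\<lambda>u. geom_ker x \<omega>1 (of_real u) * geom_ker y \<omega>2 (of_real u)) s" for s
    unfolding mellin_def by (rule set_lebesgue_integral_cong) (auto simp: geom_ker0_def power2_eq_square)
  then show ?thesis using H by (intro exI[of _ H]) (auto simp: geom_ker0_def)
qed

text \<open>The entire function supplied by the locale carries one factor s - 2 too many, but it
  vanishes at 2, so the factor can be divided out. The formula then extends to Re s > 1, because the
  kernel is only O(1/u) at 0 and its Mellin transform is holomorphic there.\<close>

lemma cone_entire_1:
  assumes w: "Re \<omega> > 0" and y: "y > 0"
  shows "\<exists>K. K holomorphic_on UNIV \<and>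
     (\<forall>s. Re s > 1 \<longrightarrow> (s - 1) * (mellin (\<lambda>u. geom_ker y \<omega> (of_real u)) s / Gamma s) = K s)"
proof -
  define \<eta> where "\<eta> = strip_width \<omega>"
  have \<eta>: "\<eta> > 0" "\<eta> \<le> strip_width \<omega>" using strip_width_pos w by (auto simp: \<eta>_def)
  obtain \<delta> C where "hankel (\<lambda>u. u * geom_ker0 y \<omega> u) \<eta> \<delta> C"
    using hankel_cone_1[OF w y \<eta>] by blast
  from hankel.entire_continuation[OF this] obtain H where H: "H holomorphic_on UNIV"
    "\<And>s. Re s > 2 \<Longrightarrow> (s - 1) * (s - 2) * (mellin (\<lambda>u. of_real u * geom_ker0 y \<omega> (of_real u) / (of_real u)\<^sup>2) s / Gamma s) = H s"
    "H 2 = 0" by auto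
  define \<phi> where "\<phi> = (\<lambda>u. geom_ker y \<omega> (complex_of_real u))"
  have m: "mellin (\<lambda>u. of_real u * geom_ker0 y \<omega> (of_real u) / (of_real u)\<^sup>2) s = mellin \<phi> s" for s
    unfolding mellin_def \<phi>_def by (rule set_lebesgue_integral_cong) (auto simp: geom_ker0_def power2_eq_square)
  define a where "a = Re \<omega>"
  define d where "d = y * a / 2"
  have a: "a > 0" "d > 0" using w y by (auto simp: a_def d_def)
  have ne: "1 - exp (- \<omega> * of_real u) \<noteq> 0" if "u > 0" for u
  proof -
    have "norm (exp (- \<omega> * of_real u)) < 1" using w that by simp
    show ?thesis
    proof
      assume "1 - exp (- \<omega> * of_real u) = 0"
      then have "exp (- \<omega> * of_real u) = 1" by simp
      with \<open>norm (exp (- \<omega> * of_real u)) < 1\<close> show False by (metis norm_one less_irrefl)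
    qed
  qed
  have cont: "continuous_on {0<..} \<phi>"
    unfolding \<phi>_def geom_ker_def using ne by (intro continuous_intros) auto
  have bnd: "norm (\<phi> u) \<le> (1 / a + 1 / d) * u powr (- 1) * exp (- d * u)" if u: "u > 0" for u
  proof -
    have "1 - exp (- a * u) \<le> norm (1 - exp (- \<omega> * of_real u))"
      using norm_triangle_ineq2[of 1 "exp (- \<omega> * of_real u)"] by (simp add: a_def)
    moreover have "1 - exp (- a * u) > 0" using a u by simp
    ultimately have "norm (\<phi> u) \<le> exp (- y * a * u) * (1 / (1 - exp (- a * u)))"
      unfolding \<phi>_def geom_ker_def norm_divide by (simp add: a_def frac_le)
    also have "\<dots> \<le> exp (- y * a * u) * ((1 / a + 1 / d) * u powr (- 1) * exp (d * u))"
      by (intro mult_left_mono geom_inverse_bound a u) auto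
    also have "\<dots> = (1 / a + 1 / d) * u powr (- 1) * (exp (- y * a * u) * exp (d * u))" by simp
    also have "exp (- y * a * u) * exp (d * u) = exp (- d * u)" by (simp add: d_def flip: exp_add)
    finally show ?thesis .
  qed
  have holM: "mellin \<phi> holomorphic_on {s. Re s > 1}"
    by (rule mellin_holomorphic[OF cont a(2) bnd])
  define K where "K = (\<lambda>z. if z = 2 then deriv H 2 else (H z - H 2) / (z - 2))"
  have holK: "K holomorphic_on UNIV"
    unfolding K_def by (intro pole_lemma_open H) auto
  have "(s - 1) * (mellin \<phi> s * rGamma s) = K s" if s: "Re s > 1" for s
  proof (rule halfplane_continuation[where a = 1 and b = 2 and f = "\<lambda>s. (s - 1) * (mellin \<phi> s * rGamma s)"])
    show "(s - 1) * (mellin \<phi> s * rGamma s) = K s" if "Re s > 2" for s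
    proof -
      have "s \<noteq> 2" using that by auto
      moreover have "(s - 1) * (s - 2) * (mellin \<phi> s * rGamma s) = H s"
        using H(2)[OF that, unfolded m] by (simp only: rGamma_inverse_Gamma divide_inverse)
      ultimately show ?thesis by (simp add: K_def H(3) field_simps)
    qed
  qed (use s in \<open>auto intro!: holomorphic_intros holM holomorphic_on_subset[OF holK]\<close>)
  then show ?thesis
    using holK by (intro exI[of _ K]) (auto simp: \<phi>_def rGamma_inverse_Gamma divide_inverse)
qed

section \<open>Powers with argument in \<open>[-\<pi>, \<pi>)\<close>\<close>

lemma arg_lo_polar:
  assumes "w \<noteq> 0"
  shows "w = of_real (norm w) * exp (\<i> * of_real (arg_lo w))" "- pi \<le> arg_lo w" "arg_lo w < pi"
proof -
  show "w = of_real (norm w) * exp (\<i> * of_real (arg_lo w))"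
  proof (cases "Arg w = pi")
    case True
    have e: "exp (\<i> * of_real (- pi)) = exp (\<i> * of_real pi)" by (simp add: exp_minus)
    have "arg_lo w = - pi" using True by (simp add: arg_lo_def)
    then show ?thesis using Arg_eq[OF assms] unfolding True e[symmetric] by (simp only:)
  next
    case False
    then show ?thesis unfolding arg_lo_def using Arg_eq[OF assms] by (simp only: if_False)
  qed
  show "- pi \<le> arg_lo w" "arg_lo w < pi"
    using Arg_bounded[of w] pi_gt_zero by (auto simp: arg_lo_def)
qed

lemma arg_lo_unique:
  assumes "w = of_real r * exp (\<i> * of_real \<theta>)" "r > 0" "- pi \<le> \<theta>" "\<theta> < pi"
  shows "arg_lo w = \<theta>"
proof (cases "\<theta> = - pi")
  case True
  have e: "exp (\<i> * of_real (- pi)) = exp (\<i> * of_real pi)" by (simp add: exp_minus)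
  have "Arg w = pi"
    using assms unfolding True e by (intro Arg_unique[of r pi]) auto
  then show ?thesis using True by (simp add: arg_lo_def)
next
  case False
  then have "Arg w = \<theta>" using assms by (intro Arg_unique[of r \<theta>]) auto
  then show ?thesis using assms by (simp add: arg_lo_def)
qed

text \<open>The half-open half-plane arg w in [0, pi). Of w and -w with w nonzero exactly one
  belongs to it, which fits arguments in [-pi, pi).\<close>

definition upper :: "complex \<Rightarrow> bool" where
  "upper w \<longleftrightarrow> Im w > 0 \<or> (Im w = 0 \<and> Re w > 0)"

lemma upper_nonzero: "upper w \<Longrightarrow> w \<noteq> 0"
  by (auto simp: upper_def)

lemma upper_cases: "w \<noteq> 0 \<Longrightarrow> upper w \<or> upper (- w)"
  by (auto simp: upper_def complex_eq_iff)

lemma upper_not_minus: "upper w \<Longrightarrow> \<not> upper (- w)"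
  by (auto simp: upper_def)

lemma upper_iff_arg_lo: "w \<noteq> 0 \<Longrightarrow> upper w \<longleftrightarrow> arg_lo w \<ge> 0"
proof -
  assume w: "w \<noteq> 0"
  have "Arg w = pi \<longleftrightarrow> Im w = 0 \<and> Re w < 0" using Arg_eq_pi by auto
  moreover have "Arg w < 0 \<longleftrightarrow> Im w < 0" by (rule Arg_neg_iff)
  moreover have "\<not> pi \<le> 0" using pi_gt_zero by linarith
  ultimately show ?thesis
    using w by (auto simp: upper_def arg_lo_def complex_eq_iff not_less) 
qed

lemma arg_lo_minus:
  assumes "upper w"
  shows "arg_lo (- w) = arg_lo w - pi"
proof (rule arg_lo_unique)
  have w: "w \<noteq> 0" using assms by (rule upper_nonzero)
  have "exp (\<i> * of_real (arg_lo w - pi)) = - exp (\<i> * of_real (arg_lo w))"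
    by (simp add: exp_diff right_diff_distrib)
  then show "- w = of_real (norm w) * exp (\<i> * of_real (arg_lo w - pi))"
    using arg_lo_polar(1)[OF w] by (simp only:) simp
  show "- pi \<le> arg_lo w - pi" using upper_iff_arg_lo[OF w] assms by simp
  show "arg_lo w - pi < pi" using arg_lo_polar(3)[OF w] pi_gt_zero by linarith
qed (use assms upper_nonzero in auto)

text \<open>Negating a point with argument in [0, pi) always lowers the argument by pi, without
  exception on the boundary: the positive axis goes to -pi, not to pi.\<close>

lemma cpow_minus:
  assumes "upper w"
  shows "cpow (- w) (- s) = exp (\<i> * of_real pi * s) * cpow w (- s)"
  by (simp add: cpow_def arg_lo_minus[OF assms] algebra_simps flip: exp_add)

text \<open>Turned back by \<phi>, an argument from [0, pi) lies strictly between -pi and pi, where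
  the principal \<open>powr\<close> and its analytic theory may be used in place of
  \<open>cpow\<close>.\<close>

lemma cpow_rotate:
  assumes w: "upper w" and \<phi>: "0 < \<phi>" "\<phi> < pi"
  shows "cpow w (- s) = exp (- \<i> * of_real \<phi> * s) * (exp (- \<i> * of_real \<phi>) * w) powr (- s)"
proof -
  define \<theta> where "\<theta> = arg_lo w"
  have w0: "w \<noteq> 0" using w by (rule upper_nonzero)
  have \<theta>: "0 \<le> \<theta>" "\<theta> < pi" using upper_iff_arg_lo[OF w0] w arg_lo_polar(3)[OF w0] by (auto simp: \<theta>_def)
  have "exp (- \<i> * of_real \<phi>) * w = exp (of_real (ln (norm w)) + \<i> * of_real (\<theta> - \<phi>))"
  proof -
    have "exp (of_real (ln (norm w)) + \<i> * of_real (\<theta> - \<phi>)) = of_real (norm w) * exp (\<i> * of_real \<theta> - \<i> * of_real \<phi>)"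
      using w0 by (simp add: exp_add exp_of_real right_diff_distrib)
    also have "\<dots> = (of_real (norm w) * exp (\<i> * of_real \<theta>)) * exp (- \<i> * of_real \<phi>)"
      by (simp add: exp_diff exp_minus divide_inverse)
    also have "\<dots> = w * exp (- \<i> * of_real \<phi>)"
      unfolding \<theta>_def using arg_lo_polar(1)[OF w0] by (simp only:)
    finally show ?thesis by (simp only: mult.commute)
  qed
  then have "Ln (exp (- \<i> * of_real \<phi>) * w) = of_real (ln (norm w)) + \<i> * of_real (\<theta> - \<phi>)"
    using \<theta> \<phi> by (simp only:) (subst Ln_exp, auto)
  moreover have "exp (- \<i> * of_real \<phi>) * w \<noteq> 0" using w0 by simp
  ultimately have "(exp (- \<i> * of_real \<phi>) * w) powr (- s) = exp (- s * (of_real (ln (norm w)) + \<i> * of_real (\<theta> - \<phi>)))"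
    by (simp only: powr_def if_False)
  then have "exp (- \<i> * of_real \<phi> * s) * (exp (- \<i> * of_real \<phi>) * w) powr (- s) =
      exp (- \<i> * of_real \<phi> * s + (- s * (of_real (ln (norm w)) + \<i> * of_real (\<theta> - \<phi>))))"
    by (simp only: exp_add)
  also have "- \<i> * of_real \<phi> * s + (- s * (of_real (ln (norm w)) + \<i> * of_real (\<theta> - \<phi>))) = - s * (of_real (ln (norm w)) + \<i> * of_real \<theta>)"
    by (simp add: algebra_simps)
  finally show ?thesis by (simp only: cpow_def \<theta>_def)
qed

lemma cpow_eq_powr:
  assumes "Re w > 0"
  shows "cpow w s = w powr s"
proof -
  have w0: "w \<noteq> 0" using assms by auto
  have "Arg w \<noteq> pi" using assms by (auto simp: Arg_eq_pi)
  then show ?thesis using w0 by (simp add: cpow_def powr_def Ln_Arg arg_lo_def Ln_of_real)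
qed

lemma cpow_entire [holomorphic_intros]:
  assumes "f holomorphic_on A"
  shows "(\<lambda>s. cpow w (f s)) holomorphic_on A"
  unfolding cpow_def using assms by (intro holomorphic_intros)

text \<open>The difference arg w - arg u lies in (-2 pi, pi). It leaves [-pi, pi) exactly if arg w <
  arg u - pi, that is, if -w has its argument in [0, arg u); adding 2 pi then produces the factor
  e(-s).\<close>

lemma cpow_divide:
  assumes u: "Im u > 0" and w: "w \<noteq> 0"
  shows "cpow (w / u) (- s) * cpow u (- s) =
    cpow w (- s) * (if upper (- w) \<and> Im (u * cnj (- w)) > 0 then exp (- 2 * of_real pi * \<i> * s) else 1)"
proof -
  have u0: "u \<noteq> 0" and uu: "upper u" using u by (auto simp: upper_def)
  define \<theta> \<alpha> where "\<theta> = arg_lo w" and "\<alpha> = arg_lo u"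
  have \<alpha>: "0 \<le> \<alpha>" "\<alpha> < pi" using upper_iff_arg_lo[OF u0] uu arg_lo_polar(3)[OF u0] by (auto simp: \<alpha>_def)
  have \<alpha>0: "\<alpha> > 0"
  proof -
    have "sin \<alpha> \<noteq> 0"
    proof
      assume "sin \<alpha> = 0"
      then have "Im (of_real (norm u) * exp (\<i> * of_real \<alpha>)) = 0" by (simp add: exp_eq_polar)
      then show False using arg_lo_polar(1)[OF u0] u unfolding \<alpha>_def by simp
    qed
    then show ?thesis using \<alpha> by (cases "\<alpha> = 0") auto
  qed
  have \<theta>: "- pi \<le> \<theta>" "\<theta> < pi" using arg_lo_polar[OF w] by (auto simp: \<theta>_def)
  define P where "P \<longleftrightarrow> upper (- w) \<and> Im (u * cnj (- w)) > 0"
  \<comment> \<open>The sign of this imaginary part tells on which side of the ray through u the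
    point -w lies.\<close>
  have Im: "Im (u * cnj (- w)) = norm u * norm w * - sin (\<alpha> - \<theta>)"
  proof -
    have "u * cnj (- w) = - ((of_real (norm u) * exp (\<i> * of_real \<alpha>)) * cnj (of_real (norm w) * exp (\<i> * of_real \<theta>)))"
      unfolding \<alpha>_def \<theta>_def using arg_lo_polar(1)[OF u0] arg_lo_polar(1)[OF w] by (simp only: complex_cnj_minus mult_minus_right)
    also have "\<dots> = - (of_real (norm u * norm w) * exp (\<i> * of_real (\<alpha> - \<theta>)))"
      by (simp add: exp_cnj exp_diff right_diff_distrib exp_minus divide_inverse)
    also have "Im \<dots> = - (norm u * norm w * sin (\<alpha> - \<theta>))"
      by (simp add: exp_eq_polar)
    finally show ?thesis by simp
  qed
  have P_iff: "P \<longleftrightarrow> \<theta> < \<alpha> - pi"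
  proof (cases "upper w")
    case True
    then have "\<theta> \<ge> 0" using upper_iff_arg_lo[OF w] by (simp add: \<theta>_def)
    then show ?thesis using upper_not_minus[OF True] \<alpha> by (auto simp: P_def)
  next
    case False
    then have um: "upper (- w)" using upper_cases[OF w] by auto
    have "\<theta> < 0" using False upper_iff_arg_lo[OF w] by (simp add: \<theta>_def)
    have "P \<longleftrightarrow> norm u * norm w * - sin (\<alpha> - \<theta>) > 0"
      unfolding P_def Im using um by simp
    also have "\<dots> \<longleftrightarrow> sin (\<alpha> - \<theta>) < 0"
      using w u0 by (simp add: mult_less_0_iff)
    also have "\<dots> \<longleftrightarrow> \<alpha> - \<theta> > pi"
    proof (cases "\<alpha> - \<theta> > pi")
      case True
      have "sin (\<alpha> - \<theta>) < 0" using True \<alpha> \<theta> by (intro sin_lt_zero) auto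
      then show ?thesis using True by simp
    next
      case f: False
      have "sin (\<alpha> - \<theta>) \<ge> 0" using f \<alpha> \<open>\<theta> < 0\<close> by (intro sin_ge_zero) auto
      then show ?thesis using f by simp
    qed
    finally show ?thesis by auto
  qed
  have quot: "w / u = of_real (norm w / norm u) * exp (\<i> * of_real (\<theta> - \<alpha>))"
  proof -
    have "w / u = (of_real (norm w) * exp (\<i> * of_real \<theta>)) / (of_real (norm u) * exp (\<i> * of_real \<alpha>))"
      unfolding \<alpha>_def \<theta>_def using arg_lo_polar(1)[OF u0] arg_lo_polar(1)[OF w] by (simp only:)
    then show ?thesis by (simp add: exp_diff right_diff_distrib)
  qed
  have pos: "norm w / norm u > 0" using w u0 by simp
  have ln: "ln (norm (w / u)) = ln (norm w) - ln (norm u)"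
    using w u0 by (simp add: norm_divide ln_div)
  have "arg_lo (w / u) = (if P then \<theta> - \<alpha> + 2 * pi else \<theta> - \<alpha>)"
  proof (cases "P")
    case True
    have "exp (\<i> * of_real (\<theta> - \<alpha> + 2 * pi)) = exp (\<i> * of_real (\<theta> - \<alpha>))"
      by (simp add: exp_add distrib_left mult.left_commute[of \<i>] mult.commute[of \<i>])
    then have "arg_lo (w / u) = \<theta> - \<alpha> + 2 * pi"
      using True P_iff quot pos \<theta> \<alpha> by (intro arg_lo_unique[of _ "norm w / norm u"]) auto
    then show ?thesis using True by simp
  next
    case False
    have "arg_lo (w / u) = \<theta> - \<alpha>"
      using False P_iff quot pos \<theta> \<alpha> by (intro arg_lo_unique[of _ "norm w / norm u"]) auto
    then show ?thesis using False by simp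
  qed
  note arg = this
  have "cpow (w / u) (- s) * cpow u (- s) = cpow w (- s) * (if P then exp (- 2 * of_real pi * \<i> * s) else 1)"
  proof (cases P)
    case True
    then have a: "arg_lo (w / u) = \<theta> - \<alpha> + 2 * pi" using arg by simp
    show ?thesis
      unfolding cpow_def ln a \<theta>_def[symmetric] \<alpha>_def[symmetric] if_P[OF True] exp_add[symmetric]
      by (rule arg_cong[of _ _ exp]) (simp add: algebra_simps)
  next
    case False
    then have a: "arg_lo (w / u) = \<theta> - \<alpha>" using arg by simp
    show ?thesis
      unfolding cpow_def ln a \<theta>_def[symmetric] \<alpha>_def[symmetric] if_not_P[OF False] exp_add[symmetric] mult_1_right
      by (rule arg_cong[of _ _ exp]) (simp add: algebra_simps)
  qed
  then show ?thesis by (simp only: P_def)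
qed

section \<open>Uniqueness of meromorphic continuation\<close>

lemma nicely_meromorphic_remove_sings:
  assumes "f nicely_meromorphic_on UNIV"
  shows "remove_sings f = f"
proof
  fix z
  have "is_pole f z \<and> f z = 0 \<or> f \<midarrow>z\<rightarrow> f z"
    using assms by (auto simp: nicely_meromorphic_on_def)
  then show "remove_sings f z = f z"
    by (metis remove_sings_at_pole remove_sings_eqI)
qed

text \<open>The difference vanishes on a half-plane, hence identically once its singularities are
  removed. Since nicely meromorphic functions are determined at each point by their values nearby,
  with 0 at the poles, the two functions agree everywhere.\<close>

lemma nicely_meromorphic_unique:
  assumes F: "F nicely_meromorphic_on UNIV" and H: "H nicely_meromorphic_on UNIV"
    and eq: "\<And>s. Re s > \<sigma> \<Longrightarrow> F s = H s"
  shows "F = H"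
proof
  fix z
  define D where "D = (\<lambda>s. F s - H s)"
  have mero: "D meromorphic_on UNIV"
    unfolding D_def using F H by (intro meromorphic_intros) (auto simp: nicely_meromorphic_on_def)
  have D0: "remove_sings D s = 0" if "Re s > \<sigma>" for s
  proof (rule remove_sings_eqI)
    have "\<forall>\<^sub>F w in at s. w \<in> {w. Re w > \<sigma>}"
      using that by (intro eventually_at_in_open') (auto simp: open_halfspace_Re_gt)
    then have "\<forall>\<^sub>F w in at s. D w = 0" by eventually_elim (simp add: D_def eq)
    then show "D \<midarrow>s\<rightarrow> 0" by (rule tendsto_eventually)
  qed
  define s0 :: complex where "s0 = of_real (\<sigma> + 1)"
  have "\<forall>\<^sub>F w in at s0. w \<in> {w. Re w > \<sigma>}"
    by (intro eventually_at_in_open') (auto simp: open_halfspace_Re_gt s0_def)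
  then have "\<forall>\<^sub>F w in at s0. remove_sings D w = 0" by eventually_elim (simp add: D0)
  then have "\<exists>\<^sub>F w in at s0. remove_sings D w = 0" by (rule eventually_frequently[rotated]) simp
  then have z0: "remove_sings D w = 0" for w
    using frequently_eq_meromorphic_imp_constant[OF _ remove_sings_nicely_meromorphic[OF mero], of 0 s0 w] by (simp add: connected_UNIV)
  have "isolated_singularity_at D z" using mero by (auto intro: meromorphic_on_isolated_singularity meromorphic_on_subset)
  then have "\<forall>\<^sub>F w in at z. remove_sings D w = D w" by (rule eventually_remove_sings_eq_at)
  then have "\<forall>\<^sub>F w in at z. F w = H w" by eventually_elim (use z0 in \<open>simp add: D_def\<close>)
  then have "remove_sings F z = remove_sings H z" by (rule remove_sings_cong) simp
  then show "F z = H z" by (simp add: nicely_meromorphic_remove_sings F H)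
qed

text \<open>Existence and uniqueness together resolve the definite description in
  \<open>mero_cont\<close>: off the possible pole at 1 the continuation is an explicit
  quotient.\<close>

lemma mero_cont_simple_pole:
  assumes K: "K holomorphic_on UNIV" and \<sigma>: "\<sigma> \<ge> 1"
    and F: "\<And>s. Re s > \<sigma> \<Longrightarrow> (s - 1) * F s = K s"
  shows "mero_cont \<sigma> F meromorphic_on UNIV" and "s \<noteq> 1 \<Longrightarrow> mero_cont \<sigma> F s = K s / (s - 1)"
proof -
  define Q where "Q = remove_sings (\<lambda>s. K s / (s - 1))"
  have "K analytic_on UNIV" using K by (simp add: analytic_on_open)
  then have "(\<lambda>s. K s / (s - 1)) meromorphic_on UNIV"
    by (intro meromorphic_intros) (auto intro: analytic_on_imp_meromorphic_on)
  then have Q: "Q nicely_meromorphic_on UNIV" unfolding Q_def by (rule remove_sings_nicely_meromorphic)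
  have Qs: "Q s = K s / (s - 1)" if "s \<noteq> 1" for s
    unfolding Q_def using that \<open>K analytic_on UNIV\<close>
    by (intro remove_sings_at_analytic analytic_intros) (auto intro: analytic_on_subset)
  have QF: "Q s = F s" if "Re s > \<sigma>" for s
  proof -
    have "s \<noteq> 1" using that \<sigma> by auto
    then show ?thesis using Qs[of s] F[OF that, symmetric] by simp
  qed
  have "mero_cont \<sigma> F = Q"
    unfolding mero_cont_def
  proof (rule the_equality)
    fix H assume "H nicely_meromorphic_on UNIV \<and> (\<forall>s. \<sigma> < Re s \<longrightarrow> H s = F s)"
    then show "H = Q" using Q QF by (intro nicely_meromorphic_unique[of H Q \<sigma>]) auto
  qed (use Q QF in auto)
  then show "mero_cont \<sigma> F meromorphic_on UNIV" "s \<noteq> 1 \<Longrightarrow> mero_cont \<sigma> F s = K s / (s - 1)"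
    using Q Qs by (auto simp: nicely_meromorphic_on_def)
qed

section \<open>Lattice sums\<close>

lemma periodic_seq_add_mult:
  assumes "periodic_seq k g"
  shows "g (n + k * m) = g n"
proof -
  have step: "g (n + k) = g n" for n using assms by (simp add: periodic_seq_def)
  show ?thesis
  proof (induction m rule: int_induct[where k = 0])
    case base show ?case by simp
  next
    case (step1 i)
    have "g (n + k * (i + 1)) = g ((n + k * i) + k)" by (simp add: algebra_simps)
    then show ?case using step1 step by simp
  next
    case (step2 i)
    have "g (n + k * (i - 1)) = g ((n + k * (i - 1)) + k)" using step by simp
    also have "(n + k * (i - 1)) + k = n + k * i" by (simp add: algebra_simps)
    finally show ?case using step2 by simp
  qed
qed

lemma periodic_seq_cong:
  assumes "periodic_seq k g" "[a = b] (mod k)"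
  shows "g a = g b"
proof -
  obtain m where "b = a + k * m" using assms(2) by (metis cong_iff_lin mult.commute)
  then show ?thesis using periodic_seq_add_mult[OF assms(1)] by simp
qed

text \<open>Makes the value at s = 2 independent of the point where a quadrant starts.\<close>

lemma periodic_window_sum:
  assumes k: "k > 0" and g: "periodic_seq k g"
  shows "(\<Sum>\<mu>\<in>{0..<k}. g (m0 + \<mu>)) = (\<Sum>\<mu>\<in>{0..<k}. g \<mu>)"
proof -
  have "bij_betw (\<lambda>\<mu>. (m0 + \<mu>) mod k) {0..<k} {0..<k}"
  proof (rule bij_betw_byWitness[where f' = "\<lambda>\<mu>. (\<mu> - m0) mod k"])
    show "\<forall>a\<in>{0..<k}. ((m0 + a) mod k - m0) mod k = a" by (auto simp: mod_diff_left_eq)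
    show "\<forall>a\<in>{0..<k}. (m0 + (a - m0) mod k) mod k = a" by (auto simp: mod_add_right_eq)
  qed (use k in auto)
  from sum.reindex_bij_betw[OF this, of g]
  have "(\<Sum>\<mu>\<in>{0..<k}. g ((m0 + \<mu>) mod k)) = (\<Sum>\<mu>\<in>{0..<k}. g \<mu>)" .
  moreover have "g ((m0 + \<mu>) mod k) = g (m0 + \<mu>)" for \<mu>
    by (rule periodic_seq_cong[OF g]) (simp add: cong_def)
  ultimately show ?thesis by simp
qed

lemma periodic_reflect: "periodic_seq k g \<Longrightarrow> periodic_seq k (\<lambda>n. g (- n))"
  unfolding periodic_seq_def using periodic_seq_add_mult[of k g _ "-1"] by (auto simp: periodic_seq_def)

lemma periodic_reflect_sum:
  assumes k: "k > 0" and g: "periodic_seq k g"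
  shows "(\<Sum>\<mu>\<in>{0..<k}. g (- \<mu>)) = (\<Sum>\<mu>\<in>{0..<k}. g \<mu>)"
proof -
  \<comment> \<open>\<mu> -> k - 1 - \<mu> turns the reflected sum into a window that starts at 1 -
    k.\<close>
  have "(\<Sum>\<mu>\<in>{0..<k}. g (- \<mu>)) = (\<Sum>\<mu>\<in>{0..<k}. g ((1 - k) + \<mu>))"
    by (rule sum.reindex_bij_witness[where i = "\<lambda>\<mu>. k - 1 - \<mu>" and j = "\<lambda>\<mu>. k - 1 - \<mu>"]) auto
  then show ?thesis using periodic_window_sum[OF k g] by simp
qed

lemma residue_tiling:
  fixes k r t :: int
  assumes k: "k > 0"
  defines "B \<equiv> \<lambda>(\<mu>, \<nu>). range (\<lambda>(l, l'). (r + \<mu> + k * int l, t + \<nu> + k * int l'))"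
  shows "(\<Union>p\<in>{0..<k} \<times> {0..<k}. B p) = {r..} \<times> {t..}"
    and "p \<in> {0..<k} \<times> {0..<k} \<Longrightarrow> p' \<in> {0..<k} \<times> {0..<k} \<Longrightarrow> p \<noteq> p' \<Longrightarrow> B p \<inter> B p' = {}"
proof -
  have mem: "(m, n) \<in> B ((m - r) mod k, (n - t) mod k)" if "m \<ge> r" "n \<ge> t" for m n
  proof -
    have "int (nat ((i::int) div k)) = i div k" if "i \<ge> 0" for i
      using that k by (simp add: pos_imp_zdiv_nonneg_iff)
    then have "(m, n) = (r + (m - r) mod k + k * int (nat ((m - r) div k)), t + (n - t) mod k + k * int (nat ((n - t) div k)))"
      using that by (simp add: add.assoc)
    then show ?thesis unfolding B_def by (auto intro!: image_eqI[of _ _ "(nat ((m - r) div k), nat ((n - t) div k))"])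
  qed
  show "(\<Union>p\<in>{0..<k} \<times> {0..<k}. B p) = {r..} \<times> {t..}"
  proof
    show "(\<Union>p\<in>{0..<k} \<times> {0..<k}. B p) \<subseteq> {r..} \<times> {t..}"
      using k by (auto simp: B_def)
    show "{r..} \<times> {t..} \<subseteq> (\<Union>p\<in>{0..<k} \<times> {0..<k}. B p)"
    proof
      fix q assume "q \<in> {r..} \<times> {t..}"
      then obtain m n where q: "q = (m, n)" "m \<ge> r" "n \<ge> t" by auto
      show "q \<in> (\<Union>p\<in>{0..<k} \<times> {0..<k}. B p)"
        unfolding q(1) using mem[OF q(2,3)] k by (intro UN_I[of "((m - r) mod k, (n - t) mod k)"]) auto
    qed
  qed
  have "p = ((fst q - r) mod k, (snd q - t) mod k)" if "p \<in> {0..<k} \<times> {0..<k}" "q \<in> B p" for p q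
    using that by (auto simp: B_def mod_mult_self2 add.assoc)
  then show "p \<in> {0..<k} \<times> {0..<k} \<Longrightarrow> p' \<in> {0..<k} \<times> {0..<k} \<Longrightarrow> p \<noteq> p' \<Longrightarrow> B p \<inter> B p' = {}"
    by blast
qed

text \<open>Splitting both indices by residues modulo k freezes the coefficients and leaves k^2
  cones with generators k \<omega>1 and k \<omega>2. The rotation by -\<phi> puts these into the
  right half-plane, where the results on cones apply. The value at 2 depends on the coefficients
  only through their sums over a period.\<close>

lemma quadrant_sum:
  fixes \<omega>1 \<omega>2 :: complex and t1 t2 \<phi> :: real and m0 n0 k :: int
  assumes k: "k > 0" and g: "periodic_seq k g" and h: "periodic_seq k h"
    and pos: "of_int m0 + t1 \<ge> 0" "of_int n0 + t2 \<ge> 0" "(of_int m0 + t1) + (of_int n0 + t2) > 0"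
    and \<phi>: "0 < \<phi>" "\<phi> < pi"
    and re: "Re (exp (- \<i> * of_real \<phi>) * \<omega>1) > 0" "Re (exp (- \<i> * of_real \<phi>) * \<omega>2) > 0"
    and up: "\<And>m n. m \<ge> m0 \<Longrightarrow> n \<ge> n0 \<Longrightarrow> upper ((of_int m + of_real t1) * \<omega>1 + (of_int n + of_real t2) * \<omega>2)"
  shows "\<exists>H. H holomorphic_on UNIV \<and>
     H 2 = (\<Sum>\<mu>\<in>{0..<k}. g \<mu>) * (\<Sum>\<nu>\<in>{0..<k}. h \<nu>) / (of_int k ^ 2 * \<omega>1 * \<omega>2) \<and>
     (\<forall>s. Re s > 2 \<longrightarrow>
       (\<lambda>(m, n). norm (g m * h n * cpow ((of_int m + of_real t1) * \<omega>1 + (of_int n + of_real t2) * \<omega>2) (- s))) summable_on {m0..} \<times> {n0..} \<and>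
       (s - 1) * (s - 2) * (\<Sum>\<^sub>\<infinity>(m, n)\<in>{m0..} \<times> {n0..}. g m * h n * cpow ((of_int m + of_real t1) * \<omega>1 + (of_int n + of_real t2) * \<omega>2) (- s)) = H s)"
proof -
  define E where "E = exp (- \<i> * of_real \<phi>)"
  define \<Omega>1 \<Omega>2 where "\<Omega>1 = of_int k * (E * \<omega>1)" and "\<Omega>2 = of_int k * (E * \<omega>2)"
  \<comment> \<open>Coordinates of the apex in units of the period, since the generators absorb the
    factor k.\<close>
  define x where "x \<mu> = (of_int m0 + of_int \<mu> + t1) / of_int k" for \<mu> :: int
  define y where "y \<nu> = (of_int n0 + of_int \<nu> + t2) / of_int k" for \<nu> :: int
  define P where "P = {0..<k} \<times> {0..<k}"
  define idx where "idx = (\<lambda>(\<mu>, \<nu>) (l, l'). (m0 + \<mu> + k * int l, n0 + \<nu> + k * int l'))"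
  define c where "c = (\<lambda>(\<mu>, \<nu>). g (m0 + \<mu>) * h (n0 + \<nu>))"
  define M where "M = (\<lambda>(\<mu>, \<nu>). mellin (\<lambda>u. geom_ker (x \<mu>) \<Omega>1 (of_real u) * geom_ker (y \<nu>) \<Omega>2 (of_real u)))"
  define W where "W = (\<lambda>(m::int, n::int). (of_int m + of_real t1) * \<omega>1 + (of_int n + of_real t2) * \<omega>2)"
  define T where "T s = (\<lambda>q. g (fst q) * h (snd q) * cpow (W q) (- s))" for s
  have kr: "real_of_int k > 0" "complex_of_int k \<noteq> 0" using k by auto
  have reO: "Re \<Omega>1 > 0" "Re \<Omega>2 > 0"
  proof -
    have "Re (of_int k * v) = of_int k * Re v" for v by simp
    then show "Re \<Omega>1 > 0" "Re \<Omega>2 > 0" using re kr by (simp_all add: \<Omega>1_def \<Omega>2_def E_def)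
  qed
  have xy: "x \<mu> \<ge> 0" "y \<nu> \<ge> 0" "x \<mu> + y \<nu> > 0" if "\<mu> \<ge> 0" "\<nu> \<ge> 0" for \<mu> \<nu>
  proof -
    have "of_int m0 + of_int \<mu> + t1 \<ge> 0" "of_int n0 + of_int \<nu> + t2 \<ge> 0"
      "(of_int m0 + of_int \<mu> + t1) + (of_int n0 + of_int \<nu> + t2) > 0"
      using pos that by linarith+
    then show "x \<mu> \<ge> 0" "y \<nu> \<ge> 0" "x \<mu> + y \<nu> > 0"
      using kr by (auto simp: x_def y_def simp flip: add_divide_distrib)
  qed
  have "\<forall>p\<in>P. \<exists>H. H holomorphic_on UNIV \<and> H 2 = 1 / (\<Omega>1 * \<Omega>2) \<and> (\<forall>s. Re s > 2 \<longrightarrow> (s - 1) * (s - 2) * (M p s / Gamma s) = H s)"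
    using cone_entire_2[OF reO] xy by (auto simp: P_def M_def)
  then obtain Hf where Hf: "\<And>p. p \<in> P \<Longrightarrow> Hf p holomorphic_on UNIV" "\<And>p. p \<in> P \<Longrightarrow> Hf p 2 = 1 / (\<Omega>1 * \<Omega>2)"
    "\<And>p s. p \<in> P \<Longrightarrow> Re s > 2 \<Longrightarrow> (s - 1) * (s - 2) * (M p s / Gamma s) = Hf p s"
    by (metis bchoice)
  define H where "H s = exp (- \<i> * of_real \<phi> * s) * (\<Sum>p\<in>P. c p * Hf p s)" for s
  have holH: "H holomorphic_on UNIV"
    unfolding H_def by (intro holomorphic_intros Hf)
  have "(\<Sum>p\<in>P. c p) = (\<Sum>\<mu>\<in>{0..<k}. g (m0 + \<mu>)) * (\<Sum>\<nu>\<in>{0..<k}. h (n0 + \<nu>))"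
    by (simp only: P_def c_def sum_product sum.cartesian_product)
  also have "\<dots> = (\<Sum>\<mu>\<in>{0..<k}. g \<mu>) * (\<Sum>\<nu>\<in>{0..<k}. h \<nu>)"
    by (simp only: periodic_window_sum[OF k g] periodic_window_sum[OF k h])
  finally have csum: "(\<Sum>p\<in>P. c p) = (\<Sum>\<mu>\<in>{0..<k}. g \<mu>) * (\<Sum>\<nu>\<in>{0..<k}. h \<nu>)" .
  have H2: "H 2 = (\<Sum>\<mu>\<in>{0..<k}. g \<mu>) * (\<Sum>\<nu>\<in>{0..<k}. h \<nu>) / (of_int k ^ 2 * \<omega>1 * \<omega>2)"
  proof -
    have "(\<Sum>p\<in>P. c p * Hf p 2) = (\<Sum>p\<in>P. c p) * (1 / (\<Omega>1 * \<Omega>2))"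
      unfolding sum_distrib_right by (intro sum.cong refl) (simp add: Hf)
    \<comment> \<open>At s = 2 the rotation factor cancels against the one contained in the product
      of the generators.\<close>
    moreover have "exp (- \<i> * of_real \<phi> * 2) = E * E" by (simp add: E_def exp_add[symmetric] algebra_simps)
    moreover have "E \<noteq> 0" by (simp add: E_def)
    ultimately show ?thesis
      unfolding H_def csum by (simp add: \<Omega>1_def \<Omega>2_def power2_eq_square)
  qed
  have inj: "inj (idx p)" for p
    using k by (auto simp: inj_on_def idx_def split: prod.splits)
  have tile: "(\<Union>p\<in>P. range (idx p)) = {m0..} \<times> {n0..}"
    and disj: "\<And>p p'. p \<in> P \<Longrightarrow> p' \<in> P \<Longrightarrow> p \<noteq> p' \<Longrightarrow> range (idx p) \<inter> range (idx p') = {}"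
    using residue_tiling[OF k, where r = m0 and t = n0] by (simp_all add: P_def idx_def case_prod_unfold)
  have main: "(\<lambda>q. norm (T s q)) summable_on {m0..} \<times> {n0..} \<and> (s - 1) * (s - 2) * infsum (T s) ({m0..} \<times> {n0..}) = H s"
    if s: "Re s > 2" for s
  proof -
    define A where "A = (\<lambda>(\<mu>, \<nu>) (l::nat, l'::nat). ((of_nat l + of_real (x \<mu>)) * \<Omega>1 + (of_nat l' + of_real (y \<nu>)) * \<Omega>2) powr (- s))"
    define e where "e = exp (- \<i> * of_real \<phi> * s)"
    have T_idx: "T s (idx p i) = c p * e * A p i" if p: "p \<in> P" for p i
    proof -
      obtain \<mu> \<nu> where p_eq: "p = (\<mu>, \<nu>)" by (cases p)
      obtain l l' where i_eq: "i = (l, l')" by (cases i)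
      have nn: "\<mu> \<ge> 0" "\<nu> \<ge> 0" using p by (auto simp: P_def p_eq)
      have W: "E * W (idx p i) = (of_nat l + of_real (x \<mu>)) * \<Omega>1 + (of_nat l' + of_real (y \<nu>)) * \<Omega>2"
      proof -
        have "of_int k * complex_of_real (x \<mu>) = of_int m0 + of_int \<mu> + of_real t1"
          "of_int k * complex_of_real (y \<nu>) = of_int n0 + of_int \<nu> + of_real t2"
          using kr by (simp_all add: x_def y_def)
        then have "of_int (m0 + \<mu> + k * int l) + complex_of_real t1 = of_int k * (of_nat l + of_real (x \<mu>))"
          "of_int (n0 + \<nu> + k * int l') + complex_of_real t2 = of_int k * (of_nat l' + of_real (y \<nu>))"
          by (simp_all add: algebra_simps)
        then show ?thesis
          by (simp add: W_def idx_def p_eq i_eq \<Omega>1_def \<Omega>2_def) (simp add: algebra_simps)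
      qed
      have "upper (W (idx p i))"
        using nn k up[of "m0 + \<mu> + k * int l" "n0 + \<nu> + k * int l'"] by (simp add: W_def idx_def p_eq i_eq)
      then have "cpow (W (idx p i)) (- s) = e * A p i"
        using cpow_rotate[OF _ \<phi>, of "W (idx p i)" s] W by (simp add: e_def E_def A_def p_eq i_eq)
      moreover have "g (fst (idx p i)) * h (snd (idx p i)) = c p"
        using periodic_seq_add_mult[OF g] periodic_seq_add_mult[OF h] by (simp add: idx_def p_eq i_eq c_def)
      ultimately show ?thesis by (simp add: T_def)
    qed
    have cone: "(\<lambda>i. norm (A p i)) summable_on UNIV" "(A p has_sum (M p s / Gamma s)) UNIV" if p: "p \<in> P" for p
    proof -
      obtain \<mu> \<nu> where p_eq: "p = (\<mu>, \<nu>)" by (cases p)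
      have nn: "\<mu> \<ge> 0" "\<nu> \<ge> 0" using p by (auto simp: P_def p_eq)
      show "(\<lambda>i. norm (A p i)) summable_on UNIV" "(A p has_sum (M p s / Gamma s)) UNIV"
        using cone_sum_2[OF reO xy[OF nn] s] by (simp_all add: A_def M_def p_eq case_prod_unfold)
    qed
    have abs: "(\<lambda>q. norm (T s q)) summable_on (\<Union>p\<in>P. range (idx p))"
    proof (rule summable_on_finite_union_disjoint)
      fix p assume p: "p \<in> P"
      have "(\<lambda>i. norm (c p * e) * norm (A p i)) summable_on UNIV"
        by (intro summable_on_cmult_right cone p)
      then show "(\<lambda>q. norm (T s q)) summable_on range (idx p)"
        by (subst summable_on_reindex[OF inj]) (simp add: o_def T_idx[OF p] norm_mult)
    qed (use disj in \<open>auto simp: P_def\<close>)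
    have "(T s has_sum (\<Sum>p\<in>P. c p * e * (M p s / Gamma s))) (\<Union>p\<in>P. range (idx p))"
    proof (rule sum_has_sum)
      fix p assume p: "p \<in> P"
      have "((\<lambda>i. c p * e * A p i) has_sum (c p * e * (M p s / Gamma s))) UNIV"
        by (intro has_sum_cmult_right cone p)
      then show "(T s has_sum (c p * e * (M p s / Gamma s))) (range (idx p))"
        by (subst has_sum_reindex[OF inj]) (simp add: o_def T_idx[OF p])
    qed (use disj in \<open>auto simp: P_def\<close>)
    then have "infsum (T s) ({m0..} \<times> {n0..}) = (\<Sum>p\<in>P. c p * e * (M p s / Gamma s))"
      unfolding tile by (rule infsumI)
    then have "(s - 1) * (s - 2) * infsum (T s) ({m0..} \<times> {n0..}) = (\<Sum>p\<in>P. e * (c p * ((s - 1) * (s - 2) * (M p s / Gamma s))))"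
      by (simp add: sum_distrib_left mult_ac)
    also have "\<dots> = (\<Sum>p\<in>P. e * (c p * Hf p s))"
      by (intro sum.cong refl) (simp only: Hf(3)[OF _ s])
    also have "\<dots> = H s" by (simp add: H_def e_def sum_distrib_left)
    finally show ?thesis using abs unfolding tile by blast
  qed
  show ?thesis
    using holH H2 main by (intro exI[of _ H]) (simp add: T_def W_def case_prod_unfold)
qed

definition lattice_term :: "complex \<Rightarrow> (int \<Rightarrow> complex) \<Rightarrow> (int \<Rightarrow> complex) \<Rightarrow> real \<Rightarrow> real \<Rightarrow> complex \<Rightarrow> int \<times> int \<Rightarrow> complex" where
  "lattice_term z g h r1 r2 s =
     (\<lambda>(m, n). g m * h n * cpow ((of_int m + of_real r1) * z + of_int n + of_real r2) (- s))"

definition lattice_point :: "complex \<Rightarrow> real \<Rightarrow> real \<Rightarrow> int \<times> int \<Rightarrow> complex" where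
  "lattice_point z r1 r2 = (\<lambda>(m, n). (of_int m + of_real r1) * z + of_int n + of_real r2)"

lemma lattice_point_eq_0_iff:
  assumes "Im z > 0"
  shows "lattice_point z r1 r2 (m, n) = 0 \<longleftrightarrow> of_int m + r1 = 0 \<and> of_int n + r2 = 0"
  using assms by (auto simp: lattice_point_def complex_eq_iff)

lemma upper_lattice_point:
  assumes "Im z > 0"
  shows "upper (lattice_point z r1 r2 (m, n)) \<longleftrightarrow> of_int m + r1 > 0 \<or> (of_int m + r1 = 0 \<and> of_int n + r2 > 0)"
  using assms by (auto simp: lattice_point_def upper_def zero_less_mult_iff)

text \<open>The angle is that of z + |z| \<omega>, which bisects the angle between z and \<omega>.
  As z is not real, both lie less than pi/2 away from the bisector.\<close>

lemma rotation_exists: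
  assumes z: "Im z > 0" and \<omega>: "\<omega> = 1 \<or> \<omega> = - 1"
  shows "\<exists>\<phi>>0. \<phi> < pi \<and> Re (exp (- \<i> * of_real \<phi>) * z) > 0 \<and> Re (exp (- \<i> * of_real \<phi>) * \<omega>) > 0"
proof -
  define e where "e = z + of_real (norm z) * \<omega>"
  have Im: "Im e > 0" using z \<omega> by (auto simp: e_def)
  then have e0: "e \<noteq> 0" by auto
  have A: "0 < Arg e" "Arg e < pi" using Arg_lt_pi[of e] Im by auto
  have "cnj e = of_real (norm e) * exp (- \<i> * of_real (Arg e))"
  proof -
    have "cnj e = cnj (of_real (norm e) * exp (\<i> * of_real (Arg e)))" using Arg_eq[OF e0] by simp
    then show ?thesis by (simp add: exp_cnj)
  qed
  note cnj_e = this
  have rot: "Re (exp (- \<i> * of_real (Arg e)) * v) > 0" if "Re (cnj e * v) > 0" for v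
  proof -
    have "Re (of_real r * w) = r * Re w" for r w by simp
    then have "Re (cnj e * v) = norm e * Re (exp (- \<i> * of_real (Arg e)) * v)"
      unfolding cnj_e mult.assoc by blast
    then show ?thesis using that by (simp only: zero_less_mult_iff) auto
  qed
  have nz: "\<bar>Re z\<bar> < norm z"
  proof -
    have "(Re z)\<^sup>2 < (norm z)\<^sup>2" using z by (simp add: cmod_power2)
    then show ?thesis using power2_less_imp_less[of "\<bar>Re z\<bar>" "norm z"] by simp
  qed
  have "Re (cnj e * z) = norm z * (norm z + Re z * Re \<omega>)"
  proof -
    have "Re (cnj e * z) = (Re z)\<^sup>2 + (Im z)\<^sup>2 + norm z * (Re z * Re \<omega>)"
      using \<omega> by (auto simp: e_def power2_eq_square algebra_simps)
    also have "(Re z)\<^sup>2 + (Im z)\<^sup>2 = norm z * norm z"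
      by (simp only: cmod_power2[symmetric]) (simp only: power2_eq_square)
    finally show ?thesis by (simp add: algebra_simps)
  qed
  also have "\<dots> > 0" using nz \<omega> z by (intro mult_pos_pos) (auto simp: abs_less_iff)
  finally have 1: "Re (cnj e * z) > 0" .
  have "Re (cnj e * \<omega>) > 0" using nz \<omega> by (auto simp: e_def abs_less_iff)
  with 1 A rot show ?thesis by blast
qed

text \<open>The quadrants are spanned by z, 1 and by z, -1. The sign of the second generator
  reverses the value at s = 2, while reflecting the coefficients does not change their sum over a
  period.\<close>

lemma upper_lattice_sum:
  fixes r1 r2 :: real
  assumes k: "k > 0" and g: "periodic_seq k g" and h: "periodic_seq k h" and z: "Im z > 0"
  defines "U \<equiv> {q. upper (lattice_point z r1 r2 q)}"
  shows "\<exists>H. H holomorphic_on UNIV \<and> H 2 = 0 \<and> (\<forall>s. Re s > 2 \<longrightarrow>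
       (\<lambda>q. norm (lattice_term z g h r1 r2 s q)) summable_on U \<and>
       (s - 1) * (s - 2) * infsum (lattice_term z g h r1 r2 s) U = H s)"
proof -
  define h' where "h' n = h (- n)" for n
  have h': "periodic_seq k h'" unfolding h'_def[abs_def] by (rule periodic_reflect[OF h])
  \<comment> \<open>Ceiling, or floor plus one, decides whether an edge is included. The edge m + r1
    = 0 counts for n + r2 > 0 only, the edge n + r2 = 0 goes to the second quadrant, and the point 0
    belongs to neither.\<close>
  define m0 where "m0 = \<lceil>- r1\<rceil>" define n0 where "n0 = \<lfloor>- r2\<rfloor> + 1"
  define m1 where "m1 = \<lfloor>- r1\<rfloor> + 1" define n1 where "n1 = \<lceil>r2\<rceil>"
  define Q1 where "Q1 = {m0..} \<times> {n0..}"
  define Q2 where "Q2 = {m1..} \<times> {..- n1}"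
  have c1: "m \<ge> m0 \<longleftrightarrow> of_int m + r1 \<ge> 0" for m by (auto simp: m0_def ceiling_le_iff)
  have c2: "n \<ge> n0 \<longleftrightarrow> of_int n + r2 > 0" for n unfolding n0_def by linarith
  have c3: "m \<ge> m1 \<longleftrightarrow> of_int m + r1 > 0" for m unfolding m1_def by linarith
  have c4: "n \<ge> n1 \<longleftrightarrow> of_int n - r2 \<ge> 0" for n by (auto simp: n1_def ceiling_le_iff)
  have U: "U = Q1 \<union> Q2"
  proof (intro set_eqI, clarify)
    fix m n
    show "(m, n) \<in> U \<longleftrightarrow> (m, n) \<in> Q1 \<union> Q2"
      using c4[of "- n"] unfolding U_def Q1_def Q2_def mem_Collect_eq upper_lattice_point[OF z]
      by (auto simp: c1 c2 c3)
  qed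
  have disj: "Q1 \<inter> Q2 = {}" using c4 by (force simp: Q1_def Q2_def c1 c2 c3)
  define S where "S = (\<Sum>\<mu>\<in>{0..<k}. g \<mu>) * (\<Sum>\<nu>\<in>{0..<k}. h \<nu>)"
  have S': "(\<Sum>\<mu>\<in>{0..<k}. g \<mu>) * (\<Sum>\<nu>\<in>{0..<k}. h' \<nu>) = S"
    unfolding S_def h'_def periodic_reflect_sum[OF k h] ..
  obtain \<phi>1 where \<phi>1: "0 < \<phi>1" "\<phi>1 < pi" "Re (exp (- \<i> * of_real \<phi>1) * z) > 0" "Re (exp (- \<i> * of_real \<phi>1) * 1) > 0"
    using rotation_exists[OF z, of 1] by auto
  obtain \<phi>2 where \<phi>2: "0 < \<phi>2" "\<phi>2 < pi" "Re (exp (- \<i> * of_real \<phi>2) * z) > 0" "Re (exp (- \<i> * of_real \<phi>2) * (- 1)) > 0"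
    using rotation_exists[OF z, of "- 1"] by auto
  have up1: "upper ((of_int m + of_real r1) * z + (of_int n + of_real r2) * 1)" if "m \<ge> m0" "n \<ge> n0" for m n
    using upper_lattice_point[OF z, of r1 r2 m n] that by (auto simp: lattice_point_def c1 c2 algebra_simps)
  have up2: "upper ((of_int m + of_real r1) * z + (of_int n + of_real (- r2)) * (- 1))" if "m \<ge> m1" "n \<ge> n1" for m n
    using upper_lattice_point[OF z, of r1 r2 m "- n"] that by (auto simp: lattice_point_def c3 algebra_simps)
  obtain H1 where H1: "H1 holomorphic_on UNIV" "H1 2 = S / (of_int k ^ 2 * z * 1)"
    "\<And>s. Re s > 2 \<Longrightarrow> (\<lambda>(m, n). norm (g m * h n * cpow ((of_int m + of_real r1) * z + (of_int n + of_real r2) * 1) (- s))) summable_on {m0..} \<times> {n0..}"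
    "\<And>s. Re s > 2 \<Longrightarrow> (s - 1) * (s - 2) * (\<Sum>\<^sub>\<infinity>(m, n)\<in>{m0..} \<times> {n0..}. g m * h n * cpow ((of_int m + of_real r1) * z + (of_int n + of_real r2) * 1) (- s)) = H1 s"
    using quadrant_sum[OF k g h, of m0 r1 n0 r2 \<phi>1 z 1] \<phi>1 up1 c1[of m0] c2[of n0] unfolding S_def by force
  obtain H2 where H2: "H2 holomorphic_on UNIV" "H2 2 = S / (of_int k ^ 2 * z * (- 1))"
    "\<And>s. Re s > 2 \<Longrightarrow> (\<lambda>(m, n). norm (g m * h' n * cpow ((of_int m + of_real r1) * z + (of_int n + of_real (- r2)) * (- 1)) (- s))) summable_on {m1..} \<times> {n1..}"
    "\<And>s. Re s > 2 \<Longrightarrow> (s - 1) * (s - 2) * (\<Sum>\<^sub>\<infinity>(m, n)\<in>{m1..} \<times> {n1..}. g m * h' n * cpow ((of_int m + of_real r1) * z + (of_int n + of_real (- r2)) * (- 1)) (- s)) = H2 s"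
    using quadrant_sum[OF k g h', of m1 r1 n1 "- r2" \<phi>2 z "- 1"] \<phi>2 up2 c3[of m1] c4[of n1] unfolding S' by force
  define T where "T s = lattice_term z g h r1 r2 s" for s
  define H where "H s = H1 s + H2 s" for s
  have main: "(\<lambda>q. norm (T s q)) summable_on U \<and> (s - 1) * (s - 2) * infsum (T s) U = H s" if s: "Re s > 2" for s
  proof -
    have T1: "T s = (\<lambda>(m, n). g m * h n * cpow ((of_int m + of_real r1) * z + (of_int n + of_real r2) * 1) (- s))"
      by (simp add: T_def lattice_term_def add.assoc)
    have s1: "(\<lambda>q. norm (T s q)) summable_on Q1"
      using H1(3)[OF s] by (simp add: T1 Q1_def case_prod_unfold)
    have i1: "(s - 1) * (s - 2) * infsum (T s) Q1 = H1 s"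
      using H1(4)[OF s] by (simp only: T1 Q1_def)
    define f where "f = (\<lambda>(m::int, n::int). (m, - n))"
    have bij: "bij_betw f ({m1..} \<times> {n1..}) Q2"
      by (rule bij_betw_byWitness[where f' = f]) (auto simp: f_def Q2_def)
    have Tf: "T s (f q) = (case q of (m, n) \<Rightarrow> g m * h' n * cpow ((of_int m + of_real r1) * z + (of_int n + of_real (- r2)) * (- 1)) (- s))" for q
      by (cases q) (simp add: T_def lattice_term_def f_def h'_def algebra_simps)
    have s2: "(\<lambda>q. norm (T s q)) summable_on Q2"
      using H2(3)[OF s] by (subst summable_on_reindex_bij_betw[OF bij, symmetric]) (simp add: Tf case_prod_unfold)
    have i2: "(s - 1) * (s - 2) * infsum (T s) Q2 = H2 s"
      using H2(4)[OF s] by (subst infsum_reindex_bij_betw[OF bij, symmetric]) (simp only: Tf)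
    have "infsum (T s) U = infsum (T s) Q1 + infsum (T s) Q2"
      unfolding U by (rule infsum_Un_disjoint[OF abs_summable_summable[OF s1] abs_summable_summable[OF s2] disj])
    then have "(s - 1) * (s - 2) * infsum (T s) U = H s"
      using i1 i2 by (simp add: H_def distrib_left)
    moreover have "(\<lambda>q. norm (T s q)) summable_on U"
      unfolding U by (rule summable_on_Un_disjoint[OF s1 s2 disj])
    ultimately show ?thesis by blast
  qed
  have "H 2 = 0" by (simp add: H_def H1 H2)
  moreover have "H holomorphic_on UNIV" unfolding H_def by (intro holomorphic_intros H1 H2)
  ultimately show ?thesis using main by (intro exI[of _ H]) (simp add: T_def)
qed

text \<open>The lower half-plane is reached by negation: the reflected coefficients are again
  periodic, and every term acquires the same factor exp(i pi s). Both halves vanish at s = 2, so the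
  factor s - 2 can be divided out and only s - 1 remains.\<close>

lemma lattice_sum:
  fixes r1 r2 :: real
  assumes k: "k > 0" and g: "periodic_seq k g" and h: "periodic_seq k h" and z: "Im z > 0"
  defines "S \<equiv> {q. lattice_point z r1 r2 q \<noteq> 0}"
  shows "\<exists>K. K holomorphic_on UNIV \<and> (\<forall>s. Re s > 2 \<longrightarrow>
       (\<lambda>q. norm (lattice_term z g h r1 r2 s q)) summable_on S \<and>
       (s - 1) * infsum (lattice_term z g h r1 r2 s) S = K s)"
proof -
  define U where "U r1 r2 = {q. upper (lattice_point z r1 r2 q)}" for r1 r2
  define L where "L = {q. upper (- lattice_point z r1 r2 q)}"
  define g' where "g' n = g (- n)" for n define h' where "h' n = h (- n)" for n
  have p': "periodic_seq k g'" "periodic_seq k h'"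
    unfolding g'_def[abs_def] h'_def[abs_def] by (intro periodic_reflect g h)+
  obtain H1 where H1: "H1 holomorphic_on UNIV" "H1 2 = 0"
    "\<And>s. Re s > 2 \<Longrightarrow> (\<lambda>q. norm (lattice_term z g h r1 r2 s q)) summable_on U r1 r2"
    "\<And>s. Re s > 2 \<Longrightarrow> (s - 1) * (s - 2) * infsum (lattice_term z g h r1 r2 s) (U r1 r2) = H1 s"
    using upper_lattice_sum[OF k g h z, of r1 r2] unfolding U_def by blast
  obtain H2 where H2: "H2 holomorphic_on UNIV" "H2 2 = 0"
    "\<And>s. Re s > 2 \<Longrightarrow> (\<lambda>q. norm (lattice_term z g' h' (- r1) (- r2) s q)) summable_on U (- r1) (- r2)"
    "\<And>s. Re s > 2 \<Longrightarrow> (s - 1) * (s - 2) * infsum (lattice_term z g' h' (- r1) (- r2) s) (U (- r1) (- r2)) = H2 s"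
    using upper_lattice_sum[OF k p' z, of "- r1" "- r2"] unfolding U_def by blast
  define f where "f = (\<lambda>(m::int, n::int). (- m, - n))"
  have pt: "lattice_point z r1 r2 (f q) = - lattice_point z (- r1) (- r2) q" for q
    by (cases q) (simp add: f_def lattice_point_def algebra_simps)
  have ff: "f (f q) = q" for q by (cases q) (simp add: f_def)
  have bij: "bij_betw f (U (- r1) (- r2)) L"
  proof (rule bij_betw_byWitness[where f' = f])
    show "f ` U (- r1) (- r2) \<subseteq> L" by (auto simp: L_def U_def pt)
    show "f ` L \<subseteq> U (- r1) (- r2)"
    proof
      fix q assume "q \<in> f ` L"
      then obtain q' where q': "q = f q'" "q' \<in> L" by auto
      then have "upper (- lattice_point z r1 r2 (f q))" by (simp add: L_def ff)
      then show "q \<in> U (- r1) (- r2)" by (simp add: pt U_def)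
    qed
  qed (auto simp: ff)
  have Tf: "lattice_term z g h r1 r2 s (f q) = exp (\<i> * of_real pi * s) * lattice_term z g' h' (- r1) (- r2) s q"
    if "q \<in> U (- r1) (- r2)" for q s
  proof -
    obtain m n where q: "q = (m, n)" by (cases q)
    have "lattice_term z g h r1 r2 s (f q) = g' m * h' n * cpow (lattice_point z r1 r2 (f q)) (- s)"
      by (simp add: lattice_term_def lattice_point_def q f_def g'_def h'_def)
    also have "cpow (lattice_point z r1 r2 (f q)) (- s) = exp (\<i> * of_real pi * s) * cpow (lattice_point z (- r1) (- r2) q) (- s)"
      unfolding pt using that by (intro cpow_minus) (simp add: U_def)
    finally show ?thesis by (simp add: lattice_term_def lattice_point_def q)
  qed
  have S: "S = U r1 r2 \<union> L" and disj: "U r1 r2 \<inter> L = {}"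
  proof -
    have iff: "w \<noteq> 0 \<longleftrightarrow> upper w \<or> upper (- w)" for w
      using upper_cases[of w] upper_nonzero[of w] upper_nonzero[of "- w"] by auto
    show "S = U r1 r2 \<union> L" unfolding S_def U_def L_def iff by blast
    show "U r1 r2 \<inter> L = {}" using upper_not_minus unfolding U_def L_def by blast
  qed
  define H where "H s = H1 s + exp (\<i> * of_real pi * s) * H2 s" for s
  have holH: "H holomorphic_on UNIV" unfolding H_def by (intro holomorphic_intros H1 H2)
  define K where "K = (\<lambda>w. if w = 2 then deriv H 2 else (H w - H 2) / (w - 2))"
  have holK: "K holomorphic_on UNIV" unfolding K_def by (intro pole_lemma_open holH) auto
  have "(\<lambda>q. norm (lattice_term z g h r1 r2 s q)) summable_on S \<and> (s - 1) * infsum (lattice_term z g h r1 r2 s) S = K s"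
    if s: "Re s > 2" for s
  proof -
    define T where "T = lattice_term z g h r1 r2 s"
    define T' where "T' = lattice_term z g' h' (- r1) (- r2) s"
    define e where "e = exp (\<i> * of_real pi * s)"
    have Tf': "T (f q) = e * T' q" if "q \<in> U (- r1) (- r2)" for q using Tf[OF that] by (simp add: T_def T'_def e_def)
    have s1: "(\<lambda>q. norm (T q)) summable_on U r1 r2" using H1(3)[OF s] by (simp add: T_def)
    have "(\<lambda>q. norm e * norm (T' q)) summable_on U (- r1) (- r2)"
      using H2(3)[OF s] unfolding T'_def by (rule summable_on_cmult_right)
    also have "?this \<longleftrightarrow> (\<lambda>q. norm (T (f q))) summable_on U (- r1) (- r2)"
      by (intro summable_on_cong) (simp add: Tf' norm_mult)
    also have "\<dots> \<longleftrightarrow> (\<lambda>q. norm (T q)) summable_on L" by (rule summable_on_reindex_bij_betw[OF bij])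
    finally have s2: "(\<lambda>q. norm (T q)) summable_on L" .
    have "infsum T L = infsum (\<lambda>q. T (f q)) (U (- r1) (- r2))" by (rule infsum_reindex_bij_betw[OF bij, symmetric])
    also have "\<dots> = infsum (\<lambda>q. e * T' q) (U (- r1) (- r2))" by (intro infsum_cong Tf')
    also have "\<dots> = e * infsum T' (U (- r1) (- r2))" by (rule infsum_cmult_right')
    finally have iL: "infsum T L = e * infsum T' (U (- r1) (- r2))" .
    have "infsum T S = infsum T (U r1 r2) + e * infsum T' (U (- r1) (- r2))"
      unfolding S iL[symmetric] by (rule infsum_Un_disjoint[OF abs_summable_summable[OF s1] abs_summable_summable[OF s2] disj])
    then have "(s - 1) * (s - 2) * infsum T S = (s - 1) * (s - 2) * infsum T (U r1 r2) + e * ((s - 1) * (s - 2) * infsum T' (U (- r1) (- r2)))"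
      by (simp add: algebra_simps)
    also have "\<dots> = H s" unfolding T_def T'_def H1(4)[OF s] H2(4)[OF s] by (simp add: H_def e_def)
    finally have "(s - 2) * ((s - 1) * infsum T S) = H s" by (simp add: mult_ac)
    moreover have "s \<noteq> 2" using s by auto
    moreover have "H 2 = 0" by (simp add: H_def H1 H2)
    ultimately have "(s - 1) * infsum T S = K s" by (simp add: K_def eq_divide_eq mult.commute)
    moreover have "(\<lambda>q. norm (T q)) summable_on S" unfolding S by (rule summable_on_Un_disjoint[OF s1 s2 disj])
    ultimately show ?thesis by (simp add: T_def)
  qed
  then show ?thesis using holK by blast
qed

lemma G_series_lattice:
  assumes "Im z > 0"
  shows "G_series z g h r1 r2 s = infsum (lattice_term z g h r1 r2 s) {q. lattice_point z r1 r2 q \<noteq> 0}"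
proof -
  have "{(m, n). (real_of_int m, real_of_int n) \<noteq> (- r1, - r2)} = {q. lattice_point z r1 r2 q \<noteq> 0}"
    using lattice_point_eq_0_iff[OF assms] by (auto simp: eq_neg_iff_add_eq_0)
  then show ?thesis by (simp add: G_series_def lattice_term_def)
qed

lemma L_series_continuation:
  assumes k: "k > 0" and g: "periodic_seq k g"
  shows "\<exists>K. K holomorphic_on UNIV \<and> (\<forall>s. Re s > 1 \<longrightarrow> (s - 1) * L_series g \<theta> s = K s)"
proof -
  \<comment> \<open>The least integer above -\<theta>; the inequality is strict, hence floor plus
    one.\<close>
  define n0 where "n0 = \<lfloor>- \<theta>\<rfloor> + 1"
  have n0: "{n. of_int n > - \<theta>} = {n0..}" unfolding n0_def by (auto; linarith)
  have pos: "of_int n0 + \<theta> > 0" unfolding n0_def by linarith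
  define y where "y \<nu> = (of_int n0 + of_int \<nu> + \<theta>) / of_int k" for \<nu> :: int
  have kr: "real_of_int k > 0" "complex_of_int k \<noteq> 0" using k by auto
  have y: "y \<nu> > 0" if "\<nu> \<ge> 0" for \<nu> using that pos kr by (auto simp: y_def intro!: divide_pos_pos)
  have rek: "Re (of_int k) > 0" using k by simp
  define M where "M \<nu> = mellin (\<lambda>u. geom_ker (y \<nu>) (of_int k) (of_real u))" for \<nu>
  have "\<forall>\<nu>\<in>{0..<k}. \<exists>K. K holomorphic_on UNIV \<and> (\<forall>s. Re s > 1 \<longrightarrow> (s - 1) * (M \<nu> s / Gamma s) = K s)"
    using cone_entire_1[OF rek y] by (auto simp: M_def)
  then obtain Kf where Kf: "\<And>\<nu>. \<nu> \<in> {0..<k} \<Longrightarrow> Kf \<nu> holomorphic_on UNIV"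
    "\<And>\<nu> s. \<nu> \<in> {0..<k} \<Longrightarrow> Re s > 1 \<Longrightarrow> (s - 1) * (M \<nu> s / Gamma s) = Kf \<nu> s"
    by (metis bchoice)
  define K where "K s = (\<Sum>\<nu>\<in>{0..<k}. g (n0 + \<nu>) * Kf \<nu> s)" for s
  define idx where "idx \<nu> l = n0 + \<nu> + k * int l" for \<nu> l
  have inj: "inj (idx \<nu>)" for \<nu> using k by (auto simp: inj_on_def idx_def)
  have tile: "(\<Union>\<nu>\<in>{0..<k}. range (idx \<nu>)) = {n0..}"
  proof
    show "(\<Union>\<nu>\<in>{0..<k}. range (idx \<nu>)) \<subseteq> {n0..}" using k by (auto simp: idx_def)
    show "{n0..} \<subseteq> (\<Union>\<nu>\<in>{0..<k}. range (idx \<nu>))"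
    proof
      fix n assume "n \<in> {n0..}"
      then have "n = idx ((n - n0) mod k) (nat ((n - n0) div k))"
        using k by (simp add: idx_def pos_imp_zdiv_nonneg_iff add.assoc)
      then show "n \<in> (\<Union>\<nu>\<in>{0..<k}. range (idx \<nu>))" using k by (intro UN_I[of "(n - n0) mod k"]) auto
    qed
  qed
  have idx_mod: "\<nu> = (n - n0) mod k" if "\<nu> \<in> {0..<k}" "n \<in> range (idx \<nu>)" for \<nu> n
    using that by (auto simp: idx_def add.assoc)
  have "(s - 1) * L_series g \<theta> s = K s" if s: "Re s > 1" for s
  proof -
    define T where "T n = g n * cpow (of_int n + of_real \<theta>) (- s)" for n
    have T_idx: "T (idx \<nu> l) = g (n0 + \<nu>) * ((of_nat l + of_real (y \<nu>)) * of_int k) powr (- s)" if "\<nu> \<in> {0..<k}" for \<nu> l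
    proof -
      have "of_int k * complex_of_real (y \<nu>) = of_int n0 + of_int \<nu> + of_real \<theta>" using kr by (simp add: y_def)
      then have eq: "of_int (idx \<nu> l) + of_real \<theta> = (of_nat l + of_real (y \<nu>)) * (of_int k :: complex)"
        by (simp add: idx_def algebra_simps)
      have "Re ((of_nat l + of_real (y \<nu>)) * (of_int k :: complex)) > 0"
        using y[of \<nu>] that kr by (simp add: add_nonneg_pos)
      then have "cpow (of_int (idx \<nu> l) + of_real \<theta>) (- s) = ((of_nat l + of_real (y \<nu>)) * of_int k) powr (- s)"
        unfolding eq by (rule cpow_eq_powr)
      moreover have "g (idx \<nu> l) = g (n0 + \<nu>)"
        unfolding idx_def by (rule periodic_seq_add_mult[OF g])
      ultimately show ?thesis by (simp add: T_def)
    qed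
    have "(T has_sum (\<Sum>\<nu>\<in>{0..<k}. g (n0 + \<nu>) * (M \<nu> s / Gamma s))) (\<Union>\<nu>\<in>{0..<k}. range (idx \<nu>))"
    proof (rule sum_has_sum)
      fix \<nu> assume \<nu>: "\<nu> \<in> {0..<k}"
      have "((\<lambda>l::nat. ((of_nat l + of_real (y \<nu>)) * of_int k) powr (- s)) has_sum (M \<nu> s / Gamma s)) UNIV"
        unfolding M_def using \<nu> by (intro cone_sum_1 rek y s) auto
      then have "((\<lambda>l. g (n0 + \<nu>) * ((of_nat l + of_real (y \<nu>)) * of_int k) powr (- s)) has_sum (g (n0 + \<nu>) * (M \<nu> s / Gamma s))) UNIV"
        by (rule has_sum_cmult_right)
      then show "(T has_sum (g (n0 + \<nu>) * (M \<nu> s / Gamma s))) (range (idx \<nu>))"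
        by (subst has_sum_reindex[OF inj]) (simp add: o_def T_idx[OF \<nu>])
    qed (use idx_mod in blast)+
    then have "L_series g \<theta> s = (\<Sum>\<nu>\<in>{0..<k}. g (n0 + \<nu>) * (M \<nu> s / Gamma s))"
      unfolding tile L_series_def n0 by (intro infsumI) (simp add: T_def[abs_def])
    then have "(s - 1) * L_series g \<theta> s = (\<Sum>\<nu>\<in>{0..<k}. g (n0 + \<nu>) * ((s - 1) * (M \<nu> s / Gamma s)))"
      by (simp add: sum_distrib_left mult_ac)
    also have "\<dots> = K s" unfolding K_def by (intro sum.cong refl) (simp only: Kf(2)[OF _ s])
    finally show ?thesis .
  qed
  moreover have "K holomorphic_on UNIV" unfolding K_def by (intro holomorphic_intros Kf)
  ultimately show ?thesis by blast
qed

section \<open>The loop integral of a cone\<close>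

lemma geom_ker_decay:
  assumes w: "Re w > 0" and x: "x \<ge> 0" and B: "B \<ge> 0"
  shows "\<exists>R K. K \<ge> 0 \<and> (\<forall>u. Re u \<ge> R \<longrightarrow> \<bar>Im u\<bar> \<le> B \<longrightarrow> norm (geom_ker x w u) \<le> K * exp (- (x * Re w) * Re u))"
proof -
  define R where "R = (1 + \<bar>Im w\<bar> * B) / Re w"
  define K where "K = 2 * exp (x * (\<bar>Im w\<bar> * B))"
  have "norm (geom_ker x w u) \<le> K * exp (- (x * Re w) * Re u)" if u: "Re u \<ge> R" "\<bar>Im u\<bar> \<le> B" for u
  proof -
    have im: "Im w * Im u \<le> \<bar>Im w\<bar> * B"
    proof -
      have "Im w * Im u \<le> \<bar>Im w\<bar> * \<bar>Im u\<bar>" by (metis abs_ge_self abs_mult)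
      also have "\<dots> \<le> \<bar>Im w\<bar> * B" using u by (intro mult_left_mono) auto
      finally show ?thesis .
    qed
    have "Re w * Re u \<ge> 1 + \<bar>Im w\<bar> * B"
      using u(1) w by (simp add: R_def field_simps)
    with im have "Re (w * u) \<ge> 1" by simp
    then have "norm (exp (- w * u)) \<le> exp (-1)" by simp
    also have "\<dots> \<le> 1/2" using exp_ge_add_one_self[of 1] by (simp add: exp_minus field_simps)
    finally have d: "norm (1 - exp (- w * u)) \<ge> 1/2"
      using norm_triangle_ineq2[of 1 "exp (- w * u)"] by simp
    have "norm (geom_ker x w u) \<le> norm (exp (- of_real x * w * u)) / (1/2)"
      unfolding geom_ker_def norm_divide using d by (intro divide_left_mono) auto
    also have "\<dots> = 2 * exp (- x * Re (w * u))" by (simp add: mult.assoc)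
    also have "\<dots> \<le> 2 * exp (x * (\<bar>Im w\<bar> * B) + (- (x * Re w) * Re u))"
    proof -
      have "x * (Im w * Im u) \<le> x * (\<bar>Im w\<bar> * B)" using im x by (rule mult_left_mono)
      then show ?thesis by (simp add: algebra_simps)
    qed
    also have "\<dots> = K * exp (- (x * Re w) * Re u)" by (simp only: K_def exp_add mult.assoc)
    finally show ?thesis .
  qed
  moreover have "K \<ge> 0" by (simp add: K_def)
  ultimately show ?thesis by blast
qed

lemma loop_integrand_decay:
  fixes \<delta> B e :: real
  assumes w: "Re \<omega>1 > 0" "Re \<omega>2 > 0" and xy: "x \<ge> 0" "y \<ge> 0" "x + y > 0" and e: "e > 0"
  shows "\<exists>R. \<forall>u. Re u \<ge> R \<longrightarrow> \<bar>Im u\<bar> \<le> B \<longrightarrow>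
     norm (cpow_2pi u (s - 1) * (geom_ker x \<omega>1 u * geom_ker y \<omega>2 u)) \<le> e"
proof -
  define B' where "B' = max B 0"
  have B': "B' \<ge> 0" by (simp add: B'_def)
  obtain R1 K1 where K1: "K1 \<ge> 0" "\<And>u. Re u \<ge> R1 \<Longrightarrow> \<bar>Im u\<bar> \<le> B' \<Longrightarrow> norm (geom_ker x \<omega>1 u) \<le> K1 * exp (- (x * Re \<omega>1) * Re u)"
    using geom_ker_decay[OF w(1) xy(1) B'] by blast
  obtain R2 K2 where K2: "K2 \<ge> 0" "\<And>u. Re u \<ge> R2 \<Longrightarrow> \<bar>Im u\<bar> \<le> B' \<Longrightarrow> norm (geom_ker y \<omega>2 u) \<le> K2 * exp (- (y * Re \<omega>2) * Re u)"
    using geom_ker_decay[OF w(2) xy(2) B'] by blast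
  \<comment> \<open>Half of the decay rate is reserved for the power of u.\<close>
  define \<delta> where "\<delta> = (x * Re \<omega>1 + y * Re \<omega>2) / 2"
  have "x * Re \<omega>1 + y * Re \<omega>2 > 0"
    using w xy by (cases "x = 0") (auto intro: add_pos_nonneg)
  then have \<delta>: "\<delta> > 0" by (simp add: \<delta>_def)
  from norm_powr_le_exp[OF \<delta> zero_less_one, of B' "Re (s - 1)"]
  obtain K3 where K3: "K3 \<ge> 0" "\<forall>u. 1 \<le> norm u \<and> - 1 \<le> Re u \<and> \<bar>Im u\<bar> \<le> B' \<longrightarrow> norm u powr (Re (s - 1)) \<le> K3 * exp (\<delta> * Re u)"
    by (elim exE conjE)
  \<comment> \<open>The summand 1 makes K positive, as ln (K / e) enters the choice of R, which
    ensures K exp(-\<delta> R) \<le> e.\<close>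
  define K where "K = exp (2 * pi * \<bar>Im (s - 1)\<bar>) * K3 * (K1 * K2) + 1"
  have Kpos: "K > 0" using K1 K2 K3 by (auto simp: K_def intro!: add_nonneg_pos)
  define R where "R = max 1 (max R1 (max R2 (ln (K / e) / \<delta>)))"
  show ?thesis
  proof (intro exI[of _ R] allI impI)
    fix u assume u: "R \<le> Re u" "\<bar>Im u\<bar> \<le> B"
    then have u': "Re u \<ge> 1" "Re u \<ge> R1" "Re u \<ge> R2" "ln (K / e) / \<delta> \<le> Re u" "\<bar>Im u\<bar> \<le> B'"
      by (auto simp: R_def B'_def)
    have nu: "norm u \<ge> 1" "u \<noteq> 0" using u'(1) complex_Re_le_cmod[of u] by auto
    have "norm (cpow_2pi u (s - 1)) \<le> exp (2 * pi * \<bar>Im (s - 1)\<bar>) * norm u powr Re (s - 1)"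
      by (rule norm_cpow_2pi_le[OF nu(2)])
    also have "\<dots> \<le> exp (2 * pi * \<bar>Im (s - 1)\<bar>) * (K3 * exp (\<delta> * Re u))"
      using K3(2)[rule_format, of u] nu u' by (intro mult_left_mono) auto
    finally have "norm (cpow_2pi u (s - 1) * (geom_ker x \<omega>1 u * geom_ker y \<omega>2 u)) \<le>
        (exp (2 * pi * \<bar>Im (s - 1)\<bar>) * (K3 * exp (\<delta> * Re u))) * ((K1 * exp (- (x * Re \<omega>1) * Re u)) * (K2 * exp (- (y * Re \<omega>2) * Re u)))"
      unfolding norm_mult using K1 K2 K3 u' by (intro mult_mono) auto
    also have "\<dots> = exp (2 * pi * \<bar>Im (s - 1)\<bar>) * K3 * (K1 * K2) * (exp (\<delta> * Re u) * exp (- (x * Re \<omega>1) * Re u) * exp (- (y * Re \<omega>2) * Re u))"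
      by (simp only: mult_ac)
    also have "exp (\<delta> * Re u) * exp (- (x * Re \<omega>1) * Re u) * exp (- (y * Re \<omega>2) * Re u) = exp (- \<delta> * Re u)"
    proof -
      have "x * Re \<omega>1 + y * Re \<omega>2 = 2 * \<delta>" by (simp add: \<delta>_def)
      then have "\<delta> + - (x * Re \<omega>1) + - (y * Re \<omega>2) = - \<delta>" by linarith
      then show ?thesis by (simp only: exp_add[symmetric] distrib_right[symmetric])
    qed
    also have "exp (2 * pi * \<bar>Im (s - 1)\<bar>) * K3 * (K1 * K2) * exp (- \<delta> * Re u) \<le> K * exp (- \<delta> * Re u)"
      by (intro mult_right_mono) (auto simp: K_def)
    also have "\<dots> \<le> K * exp (- ln (K / e))"
      using u'(4) \<delta> Kpos by (intro mult_left_mono) (auto simp: pos_divide_le_eq mult.commute)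
    also have "\<dots> = e" using Kpos e by (simp add: exp_minus)
    finally show "norm (cpow_2pi u (s - 1) * (geom_ker x \<omega>1 u * geom_ker y \<omega>2 u)) \<le> e" .
  qed
qed

lemma cpow_2pi_minus_2:
  assumes "u \<noteq> 0"
  shows "cpow_2pi u (s - 3) * u\<^sup>2 = cpow_2pi u (s - 1)"
proof -
  define l where "l = of_real (ln (cmod u)) + \<i> * of_real (Arg2pi u)"
  have "exp l = u"
    using assms Arg2pi_eq[of u] by (simp add: l_def exp_add exp_of_real)
  then have "u\<^sup>2 = exp (2 * l)" by (simp add: exp_double)
  then have "cpow_2pi u (s - 3) * u\<^sup>2 = exp ((s - 3) * l + 2 * l)"
    by (simp only: cpow_2pi_def l_def exp_add)
  also have "(s - 3) * l + 2 * l = (s - 1) * l" by (simp add: algebra_simps)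
  finally show ?thesis by (simp only: cpow_2pi_def l_def)
qed

text \<open>Deforming the loop gives the Hankel integral of the two kernels, which is entire and
  known in terms of the Mellin transform. The minus sign is that of the first fraction in
  \<open>I_loop\<close>, whose denominator is the negative of the one in
  \<open>geom_ker\<close>.\<close>

lemma loop_integral_cone:
  assumes w: "Re \<omega>1 > 0" "Re \<omega>2 > 0" and xy: "x \<ge> 0" "y \<ge> 0" "x + y > 0"
    and loop: "is_loop {u. (exp (- \<omega>1 * u) - 1) * (exp (\<omega>2 * u) - 1) = 0} \<gamma>"
  shows "\<exists>J. J holomorphic_on UNIV \<and>
     (\<forall>s. loop_integral \<gamma> (\<lambda>u. - (cpow_2pi u (s - 1) * (geom_ker x \<omega>1 u * geom_ker y \<omega>2 u))) = J s) \<and>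
     (\<forall>s. Re s > 2 \<longrightarrow> J s = - (exp (2 * of_real pi * \<i> * s) - 1) * mellin (\<lambda>u. geom_ker x \<omega>1 (of_real u) * geom_ker y \<omega>2 (of_real u)) s)"
proof -
  define Z where "Z = {u. (exp (- \<omega>1 * u) - 1) * (exp (\<omega>2 * u) - 1) = 0}"
  \<comment> \<open>exp (\<omega>2 u) and exp (- \<omega>2 u) equal 1 at the same points, so
    \<open>Z\<close> consists of the zeros of the two denominators of the kernels.\<close>
  have Z_alt: "Z = {u. exp (- \<omega>1 * u) = 1} \<union> {u. exp (- \<omega>2 * u) = 1}"
    by (auto simp: Z_def exp_minus)
  define \<eta> where "\<eta> = min (strip_width \<omega>1) (strip_width \<omega>2)"
  have \<eta>: "0 < \<eta>" "\<eta> \<le> strip_width \<omega>1" "\<eta> \<le> strip_width \<omega>2"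
    using strip_width_pos w by (auto simp: \<eta>_def)
  define \<psi> where "\<psi> = (\<lambda>u. geom_ker0 x \<omega>1 u * geom_ker0 y \<omega>2 u)"
  obtain \<delta> C where "hankel \<psi> \<eta> \<delta> C" using hankel_cone_2[OF w xy \<eta>] unfolding \<psi>_def by blast
  then interpret hankel \<psi> \<eta> \<delta> C .
  define f where "f s u = cpow_2pi u (s - 1) * (geom_ker x \<omega>1 u * geom_ker y \<omega>2 u)" for s u
  have closedZ: "closed Z"
  proof -
    have "Z = (\<lambda>u. (exp (- \<omega>1 * u) - 1) * (exp (\<omega>2 * u) - 1)) -` {0}" by (auto simp: Z_def)
    then show ?thesis by (simp only:) (intro continuous_closed_vimage closed_singleton continuous_intros)
  qed
  have finZ: "finite (Z \<inter> {u. \<bar>Im u\<bar> \<le> B})" for B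
    unfolding Z_alt Int_Un_distrib2 using finite_exp_eq_1 w by blast
  have stripZ: "Z \<inter> strip \<eta> \<subseteq> {0}"
  proof
    fix u assume "u \<in> Z \<inter> strip \<eta>"
    then show "u \<in> {0}"
      using exp_eq_1_strip[OF w(1), of u] exp_eq_1_strip[OF w(2), of u] \<eta> by (auto simp: Z_alt strip_def)
  qed
  have holf: "f s holomorphic_on - (Z \<union> \<real>\<^sub>\<ge>\<^sub>0)" for s
  proof -
    have "(\<lambda>u. exp ((s - 1) * (Ln (- u) + \<i> * of_real pi)) *
        ((exp (- of_real x * \<omega>1 * u) / (1 - exp (- \<omega>1 * u))) * (exp (- of_real y * \<omega>2 * u) / (1 - exp (- \<omega>2 * u)))))
        holomorphic_on - (Z \<union> \<real>\<^sub>\<ge>\<^sub>0)"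
      by (intro holomorphic_intros) (auto simp: Z_alt complex_nonpos_Reals_iff complex_nonneg_Reals_iff)
    then show ?thesis
      by (rule holomorphic_transform) (auto simp: f_def geom_ker_def cpow_2pi_eq_Ln)
  qed
  have fF: "hankel_integrand \<psi> s u = f s u" if "u \<notin> \<real>\<^sub>\<ge>\<^sub>0" for s u
  proof -
    have u: "u \<noteq> 0" using that by auto
    have "hankel_integrand \<psi> s u = (cpow_2pi u (s - 3) * u\<^sup>2) * (geom_ker x \<omega>1 u * geom_ker y \<omega>2 u)"
      using u by (simp add: hankel_integrand_def \<psi>_def geom_ker0_def power2_eq_square)
    then show ?thesis unfolding cpow_2pi_minus_2[OF u] f_def .
  qed
  have seg: "contour_integral (linepath a b) (hankel_integrand \<psi> s) = contour_integral (linepath a b) (f s)"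
    if "closed_segment a b \<subseteq> strip \<eta> - \<real>\<^sub>\<ge>\<^sub>0" for a b s
    using that by (intro contour_integral_cong) (auto simp: fF)
  have hor: "((\<lambda>X. contour_integral (linepath (Complex (- \<eta>) y') (Complex X y')) (f s)) \<longlongrightarrow>
           (LINT t:{- \<eta>..}|lborel. hankel_integrand \<psi> s (Complex t y'))) at_top"
    if y': "y' = \<eta> \<or> y' = - \<eta>" for y' s
  proof (rule Lim_transform_eventually[OF horizontal_tendsto[OF y', of s]])
    show "\<forall>\<^sub>F X in at_top. contour_integral (linepath (Complex (- \<eta>) y') (Complex X y')) (hankel_integrand \<psi> s)
        = contour_integral (linepath (Complex (- \<eta>) y') (Complex X y')) (f s)"
      using eventually_gt_at_top[of "- \<eta>"] by eventually_elim (intro seg horizontal_segment y')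
  qed
  have lim: "((\<lambda>T. contour_integral (trunc_path \<gamma> T) (f s)) \<longlongrightarrow> hankel_integral \<psi> \<eta> s) at_top" for s
    unfolding hankel_integral_eq seg[OF left_segment]
  proof (rule loop_tendsto[of Z \<gamma>])
    show "is_loop Z \<gamma>" using loop by (simp add: Z_def)
    show "\<exists>R. \<forall>u. R \<le> Re u \<longrightarrow> \<bar>Im u\<bar> \<le> B \<longrightarrow> norm (f s u) \<le> e" if "e > 0" for B e
      unfolding f_def by (rule loop_integrand_decay[OF w xy that])
  qed (use closedZ finZ \<eta> stripZ holf hor in auto)
  have li: "loop_integral \<gamma> (\<lambda>u. - f s u) = - hankel_integral \<psi> \<eta> s" for s
    unfolding loop_integral_def contour_integral_neg by (intro tendsto_Lim tendsto_minus lim) simp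
  have "mellin \<phi> s = mellin (\<lambda>u. geom_ker x \<omega>1 (of_real u) * geom_ker y \<omega>2 (of_real u)) s" for s
    unfolding mellin_def by (rule set_lebesgue_integral_cong) (auto simp: \<psi>_def geom_ker0_def power2_eq_square)
  note m = this
  show ?thesis
  proof (intro exI[of _ "\<lambda>s. - hankel_integral \<psi> \<eta> s"] conjI allI impI)
    show "(\<lambda>s. - hankel_integral \<psi> \<eta> s) holomorphic_on UNIV"
      by (intro holomorphic_intros hankel_integral_entire)
    show "loop_integral \<gamma> (\<lambda>u. - (cpow_2pi u (s - 1) * (geom_ker x \<omega>1 u * geom_ker y \<omega>2 u))) = - hankel_integral \<psi> \<eta> s" for s
      using li[of s] by (simp only: f_def)
    show "- hankel_integral \<psi> \<eta> s = - (exp (2 * of_real pi * \<i> * s) - 1) * mellin (\<lambda>u. geom_ker x \<omega>1 (of_real u) * geom_ker y \<omega>2 (of_real u)) s"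
      if "Re s > 2" for s
      unfolding hankel_integral_eq_mellin'[OF that] m by (rule minus_mult_left)
  qed
qed

text \<open>With q for the fractional part, multiplying numerator and denominator by e^(-ku) turns
  e^((v+q)u) / (e^(ku) - 1) into a geometric series with offset k y = k - v - q: the exponent of the
  numerator stays below that of the denominator. As fractional parts are less than 1, v < k gives y
  > 0 and j \<ge> 1 gives x > 0.\<close>

lemma I_loop_cone:
  fixes k c d j \<mu> v :: int and \<gamma> :: "real \<Rightarrow> complex" and R1 \<rho> :: real and z :: complex
  assumes k: "k > 0" and c: "c > 0" and re: "Re (of_int c * z + of_int d) > 0"
    and j: "j \<ge> 1" and \<mu>: "\<mu> \<ge> 0" and v: "0 \<le> v" "v < k"
    and loop: "is_loop (I_poles k c d z) \<gamma>"
  defines "x \<equiv> (of_int (c * \<mu> + j) - frac R1) / of_int (c * k)"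
    and "y \<equiv> (of_int (k - v) - frac ((of_int (d * j) + \<rho>) / of_int c)) / of_int k"
  shows "x > 0" "y > 0"
    and "\<exists>J. J holomorphic_on UNIV \<and> (\<forall>s. I_loop \<gamma> k c d R1 \<rho> j \<mu> v z s = J s) \<and>
     (\<forall>s. Re s > 2 \<longrightarrow> J s = - (exp (2 * of_real pi * \<i> * s) - 1) *
        mellin (\<lambda>u. geom_ker x (of_int k * (of_int c * z + of_int d)) (of_real u) * geom_ker y (of_int k) (of_real u)) s)"
proof -
  define \<omega> where "\<omega> = of_int c * z + of_int d"
  define q where "q = frac ((of_int (d * j) + \<rho>) / of_int c)"
  have kr: "real_of_int k > 0" "complex_of_int k \<noteq> 0" and cr: "real_of_int c > 0" using k c by auto
  show x: "x > 0"
  proof -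
    have "c * \<mu> + j \<ge> 1" using c j \<mu> by (simp add: add_increasing)
    then have "real_of_int (c * \<mu> + j) \<ge> 1" by (simp only: of_int_1_le_iff)
    then have "real_of_int (c * \<mu> + j) - frac R1 > 0" using frac_lt_1[of R1] by linarith
    then show ?thesis using kr cr unfolding x_def by (intro divide_pos_pos) auto
  qed
  show y: "y > 0"
  proof -
    have "k - v \<ge> 1" using v by simp
    then have "real_of_int (k - v) \<ge> 1" by (simp only: of_int_1_le_iff)
    moreover have "q < 1" unfolding q_def by (rule frac_lt_1)
    ultimately have "real_of_int (k - v) - q > 0" by linarith
    then show ?thesis using kr unfolding y_def q_def[symmetric] by (intro divide_pos_pos) auto
  qed
  have w: "Re (of_int k * \<omega>) > 0" "Re (of_int k) > 0"
    using re k by (simp_all add: \<omega>_def)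
  have poles: "I_poles k c d z = {u. (exp (- (of_int k * \<omega>) * u) - 1) * (exp (of_int k * u) - 1) = 0}"
    by (simp add: I_poles_def \<omega>_def mult_ac)
  have exp_flip: "exp ((of_int v + of_real q) * u) / (exp (of_int k * u) - 1) = geom_ker y (of_int k) u" for u
  proof -
    define E where "E = exp (of_int k * u)"
    have E0: "E \<noteq> 0" by (simp add: E_def)
    have ky: "of_real y * of_int k = of_int k - of_int v - complex_of_real q"
      using kr by (simp only: y_def q_def[symmetric]) (simp add: field_simps)
    have "exp (- of_real y * of_int k * u) = exp ((of_int v + of_real q) * u - of_int k * u)"
      by (simp only: mult_minus_left ky) (simp add: algebra_simps)
    then have num: "exp (- of_real y * of_int k * u) = exp ((of_int v + of_real q) * u) / E"
      by (simp only: exp_diff E_def)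
    have den: "1 - exp (- of_int k * u) = (E - 1) / E"
      using E0 by (simp only: mult_minus_left exp_minus E_def[symmetric]) (simp add: field_simps)
    show ?thesis unfolding geom_ker_def num den using E0 by (simp add: E_def[symmetric])
  qed
  have integrand: "cpow_2pi u (s - 1)
       * (exp (- (of_real ((of_int (c * \<mu> + j) - frac R1) / of_int (c * k))
                   * (of_int c * z + of_int d) * of_int k * u))
            / (exp (- of_int k * u * (of_int c * z + of_int d)) - 1))
       * (exp (of_real ((of_int v + frac ((of_int (d * j) + \<rho>) / of_int c)) / of_int k)
                   * of_int k * u)
            / (exp (of_int k * u) - 1)) =
      - (cpow_2pi u (s - 1) * (geom_ker x (of_int k * \<omega>) u * geom_ker y (of_int k) u))" for u s
  proof -
    have e2: "exp (of_real ((of_int v + frac ((of_int (d * j) + \<rho>) / of_int c)) / of_int k) * of_int k * u) = exp ((of_int v + of_real q) * u)"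
      using kr by (simp only: q_def[symmetric]) simp
    have "exp (- (of_real x * \<omega> * of_int k * u)) / (exp (- of_int k * u * \<omega>) - 1) = - geom_ker x (of_int k * \<omega>) u"
    proof -
      have "exp (- of_int k * u * \<omega>) - 1 = - (1 - exp (- (of_int k * \<omega>) * u))" by (simp add: mult_ac)
      then show ?thesis unfolding geom_ker_def by (simp only: minus_divide_right[symmetric]) (simp add: mult_ac)
    qed
    then show ?thesis unfolding e2 exp_flip x_def[symmetric] \<omega>_def[symmetric] by simp
  qed
  have "x \<ge> 0" "y \<ge> 0" "x + y > 0" using x y by auto
  from loop_integral_cone[OF w this loop[unfolded poles]]
  show "\<exists>J. J holomorphic_on UNIV \<and> (\<forall>s. I_loop \<gamma> k c d R1 \<rho> j \<mu> v z s = J s) \<and>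
     (\<forall>s. Re s > 2 \<longrightarrow> J s = - (exp (2 * of_real pi * \<i> * s) - 1) *
        mellin (\<lambda>u. geom_ker x (of_int k * (of_int c * z + of_int d)) (of_real u) * geom_ker y (of_int k) (of_real u)) s)"
    unfolding I_loop_def integrand \<omega>_def by blast
qed

section \<open>The transformation formula\<close>

text \<open>Write M = [R1] + j + c t. Raising t by one and N by d moves the lattice point by cz + d,
  parallel to an edge of the sector, so the bound on N - d t depends on j alone. Splitting t and N -
  d t modulo k makes both coefficients constant; for the second one this uses that k divides
  d.\<close>

lemma cone_decomposition:
  fixes k c d :: int and z s :: complex and R1 R2 :: real and F1 F2 :: "int \<Rightarrow> complex"
  assumes k: "k > 0" and c: "c > 0" and d: "k dvd d"
    and F1: "\<And>n m. F1 (n + k * m) = F1 n" and F2: "\<And>n m. F2 (n + k * m) = F2 n"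
    and re: "Re (of_int c * z + of_int d) > 0" and s: "Re s > 2"
    and x: "\<And>j \<mu>. 1 \<le> j \<Longrightarrow> 0 \<le> \<mu> \<Longrightarrow> x j \<mu> > 0" and y: "\<And>j v. 0 \<le> v \<Longrightarrow> v < k \<Longrightarrow> y j v > 0"
    and x_eq: "\<And>j \<mu>. x j \<mu> = (of_int (c * \<mu> + j) - frac R1) / of_int (c * k)"
    and y_eq: "\<And>j v. y j v = (of_int (k - v) - frac (R2 + of_int d * (of_int j - frac R1) / of_int c)) / of_int k"
  shows "(lattice_term z F1 F2 (- R1) (- R2) s has_sum
      (\<Sum>j = 1..c. \<Sum>\<mu> = 0..k - 1. \<Sum>v = 0..k - 1.
         F1 (\<mu> * c + j + \<lfloor>R1\<rfloor>) * F2 (\<lfloor>R2 + of_int d * (of_int j - frac R1) / of_int c\<rfloor> - v)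
         * (mellin (\<lambda>u. geom_ker (x j \<mu>) (of_int k * (of_int c * z + of_int d)) (of_real u) * geom_ker (y j v) (of_int k) (of_real u)) s / Gamma s)))
      {(M, N). of_int M > R1 \<and> of_int c * (of_int N - R2) > of_int d * (of_int M - R1)}"
proof -
  define q where "q j = R2 + of_int d * (of_int j - frac R1) / of_int c" for j :: int
  define \<omega> where "\<omega> = of_int k * (of_int c * z + of_int d)"
  define T where "T = lattice_term z F1 F2 (- R1) (- R2) s"
  define X where "X = {(M, N). of_int M > R1 \<and> of_int c * (of_int N - R2) > of_int d * (of_int M - R1)}"
  define P where "P = {1..c} \<times> {0..k - 1} \<times> {0..k - 1}"
  \<comment> \<open>As l' and v vary, k (l' + 1) - v runs exactly once through the positive
    integers. The negative sign of v is the one in the second coefficient of the formula.\<close>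
  define idx where "idx = (\<lambda>(j, \<mu>, v) (l, l'). (\<lfloor>R1\<rfloor> + j + c * (\<mu> + k * int l), \<lfloor>q j\<rfloor> + d * (\<mu> + k * int l) + k * (int l' + 1) - v))"
  define C where "C = (\<lambda>(j, \<mu>, v). F1 (\<mu> * c + j + \<lfloor>R1\<rfloor>) * F2 (\<lfloor>q j\<rfloor> - v))"
  define Me where "Me = (\<lambda>(j, \<mu>, v). mellin (\<lambda>u. geom_ker (x j \<mu>) \<omega> (of_real u) * geom_ker (y j v) (of_int k) (of_real u)) s / Gamma s)"
  have kr: "real_of_int k > 0" "complex_of_int k \<noteq> 0" and cr: "real_of_int c > 0" "complex_of_int c \<noteq> 0" using k c by auto
  have w: "Re \<omega> > 0" "Re (of_int k) > 0" using re k by (simp_all add: \<omega>_def)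
  obtain d' where d': "d = k * d'" using d by auto
  \<comment> \<open>Expressed by j and t, the inequality of the sector compares N - d t with the
    threshold q j, up to the positive factor c.\<close>
  have c_frac: "of_int c * (of_int N - R2) - of_int d * (of_int M - R1) = of_int c * (of_int (N - d * t) - q j)"
    if "M = \<lfloor>R1\<rfloor> + j + c * t" for M N j t
  proof -
    have M: "of_int M - R1 = of_int j - frac R1 + of_int c * of_int t" by (simp add: that frac_def)
    have "of_int d * (of_int M - R1) = of_int d * (of_int j - frac R1) + of_int c * (of_int d * of_int t)"
      unfolding M by (simp only: distrib_left mult_ac)
    moreover have "of_int c * q j = of_int c * R2 + of_int d * (of_int j - frac R1)"
      using cr by (simp add: q_def distrib_left)
    ultimately show ?thesis by (simp only: of_int_diff of_int_mult right_diff_distrib)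
  qed
  have X_iff: "(M, N) \<in> X \<longleftrightarrow> of_int M > R1 \<and> N - d * t \<ge> \<lfloor>q j\<rfloor> + 1" if "M = \<lfloor>R1\<rfloor> + j + c * t" for M N j t
  proof -
    have "of_int c * (of_int N - R2) > of_int d * (of_int M - R1) \<longleftrightarrow> of_int c * (of_int (N - d * t) - q j) > 0"
      using c_frac[OF that, of N] by linarith
    also have "\<dots> \<longleftrightarrow> of_int (N - d * t) > q j" using cr by (simp add: zero_less_mult_iff)
    also have "\<dots> \<longleftrightarrow> N - d * t \<ge> \<lfloor>q j\<rfloor> + 1" by linarith
    finally show ?thesis by (simp add: X_def)
  qed
  \<comment> \<open>A left inverse of all the parametrisations at once: it recovers the cone from
    the lattice point, which gives disjointness. The shifts by 1 are due to j and N - d t -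
    \<lfloor>q j\<rfloor> starting at 1.\<close>
  define dec where "dec = (\<lambda>(M, N). let i = M - \<lfloor>R1\<rfloor> - 1; j = i mod c + 1; t = i div c; p = N - \<lfloor>q j\<rfloor> - d * t - 1
      in (j, t mod k, k - 1 - p mod k))"
  have dec_idx: "dec (idx p i) = p" if "p \<in> P" for p i
  proof -
    obtain j \<mu> v where p: "p = (j, \<mu>, v)" by (cases p)
    obtain l l' where i: "i = (l, l')" by (cases i)
    have b: "1 \<le> j" "j \<le> c" "0 \<le> \<mu>" "\<mu> < k" "0 \<le> v" "v < k" using that by (auto simp: P_def p)
    define t where "t = \<mu> + k * int l"
    have 1: "(j - 1 + c * t) mod c = j - 1" "(j - 1 + c * t) div c = t"
      using b c by (simp_all add: div_add1_eq)
    have 2: "t mod k = \<mu>" using b k by (simp add: t_def)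
    have 3: "(k * (int l' + 1) - v - 1) mod k = k - 1 - v"
    proof -
      have "k * (int l' + 1) - v - 1 = (k - 1 - v) + k * int l'" by (simp add: algebra_simps)
      also have "\<dots> mod k = k - 1 - v" unfolding mod_mult_self2 using b by simp
      finally show ?thesis .
    qed
    have 4: "\<lfloor>R1\<rfloor> + j + c * t - \<lfloor>R1\<rfloor> - 1 = j - 1 + c * t"
      "\<lfloor>q j\<rfloor> + d * t + k * (int l' + 1) - v - \<lfloor>q j\<rfloor> - d * t - 1 = k * (int l' + 1) - v - 1" by simp_all
    show ?thesis
      unfolding dec_def idx_def p i prod.case Let_def t_def[symmetric] by (simp only: 4 1 2 3 diff_add_cancel) simp
  qed
  have inj: "inj (idx p)" for p
    using k c by (auto simp: inj_on_def idx_def split: prod.splits)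
  have tile: "(\<Union>p\<in>P. range (idx p)) = X"
  proof
    show "(\<Union>p\<in>P. range (idx p)) \<subseteq> X"
    proof
      fix n assume "n \<in> (\<Union>p\<in>P. range (idx p))"
      then obtain j \<mu> v l l' where p: "(j, \<mu>, v) \<in> P" and n: "n = idx (j, \<mu>, v) (l, l')" by fastforce
      have b: "1 \<le> j" "j \<le> c" "0 \<le> \<mu>" "\<mu> < k" "0 \<le> v" "v < k" using p by (auto simp: P_def)
      define t where "t = \<mu> + k * int l"
      have t0: "t \<ge> 0" using b k by (simp add: t_def)
      define M N where "M = \<lfloor>R1\<rfloor> + j + c * t" and "N = \<lfloor>q j\<rfloor> + d * t + k * (int l' + 1) - v"
      have "c * t \<ge> 0" using c t0 by simp
      then have "M \<ge> \<lfloor>R1\<rfloor> + 1" using b by (simp add: M_def)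
      then have "of_int M > R1" by linarith
      moreover have "N - d * t \<ge> \<lfloor>q j\<rfloor> + 1"
      proof -
        have "k * (int l' + 1) \<ge> k" using k by simp
        then show ?thesis unfolding N_def using b by linarith
      qed
      ultimately have "(M, N) \<in> X" using X_iff[OF M_def, of N] by simp
      then show "n \<in> X" by (simp add: n idx_def M_def N_def t_def)
    qed
    show "X \<subseteq> (\<Union>p\<in>P. range (idx p))"
    proof
      fix n assume "n \<in> X"
      moreover obtain M N where n: "n = (M, N)" by (cases n)
      ultimately have MN: "(M, N) \<in> X" by simp
      define i where "i = M - \<lfloor>R1\<rfloor> - 1"
      define j where "j = i mod c + 1"
      define t where "t = i div c"
      have i0: "i \<ge> 0" using MN unfolding i_def X_def by (simp add: floor_less_iff[symmetric])
      have t0: "t \<ge> 0" unfolding t_def using i0 c by (simp add: pos_imp_zdiv_nonneg_iff)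
      have j: "1 \<le> j" "j \<le> c" unfolding j_def using c pos_mod_bound[of c i] pos_mod_sign[of c i] by linarith+
      have M: "M = \<lfloor>R1\<rfloor> + j + c * t" unfolding j_def t_def using mult_div_mod_eq[of c i] by (simp add: i_def)
      define p where "p = N - \<lfloor>q j\<rfloor> - d * t - 1"
      have p0: "p \<ge> 0" using X_iff[OF M, of N] MN by (simp add: p_def)
      define v where "v = k - 1 - p mod k"
      have v: "0 \<le> v" "v < k" unfolding v_def using k pos_mod_bound[of k p] pos_mod_sign[of k p] by linarith+
      have N: "N = \<lfloor>q j\<rfloor> + d * t + k * (p div k + 1) - v"
        unfolding v_def using mult_div_mod_eq[of k p] by (simp add: p_def algebra_simps)
      have tt: "t = t mod k + k * int (nat (t div k))" using t0 k by (simp add: pos_imp_zdiv_nonneg_iff)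
      have pp: "int (nat (p div k)) = p div k" using p0 k by (simp add: pos_imp_zdiv_nonneg_iff)
      have "(M, N) = idx (j, t mod k, v) (nat (t div k), nat (p div k))"
        unfolding idx_def prod.case tt[symmetric] pp using M N by simp
      moreover have "(j, t mod k, v) \<in> P" using j v k by (simp add: P_def)
      ultimately show "n \<in> (\<Union>p\<in>P. range (idx p))" unfolding n by blast
    qed
  qed
  have T_idx: "T (idx p i) = C p * (case (p, i) of ((j, \<mu>, v), (l, l')) \<Rightarrow> ((of_nat l + of_real (x j \<mu>)) * \<omega> + (of_nat l' + of_real (y j v)) * of_int k) powr (- s))"
    if pP: "p \<in> P" for p i
  proof -
    obtain j \<mu> v where p: "p = (j, \<mu>, v)" by (cases p)
    obtain l l' where i: "i = (l, l')" by (cases i)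
    have b: "1 \<le> j" "j \<le> c" "0 \<le> \<mu>" "\<mu> < k" "0 \<le> v" "v < k" using pP by (auto simp: P_def p)
    define t where "t = \<mu> + k * int l"
    define M N where "M = \<lfloor>R1\<rfloor> + j + c * t" and "N = \<lfloor>q j\<rfloor> + d * t + k * (int l' + 1) - v"
    have i_eq: "idx p i = (M, N)" by (simp add: idx_def p i M_def N_def t_def)
    define W where "W = (of_nat l + of_real (x j \<mu>)) * \<omega> + (of_nat l' + of_real (y j v)) * of_int k"
    have W: "(of_int M + of_real (- R1)) * z + of_int N + of_real (- R2) = W"
    proof -
      have X1: "of_int c * of_int k * complex_of_real (x j \<mu>) = of_int c * of_int \<mu> + of_int j - of_real (frac R1)"
      proof -
        have "of_int c * of_int k * x j \<mu> = of_int c * of_int \<mu> + of_int j - frac R1"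
          unfolding x_eq using kr cr by simp
        then have "complex_of_real (of_int c * of_int k * x j \<mu>) = complex_of_real (of_int c * of_int \<mu> + of_int j - frac R1)" by (simp only:)
        then show ?thesis by simp
      qed
      have Y1: "of_int k * complex_of_real (y j v) = of_int k - of_int v - of_real (frac (q j))"
      proof -
        have "of_int k * y j v = of_int k - of_int v - frac (q j)"
          unfolding y_eq q_def[symmetric] using kr by simp
        then have "complex_of_real (of_int k * y j v) = complex_of_real (of_int k - of_int v - frac (q j))" by (simp only:)
        then show ?thesis by simp
      qed
      have Q1: "of_int c * complex_of_real (q j) = of_int c * of_real R2 + of_int d * (of_int j - of_real (frac R1))"
      proof -
        have "of_int c * q j = of_int c * R2 + of_int d * (of_int j - frac R1)"
          using cr by (simp add: q_def distrib_left)
        then have "complex_of_real (of_int c * q j) = complex_of_real (of_int c * R2 + of_int d * (of_int j - frac R1))" by (simp only:)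
        then show ?thesis by simp
      qed
      have fR: "of_real (frac R1) = complex_of_real R1 - of_int \<lfloor>R1\<rfloor>" "of_real (frac (q j)) = complex_of_real (q j) - of_int \<lfloor>q j\<rfloor>"
        by (simp_all add: frac_def)
      define a where "a = of_int c * of_int \<mu> + of_int j - complex_of_real (frac R1) + of_int c * of_int k * of_nat l"
      \<comment> \<open>c W is computed in place of W in order to clear the denominator of q
        j.\<close>
      have "of_int c * W = (of_int c * of_int k * of_nat l + of_int c * of_int k * of_real (x j \<mu>)) * (of_int c * z + of_int d)
          + of_int c * (of_int k * of_nat l' + of_int k * of_real (y j v))"
        by (simp add: W_def \<omega>_def algebra_simps)
      also have "\<dots> = a * (of_int c * z + of_int d) + of_int c * (of_int k * of_nat l' + (of_int k - of_int v - (of_real (q j) - of_int \<lfloor>q j\<rfloor>)))"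
        unfolding X1 Y1 fR(2) a_def by (simp only: add.commute)
      also have "\<dots> = of_int c * (a * z) + (of_int d * a + of_int c * (of_int k * of_nat l' + of_int k - of_int v + of_int \<lfloor>q j\<rfloor>) - of_int c * of_real (q j))"
        by (simp add: algebra_simps)
      also have "\<dots> = of_int c * (a * z) + of_int c * (of_int N - of_real R2)"
        unfolding Q1 a_def by (simp add: N_def t_def algebra_simps)
      finally have "of_int c * W = of_int c * (a * z + (of_int N - of_real R2))" by (simp only: distrib_left)
      then have "W = a * z + (of_int N - of_real R2)" using cr by simp
      moreover have "a = of_int M + of_real (- R1)" unfolding a_def fR(1) by (simp add: M_def t_def algebra_simps)
      ultimately show ?thesis by simp
    qed
    have "Re W > 0"
    proof -
      have "Re ((of_nat l + of_real r) * v) = (of_nat l + r) * Re v" for r v and l :: nat by simp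
      then have "Re W = (of_nat l + x j \<mu>) * Re \<omega> + (of_nat l' + y j v) * Re (of_int k)"
        unfolding W_def by (simp only: plus_complex.sel)
      then show ?thesis using x[of j \<mu>] y[of v j] b w by (simp add: add_pos_pos add_nonneg_pos)
    qed
    then have "cpow W (- s) = W powr (- s)" by (rule cpow_eq_powr)
    moreover have "F1 M = F1 (\<mu> * c + j + \<lfloor>R1\<rfloor>)"
      using F1[of "\<mu> * c + j + \<lfloor>R1\<rfloor>" "c * int l"] by (simp add: M_def t_def algebra_simps)
    moreover have "F2 N = F2 (\<lfloor>q j\<rfloor> - v)"
      using F2[of "\<lfloor>q j\<rfloor> - v" "d' * t + int l' + 1"] by (simp add: N_def d' algebra_simps)
    ultimately show ?thesis
      unfolding i_eq T_def lattice_term_def prod.case W by (simp add: C_def p i W_def)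
  qed
  have "(T has_sum (\<Sum>p\<in>P. C p * Me p)) (\<Union>p\<in>P. range (idx p))"
  proof (rule sum_has_sum)
    show "finite P" by (simp add: P_def)
    fix p assume pP: "p \<in> P"
    obtain j \<mu> v where p: "p = (j, \<mu>, v)" by (cases p)
    have xy: "x j \<mu> \<ge> 0" "y j v \<ge> 0" "x j \<mu> + y j v > 0"
      using x[of j \<mu>] y[of v j] pP by (auto simp: P_def p)
    have "((\<lambda>(l::nat, l'::nat). ((of_nat l + of_real (x j \<mu>)) * \<omega> + (of_nat l' + of_real (y j v)) * of_int k) powr (- s)) has_sum Me p) UNIV"
      unfolding Me_def p prod.case by (rule cone_sum_2(2)[OF w xy s])
    then have "((\<lambda>i. C p * (case i of (l::nat, l'::nat) \<Rightarrow> ((of_nat l + of_real (x j \<mu>)) * \<omega> + (of_nat l' + of_real (y j v)) * of_int k) powr (- s))) has_sum (C p * Me p)) UNIV"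
      by (rule has_sum_cmult_right)
    also have "(\<lambda>i. C p * (case i of (l::nat, l'::nat) \<Rightarrow> ((of_nat l + of_real (x j \<mu>)) * \<omega> + (of_nat l' + of_real (y j v)) * of_int k) powr (- s))) = T \<circ> idx p"
      unfolding o_def T_idx[OF pP] by (rule ext) (simp add: p split: prod.split)
    finally show "(T has_sum (C p * Me p)) (range (idx p))"
      by (simp only: has_sum_reindex[OF inj])
  next
    fix p p' assume "p \<in> P" "p' \<in> P" "p \<noteq> p'"
    then show "range (idx p) \<inter> range (idx p') = {}" using dec_idx by (metis (no_types, lifting) disjoint_iff rangeE)
  qed
  moreover have "(\<Sum>p\<in>P. C p * Me p) = (\<Sum>j = 1..c. \<Sum>\<mu> = 0..k - 1. \<Sum>v = 0..k - 1. C (j, \<mu>, v) * Me (j, \<mu>, v))"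
    unfolding P_def by (simp only: sum.cartesian_product')
  ultimately show ?thesis
    unfolding tile X_def T_def C_def Me_def prod.case q_def \<omega>_def by simp
qed

section \<open>The modular substitution\<close>

lemma dil_periodic: "periodic_seq k f \<Longrightarrow> periodic_seq k (dil f m)"
  using periodic_seq_add_mult[of k f _ m]
  by (subst periodic_seq_def) (simp add: dil_def distrib_left mult.commute[of m k])

lemma Im_moebius_pos:
  fixes a b c d :: int
  assumes det: "a * d - b * c = 1" and z: "Im z > 0" and c: "c > 0"
  shows "Im ((of_int a * z + of_int b) / (of_int c * z + of_int d)) > 0"
proof -
  define u where "u = of_int c * z + of_int d"
  have "Im u > 0" using z c by (simp add: u_def)
  then have u0: "u \<noteq> 0" by auto
  have "Im ((of_int a * z + of_int b) / u) = Im ((of_int a * z + of_int b) * cnj u) / (norm u)\<^sup>2"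
    by (subst complex_div_cnj) (simp add: Im_divide_of_real del: of_real_power flip: of_real_power)
  also have "Im ((of_int a * z + of_int b) * cnj u) = of_int (a * d - b * c) * Im z"
    by (simp add: u_def algebra_simps)
  finally show ?thesis using z u0 by (simp add: det u_def)
qed

text \<open>Only the terms in P change under the substitution, each by the factor e(-s). Reflecting
  them at 0 costs e(s/2), and the reflected sector consists of the ray M = R1 and the open cone
  X.\<close>

lemma G_series_transformation:
  fixes k a b c d \<alpha> \<beta> :: int and f fstar :: "int \<Rightarrow> complex" and r1 r2 R1 R2 :: real and z s :: complex
  assumes k: "k > 0" and f: "periodic_seq k f" and fs: "periodic_seq k fstar"
    and det: "a * d - b * c = 1" and c: "c > 0" and a: "k dvd a" and d: "k dvd d"
    and R1: "R1 = of_int a * r1 + of_int c * r2" and R2: "R2 = of_int b * r1 + of_int d * r2"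
    and z: "Im z > 0" and s: "Re s > 2"
  defines "u \<equiv> of_int c * z + of_int d"
    and "X \<equiv> {(M, N). of_int M > R1 \<and> of_int c * (of_int N - R2) > of_int d * (of_int M - R1)}"
  shows "cpow u (- s) * G_series ((of_int a * z + of_int b) / u) (dil fstar (- \<beta>)) (dil f (- \<alpha>)) r1 r2 s =
     G_series z (dil f (\<alpha> * b)) (dil fstar (\<beta> * c)) R1 R2 s
     - 2 * \<i> * sin (of_real pi * s) *
       (f_lambda f (- \<alpha> * b) R1 * L_series (dil fstar (- \<beta> * c)) (- R2) s
        + infsum (lattice_term z (dil f (- \<alpha> * b)) (dil fstar (- \<beta> * c)) (- R1) (- R2) s) X)"
proof -
  define V where "V = (of_int a * z + of_int b) / u"
  have Imu: "Im u > 0" using z c by (simp add: u_def)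
  then have u0: "u \<noteq> 0" by auto
  have ImV: "Im V > 0"
    using Im_moebius_pos[OF det z c] by (simp add: V_def u_def)
  define T1 where "T1 = lattice_term V (dil fstar (- \<beta>)) (dil f (- \<alpha>)) r1 r2 s"
  define T where "T = lattice_term z (dil f (\<alpha> * b)) (dil fstar (\<beta> * c)) R1 R2 s"
  define T' where "T' = lattice_term z (dil f (- \<alpha> * b)) (dil fstar (- \<beta> * c)) (- R1) (- R2) s"
  define S1 where "S1 = {q. lattice_point V r1 r2 q \<noteq> 0}"
  define S where "S = {q. lattice_point z R1 R2 q \<noteq> 0}"
  define S' where "S' = {q. lattice_point z (- R1) (- R2) q \<noteq> 0}"
  define \<tau> where "\<tau> = (\<lambda>(m, n). (a * m + c * n, b * m + d * n))"
  define \<tau>' where "\<tau>' = (\<lambda>(M, N). (d * M - c * N, a * N - b * M))"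
  define P where "P = {q. upper (- lattice_point z R1 R2 q) \<and> Im (u * cnj (- lattice_point z R1 R2 q)) > 0}"
  define e where "e = exp (- 2 * of_real pi * \<i> * s)"
  have inv1: "\<tau>' (\<tau> q) = q" for q
  proof (cases q)
    case (Pair m n)
    have "d * (a * m + c * n) - c * (b * m + d * n) = (a * d - b * c) * m"
      "a * (b * m + d * n) - b * (a * m + c * n) = (a * d - b * c) * n" by (simp_all add: algebra_simps)
    then show ?thesis by (simp add: Pair \<tau>_def \<tau>'_def det)
  qed
  have inv2: "\<tau> (\<tau>' q) = q" for q
  proof (cases q)
    case (Pair m n)
    have "a * (d * m - c * n) + c * (a * n - b * m) = (a * d - b * c) * m"
      "b * (d * m - c * n) + d * (a * n - b * m) = (a * d - b * c) * n" by (simp_all add: algebra_simps)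
    then show ?thesis by (simp add: Pair \<tau>_def \<tau>'_def det)
  qed
  have pt: "lattice_point V r1 r2 q = lattice_point z R1 R2 (\<tau> q) / u" for q
  proof (cases q)
    case (Pair m n)
    have "lattice_point V r1 r2 q * u = (of_int m + of_real r1) * (V * u) + (of_int n + of_real r2) * u"
      by (simp add: Pair lattice_point_def algebra_simps)
    also have "V * u = of_int a * z + of_int b" using u0 by (simp add: V_def)
    also have "(of_int m + of_real r1) * (of_int a * z + of_int b) + (of_int n + of_real r2) * u = lattice_point z R1 R2 (\<tau> q)"
      by (simp add: Pair lattice_point_def \<tau>_def u_def R1 R2 algebra_simps)
    finally show ?thesis using u0 by (simp add: eq_divide_eq)
  qed
  have bij: "bij_betw \<tau> S1 S"
    by (rule bij_betw_byWitness[where f' = \<tau>']) (use u0 inv1 inv2 in \<open>auto simp: S1_def S_def pt\<close>)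
  obtain a' d' where ad: "a = k * a'" "d = k * d'" using a d by (elim dvdE) blast
  have Tq: "cpow u (- s) * T1 q = T (\<tau> q) * (if \<tau> q \<in> P then e else 1)" if q: "q \<in> S1" for q
  proof -
    obtain M N where MN: "\<tau> q = (M, N)" by (cases "\<tau> q")
    have q_eq: "q = (d * M - c * N, a * N - b * M)" using inv1[of q] by (simp add: MN \<tau>'_def)
    have w0: "lattice_point z R1 R2 (\<tau> q) \<noteq> 0" using q u0 by (auto simp: S1_def pt)
    \<comment> \<open>The inverse substitution gives the indices d M - c N and a N - b M. As k
      divides a and d, only one of the two variables survives modulo k in each coefficient.\<close>
    have c1: "dil fstar (- \<beta>) (d * M - c * N) = dil fstar (\<beta> * c) N"
      using periodic_seq_add_mult[OF fs, of "\<beta> * c * N" "- \<beta> * d' * M"] by (simp add: dil_def ad algebra_simps)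
    have c2: "dil f (- \<alpha>) (a * N - b * M) = dil f (\<alpha> * b) M"
      using periodic_seq_add_mult[OF f, of "\<alpha> * b * M" "- \<alpha> * a' * N"] by (simp add: dil_def ad algebra_simps)
    have "T1 (m, n) = dil fstar (- \<beta>) m * dil f (- \<alpha>) n * cpow (lattice_point V r1 r2 (m, n)) (- s)" for m n
      by (simp add: T1_def lattice_term_def lattice_point_def)
    from this[of "d * M - c * N" "a * N - b * M"]
    have "T1 q = dil fstar (\<beta> * c) N * dil f (\<alpha> * b) M * cpow (lattice_point V r1 r2 q) (- s)"
      by (simp only: q_eq[symmetric] c1 c2)
    then have "cpow u (- s) * T1 q = dil f (\<alpha> * b) M * dil fstar (\<beta> * c) N * (cpow (lattice_point z R1 R2 (\<tau> q) / u) (- s) * cpow u (- s))"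
      by (simp add: pt mult_ac)
    also have "cpow (lattice_point z R1 R2 (\<tau> q) / u) (- s) * cpow u (- s) = cpow (lattice_point z R1 R2 (\<tau> q)) (- s) * (if \<tau> q \<in> P then e else 1)"
      using cpow_divide[OF Imu w0, of s] by (simp add: P_def e_def)
    also have "dil f (\<alpha> * b) M * dil fstar (\<beta> * c) N * (cpow (lattice_point z R1 R2 (\<tau> q)) (- s) * (if \<tau> q \<in> P then e else 1)) = T (\<tau> q) * (if \<tau> q \<in> P then e else 1)"
      by (simp add: T_def lattice_term_def lattice_point_def MN)
    finally show ?thesis .
  qed
  have sumT: "(\<lambda>q. norm (T q)) summable_on S"
    using lattice_sum[OF k dil_periodic[OF f, of "\<alpha> * b"] dil_periodic[OF fs, of "\<beta> * c"] z, of R1 R2] s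
    unfolding T_def S_def by blast
  have sumT': "(\<lambda>q. norm (T' q)) summable_on S'"
    using lattice_sum[OF k dil_periodic[OF f, of "- \<alpha> * b"] dil_periodic[OF fs, of "- \<beta> * c"] z, of "- R1" "- R2"] s
    unfolding T'_def S'_def by blast
  have PS: "P \<subseteq> S" using upper_nonzero by (fastforce simp: P_def S_def)
  have sT: "T summable_on S" by (rule abs_summable_summable[OF sumT])
  have sP: "T summable_on P" by (rule summable_on_subset_banach[OF sT PS])
  have sPe: "(\<lambda>q. (e - 1) * T q) summable_on P" by (rule summable_on_cmult_right[OF sP])
  have "cpow u (- s) * infsum T1 S1 = infsum (\<lambda>q. cpow u (- s) * T1 q) S1" by (rule infsum_cmult_right'[symmetric])
  also have "\<dots> = infsum (\<lambda>q. T (\<tau> q) * (if \<tau> q \<in> P then e else 1)) S1" by (intro infsum_cong Tq)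
  also have "\<dots> = infsum (\<lambda>q. T q * (if q \<in> P then e else 1)) S" by (rule infsum_reindex_bij_betw[OF bij])
  also have "\<dots> = infsum (\<lambda>q. T q + (if q \<in> P then (e - 1) * T q else 0)) S"
    by (intro infsum_cong) (simp add: algebra_simps)
  also have "\<dots> = infsum T S + infsum (\<lambda>q. if q \<in> P then (e - 1) * T q else 0) S"
  proof (rule infsum_add[OF sT])
    show "(\<lambda>q. if q \<in> P then (e - 1) * T q else 0) summable_on S"
      by (rule summable_on_cong_neutral[THEN iffD1, OF _ _ _ sPe]) (use PS in auto)
  qed
  also have "infsum (\<lambda>q. if q \<in> P then (e - 1) * T q else 0) S = infsum (\<lambda>q. (e - 1) * T q) P"
    using PS by (intro infsum_cong_neutral) auto
  also have "\<dots> = (e - 1) * infsum T P" by (rule infsum_cmult_right')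
  finally have A: "cpow u (- s) * infsum T1 S1 = infsum T S + (e - 1) * infsum T P" .
  \<comment> \<open>For M = R1 the lattice point is the positive real N - R2, which makes these
    terms those of an L-series.\<close>
  define X0 where "X0 = {(M, N). of_int M = R1 \<and> of_int N > R2}"
  define r where "r = (\<lambda>(M::int, N::int). (- M, - N))"
  have rr: "r (r q) = q" for q by (cases q) (simp add: r_def)
  have rpt: "lattice_point z R1 R2 (r q) = - lattice_point z (- R1) (- R2) q" for q
    by (cases q) (simp add: r_def lattice_point_def algebra_simps)
  have XP: "X0 \<union> X = {q. upper (lattice_point z (- R1) (- R2) q) \<and> Im (u * cnj (lattice_point z (- R1) (- R2) q)) > 0}"
  proof (intro set_eqI)
    fix q :: "int \<times> int"
    obtain M N where q: "q = (M, N)" by (cases q)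
    have "Im (u * cnj (lattice_point z (- R1) (- R2) q)) = (of_int c * (of_int N - R2) - of_int d * (of_int M - R1)) * Im z"
      by (simp add: q lattice_point_def u_def algebra_simps)
    then have 1: "Im (u * cnj (lattice_point z (- R1) (- R2) q)) > 0 \<longleftrightarrow> of_int c * (of_int N - R2) > of_int d * (of_int M - R1)"
      using z by (simp add: zero_less_mult_iff)
    have 2: "upper (lattice_point z (- R1) (- R2) q) \<longleftrightarrow> of_int M > R1 \<or> of_int M = R1 \<and> of_int N > R2"
      unfolding q upper_lattice_point[OF z] by auto
    have 3: "of_int c * (of_int N - R2) > of_int d * (of_int M - R1) \<longleftrightarrow> of_int N > R2" if "of_int M = R1"
      using that c by (simp add: zero_less_mult_iff)
    show "q \<in> X0 \<union> X \<longleftrightarrow> q \<in> {q. upper (lattice_point z (- R1) (- R2) q) \<and> Im (u * cnj (lattice_point z (- R1) (- R2) q)) > 0}"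
      unfolding mem_Collect_eq 1 2 using 3 by (auto simp: q X0_def X_def)
  qed
  have rP: "r q \<in> P \<longleftrightarrow> q \<in> X0 \<union> X" for q
    by (simp only: XP P_def mem_Collect_eq rpt minus_minus)
  have rX: "r q \<in> X0 \<union> X" if "q \<in> P" for q using that rP[of "r q"] by (simp only: rr)
  have bijr: "bij_betw r (X0 \<union> X) P"
  proof (rule bij_betw_byWitness[where f' = r])
    show "r ` (X0 \<union> X) \<subseteq> P" using rP by blast
    show "r ` P \<subseteq> X0 \<union> X" using rX by blast
  qed (simp_all only: rr ball_triv simp_thms)
  have Tr: "T (r q) = exp (\<i> * of_real pi * s) * T' q" if "q \<in> X0 \<union> X" for q
  proof -
    obtain M N where q: "q = (M, N)" by (cases q)
    have "T (r q) = dil f (- \<alpha> * b) M * dil fstar (- \<beta> * c) N * cpow (lattice_point z R1 R2 (r q)) (- s)"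
      by (simp add: T_def lattice_term_def lattice_point_def q r_def dil_def)
    also have "cpow (lattice_point z R1 R2 (r q)) (- s) = exp (\<i> * of_real pi * s) * cpow (lattice_point z (- R1) (- R2) q) (- s)"
      unfolding rpt using that by (intro cpow_minus) (simp add: XP)
    finally show ?thesis by (simp add: T'_def lattice_term_def lattice_point_def q mult_ac)
  qed
  have XS: "X0 \<union> X \<subseteq> S'" using upper_nonzero by (auto simp: XP S'_def)
  have sT': "T' summable_on S'" by (rule abs_summable_summable[OF sumT'])
  have sX: "T' summable_on X0" "T' summable_on X" using XS by (auto intro: summable_on_subset_banach[OF sT'])
  have disj: "X0 \<inter> X = {}" by (auto simp: X0_def X_def)
  have "infsum T P = infsum (\<lambda>q. T (r q)) (X0 \<union> X)" by (rule infsum_reindex_bij_betw[OF bijr, symmetric])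
  also have "\<dots> = infsum (\<lambda>q. exp (\<i> * of_real pi * s) * T' q) (X0 \<union> X)" by (intro infsum_cong Tr)
  also have "\<dots> = exp (\<i> * of_real pi * s) * infsum T' (X0 \<union> X)" by (rule infsum_cmult_right')
  also have "infsum T' (X0 \<union> X) = infsum T' X0 + infsum T' X" by (rule infsum_Un_disjoint[OF sX disj])
  finally have B: "infsum T P = exp (\<i> * of_real pi * s) * (infsum T' X0 + infsum T' X)" .
  have C: "infsum T' X0 = f_lambda f (- \<alpha> * b) R1 * L_series (dil fstar (- \<beta> * c)) (- R2) s"
  proof (cases "R1 \<in> \<int>")
    case False
    then have "X0 = {}" by (auto simp: X0_def)
    then show ?thesis using False by (simp add: f_lambda_def)
  next
    case True
    then have R1f: "of_int \<lfloor>R1\<rfloor> = R1" by simp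
    have "X0 = (\<lambda>N. (\<lfloor>R1\<rfloor>, N)) ` {N. of_int N > R2}" using R1f by (auto simp: X0_def)
    then have "infsum T' X0 = infsum (\<lambda>N. T' (\<lfloor>R1\<rfloor>, N)) {N. of_int N > R2}"
      by (simp only:) (subst infsum_reindex, auto simp: inj_on_def o_def)
    also have "T' (\<lfloor>R1\<rfloor>, N) = f (- \<alpha> * b * \<lfloor>R1\<rfloor>) * (dil fstar (- \<beta> * c) N * cpow (of_int N + of_real (- R2)) (- s))" for N
    proof -
      have "of_int \<lfloor>R1\<rfloor> + complex_of_real (- R1) = 0" using R1f by (metis add.right_inverse of_real_minus of_real_of_int_eq)
      then show ?thesis by (simp add: T'_def lattice_term_def dil_def)
    qed
    then have "infsum (\<lambda>N. T' (\<lfloor>R1\<rfloor>, N)) {N. of_int N > R2} = f (- \<alpha> * b * \<lfloor>R1\<rfloor>) * L_series (dil fstar (- \<beta> * c)) (- R2) s"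
      unfolding L_series_def by (simp only: infsum_cmult_right' minus_minus)
    finally show ?thesis using True by (simp add: f_lambda_def)
  qed
  \<comment> \<open>The factor e(-s) - 1 of the sector combined with the factor e(s/2) of the
    reflection.\<close>
  have sin: "(e - 1) * exp (\<i> * of_real pi * s) = - (2 * \<i> * sin (of_real pi * s))"
  proof -
    define E where "E = exp (\<i> * (of_real pi * s))"
    have E0: "E \<noteq> 0" by (simp add: E_def)
    have "- 2 * of_real pi * \<i> * s = - (\<i> * (of_real pi * s)) + - (\<i> * (of_real pi * s))" by (simp add: algebra_simps)
    then have eE: "e = (1 / E) * (1 / E)" unfolding e_def by (simp only: exp_add exp_minus E_def divide_inverse mult_1_left)
    have "(e - 1) * E = 1 / E - E" unfolding eE using E0 by (simp add: left_diff_distrib)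
    moreover have "2 * \<i> * sin (of_real pi * s) = E - 1 / E"
      by (simp only: sin_exp_eq exp_minus E_def[symmetric]) (simp add: field_simps)
    ultimately show ?thesis by (simp add: E_def mult.assoc)
  qed
  have "cpow u (- s) * infsum T1 S1 = infsum T S + ((e - 1) * exp (\<i> * of_real pi * s)) * (infsum T' X0 + infsum T' X)"
    unfolding A B by (simp only: mult.assoc)
  then show ?thesis
    unfolding V_def[symmetric] G_series_lattice[OF ImV] G_series_lattice[OF z] sin C
    by (simp add: T1_def S1_def T_def S_def T'_def)
qed

section \<open>From entire functions to the stated identity\<close>

lemma eq_by_continuationI:
  assumes "F meromorphic_on UNIV" "H meromorphic_on UNIV" "E \<subseteq> \<int>" and eq: "\<And>s. s \<notin> E \<Longrightarrow> F s = H s"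
  shows "eq_by_continuation E F H"
proof -
  have "remove_sings F s = remove_sings H s" for s
  proof (rule remove_sings_cong[OF _ refl])
    \<comment> \<open>The integers do not accumulate, so every point s has a punctured neighbourhood
      free of \<open>E\<close>, which determines the values after removal of singularities.\<close>
    have "closed (E - {s})" using assms(3) by (intro closed_subset_Ints) blast
    then have "\<forall>\<^sub>F x in at s. x \<in> - (E - {s})"
      by (intro eventually_at_in_open' open_Compl) auto
    then show "\<forall>\<^sub>F x in at s. F x = H x"
      using eventually_neq_at_within[of s s UNIV] by eventually_elim (auto intro: eq)
  qed
  then show ?thesis using assms by (simp add: eq_by_continuation_def)
qed

lemma meromorphic_Gamma: "Gamma meromorphic_on (UNIV :: complex set)"
proof -
  have "(\<lambda>s. inverse (rGamma s)) meromorphic_on (UNIV :: complex set)"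
    by (intro meromorphic_intros analytic_on_imp_meromorphic_on)
       (simp add: analytic_on_open holomorphic_rGamma)
  then show ?thesis by (simp add: rGamma_inverse_Gamma)
qed

lemma entire_meromorphic: "f holomorphic_on UNIV \<Longrightarrow> f meromorphic_on UNIV"
  by (intro analytic_on_imp_meromorphic_on) (simp add: analytic_on_open)

text \<open>Replacing R2 by its fractional part changes the argument by an integer. This links the
  fractional part with \<rho> in \<open>I_loop\<close> to the floor in the coefficients.\<close>

lemma frac_shift:
  fixes c d j :: int and R1 R2 \<rho> :: real
  assumes "c > 0" and "\<rho> = frac R2 * of_int c - frac R1 * of_int d"
  shows "frac (R2 + of_int d * (of_int j - frac R1) / of_int c) = frac ((of_int (d * j) + \<rho>) / of_int c)"
proof -
  have "(of_int (d * j) + \<rho>) / of_int c = frac R2 + of_int d * (of_int j - frac R1) / of_int c"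
    using assms by (simp add: field_simps)
  then have "R2 + of_int d * (of_int j - frac R1) / of_int c = (of_int (d * j) + \<rho>) / of_int c + of_int \<lfloor>R2\<rfloor>"
    by (simp add: frac_def)
  then show ?thesis by (simp only: frac_add_of_int_right)
qed

theorem theorem2:
  fixes k \<alpha> \<beta> a b c d :: int
    and f fstar :: "int \<Rightarrow> complex"
    and r1 r2 R1 R2 \<rho> :: real
    and z :: complex
    and \<gamma> :: "real \<Rightarrow> complex"
  assumes "k > 0"
    and "periodic_seq k f" and "periodic_seq k fstar"
    and "a * d - b * c = 1" and "c > 0"
    and "[a = 0] (mod k)" and "[d = 0] (mod k)"
    and "R1 = of_int a * r1 + of_int c * r2"
    and "R2 = of_int b * r1 + of_int d * r2"
    and "\<rho> = frac R2 * of_int c - frac R1 * of_int d"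
    and "Re z > - of_int d / of_int c" and "Im z > 0"
    and "is_loop (I_poles k c d z) \<gamma>"
  shows "eq_by_continuation (insert 1 \<int>\<^sub>\<le>\<^sub>0)
    (\<lambda>s. cpow (of_int c * z + of_int d) (- s) * Gamma s
       * G ((of_int a * z + of_int b) / (of_int c * z + of_int d)) s
           (dil fstar (- \<beta>)) (dil f (- \<alpha>)) r1 r2)
    (\<lambda>s. Gamma s * G z s (dil f (\<alpha> * b)) (dil fstar (\<beta> * c)) R1 R2
       - 2 * \<i> * Gamma s * sin (of_real pi * s) * f_lambda f (- \<alpha> * b) R1
           * L s (dil fstar (- \<beta> * c)) (- R2)
       + exp (2 * of_real pi * \<i> * (- s / 2))
         * (\<Sum>j = 1..c. \<Sum>\<mu> = 0..k - 1. \<Sum>v = 0..k - 1.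
              f (- \<alpha> * b * (\<mu> * c + j + \<lfloor>R1\<rfloor>))
              * fstar (- \<beta> * c * (\<lfloor>R2 + of_int d * (of_int j - frac R1) / of_int c\<rfloor> - v))
              * I_loop \<gamma> k c d R1 \<rho> j \<mu> v z s))"
proof -
  note k = assms(1) and f = assms(2) and fs = assms(3) and det = assms(4) and c = assms(5)
    and z = assms(12) and loop = assms(13)
  have a: "k dvd a" and d: "k dvd d" using assms(6,7) by (simp_all add: cong_0_iff)
  define u where "u = of_int c * z + of_int d"
  define V where "V = (of_int a * z + of_int b) / u"
  define F1 F2 where "F1 = dil f (- \<alpha> * b)" and "F2 = dil fstar (- \<beta> * c)"
  \<comment> \<open>This is the condition z \<in> K; it puts the generator cz + d of the cones into
    the right half-plane.\<close>
  have Reu: "Re u > 0" using assms(11) c by (simp add: u_def field_simps)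
  have ImV: "Im V > 0"
    using Im_moebius_pos[OF det z c] by (simp add: V_def u_def)
  define x where "x j \<mu> = (of_int (c * \<mu> + j) - frac R1) / of_int (c * k)" for j \<mu>
  define y where "y j v = (of_int (k - v) - frac ((of_int (d * j) + \<rho>) / of_int c)) / of_int k" for j v
  define co where "co j \<mu> v = F1 (\<mu> * c + j + \<lfloor>R1\<rfloor>) * F2 (\<lfloor>R2 + of_int d * (of_int j - frac R1) / of_int c\<rfloor> - v)" for j \<mu> v
  define Me where "Me j \<mu> v s = mellin (\<lambda>t. geom_ker (x j \<mu>) (of_int k * u) (of_real t) * geom_ker (y j v) (of_int k) (of_real t)) s" for j \<mu> v s
  define Il where "Il j \<mu> v = I_loop \<gamma> k c d R1 \<rho> j \<mu> v z" for j \<mu> v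
  define fl where "fl = f_lambda f (- \<alpha> * b) R1"
  define X where "X = {(M, N). of_int M > R1 \<and> of_int c * (of_int N - R2) > of_int d * (of_int M - R1)}"
  note cone = I_loop_cone[OF k c Reu[unfolded u_def] _ _ _ _ loop, folded u_def]
  have x0: "x j \<mu> > 0" if "1 \<le> j" "0 \<le> \<mu>" for j \<mu>
    using cone(1)[OF that, of 0 R1] k by (simp only: x_def)
  have y0: "y j v > 0" if "0 \<le> v" "v < k" for j v
  proof -
    have "real_of_int (k - v) \<ge> 1" using that by (simp only: of_int_1_le_iff)
    then have "of_int (k - v) - frac ((of_int (d * j) + \<rho>) / of_int c) > 0"
      using frac_lt_1[of "(of_int (d * j) + \<rho>) / of_int c"] by linarith
    then show ?thesis using k by (simp only: y_def) simp
  qed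
  have Ih: "Il j \<mu> v holomorphic_on UNIV" and Im: "\<And>s. Re s > 2 \<Longrightarrow> Il j \<mu> v s = - (exp (2 * of_real pi * \<i> * s) - 1) * Me j \<mu> v s"
    if range: "1 \<le> j" "0 \<le> \<mu>" "0 \<le> v" "v < k" for j \<mu> v
  proof -
    obtain J where J: "J holomorphic_on UNIV" "\<And>s. I_loop \<gamma> k c d R1 \<rho> j \<mu> v z s = J s"
      "\<And>s. Re s > 2 \<Longrightarrow> J s = - (exp (2 * of_real pi * \<i> * s) - 1) * Me j \<mu> v s"
      using cone(3)[OF range, of R1 \<rho>] unfolding Me_def x_def y_def by blast
    have "Il j \<mu> v = J" using J(2) by (auto simp: Il_def)
    with J show "Il j \<mu> v holomorphic_on UNIV" "\<And>s. Re s > 2 \<Longrightarrow> Il j \<mu> v s = - (exp (2 * of_real pi * \<i> * s) - 1) * Me j \<mu> v s"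
      by simp_all
  qed
  define SI where "SI s = (\<Sum>j = 1..c. \<Sum>\<mu> = 0..k - 1. \<Sum>v = 0..k - 1. co j \<mu> v * Il j \<mu> v s)" for s
  define SM where "SM s = (\<Sum>j = 1..c. \<Sum>\<mu> = 0..k - 1. \<Sum>v = 0..k - 1. co j \<mu> v * Me j \<mu> v s)" for s
  have SI_hol: "SI holomorphic_on UNIV"
    unfolding SI_def by (intro holomorphic_intros Ih) auto
  have SI_eq: "SI s = - (exp (2 * of_real pi * \<i> * s) - 1) * SM s" if s: "Re s > 2" for s
  proof -
    have "SI s = (\<Sum>j = 1..c. \<Sum>\<mu> = 0..k - 1. \<Sum>v = 0..k - 1. - (exp (2 * of_real pi * \<i> * s) - 1) * (co j \<mu> v * Me j \<mu> v s))"
      unfolding SI_def by (intro sum.cong refl) (simp only: Im[OF _ _ _ _ s] atLeastAtMost_iff zle_diff1_eq mult.left_commute)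
    then show ?thesis by (simp only: SM_def sum_distrib_left)
  qed
  \<comment> \<open>\<open>rGamma\<close> replaces the division by \<open>Gamma\<close> because it
    is entire.\<close>
  have X_eq: "infsum (lattice_term z F1 F2 (- R1) (- R2) s) X = rGamma s * SM s" if s: "Re s > 2" for s
  proof -
    have "(lattice_term z F1 F2 (- R1) (- R2) s has_sum
        (\<Sum>j = 1..c. \<Sum>\<mu> = 0..k - 1. \<Sum>v = 0..k - 1. co j \<mu> v * (Me j \<mu> v s / Gamma s))) X"
      unfolding co_def Me_def X_def u_def
    proof (rule cone_decomposition[OF k c d _ _ Reu[unfolded u_def] s])
      show "F1 (n + k * m) = F1 n" for n m unfolding F1_def by (rule periodic_seq_add_mult[OF dil_periodic[OF f]])
      show "F2 (n + k * m) = F2 n" for n m unfolding F2_def by (rule periodic_seq_add_mult[OF dil_periodic[OF fs]])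
      show "y j v = (of_int (k - v) - frac (R2 + of_int d * (of_int j - frac R1) / of_int c)) / of_int k" for j v
        unfolding y_def frac_shift[OF c assms(10)] ..
    qed (use x0 y0 in \<open>auto simp: x_def\<close>)
    then have "infsum (lattice_term z F1 F2 (- R1) (- R2) s) X =
        (\<Sum>j = 1..c. \<Sum>\<mu> = 0..k - 1. \<Sum>v = 0..k - 1. rGamma s * (co j \<mu> v * Me j \<mu> v s))"
      by (simp add: infsumI rGamma_inverse_Gamma divide_inverse mult_ac)
    then show ?thesis by (simp only: SM_def sum_distrib_left)
  qed
  have rot: "exp (2 * of_real pi * \<i> * (- s / 2)) * SI s = - (2 * \<i> * sin (of_real pi * s)) * SM s" if s: "Re s > 2" for s
  proof -
    define E where "E = exp (\<i> * (of_real pi * s))"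
    have E0: "E \<noteq> 0" by (simp add: E_def)
    have e1: "exp (2 * of_real pi * \<i> * s) = E * E"
      by (simp add: E_def exp_add[symmetric] mult_ac)
    have "2 * of_real pi * \<i> * (- s / 2) = - (\<i> * (of_real pi * s))" by simp
    then have e2: "exp (2 * of_real pi * \<i> * (- s / 2)) = inverse E" by (simp only: exp_minus E_def)
    have e3: "2 * \<i> * sin (of_real pi * s) = E - inverse E"
      by (simp only: sin_exp_eq exp_minus E_def[symmetric]) simp
    show ?thesis unfolding SI_eq[OF s] e1 e2 e3 using E0 by (simp add: field_simps)
  qed
  obtain K1 where K1: "K1 holomorphic_on UNIV" "\<And>s. Re s > 2 \<Longrightarrow> (s - 1) * G_series V (dil fstar (- \<beta>)) (dil f (- \<alpha>)) r1 r2 s = K1 s"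
    using lattice_sum[OF k dil_periodic[OF fs] dil_periodic[OF f] ImV, of "- \<beta>" "- \<alpha>" r1 r2]
    unfolding G_series_lattice[OF ImV] by blast
  obtain K2 where K2: "K2 holomorphic_on UNIV" "\<And>s. Re s > 2 \<Longrightarrow> (s - 1) * G_series z (dil f (\<alpha> * b)) (dil fstar (\<beta> * c)) R1 R2 s = K2 s"
    using lattice_sum[OF k dil_periodic[OF f] dil_periodic[OF fs] z, of "\<alpha> * b" "\<beta> * c" R1 R2]
    unfolding G_series_lattice[OF z] by blast
  obtain K3 where K3: "K3 holomorphic_on UNIV" "\<And>s. Re s > 1 \<Longrightarrow> (s - 1) * L_series F2 (- R2) s = K3 s"
    using L_series_continuation[OF k dil_periodic[OF fs], of "- \<beta> * c" "- R2"] unfolding F2_def by blast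
  have le: "(1::real) \<le> 2" "(1::real) \<le> 1" by simp_all
  note G1 = mero_cont_simple_pole[OF K1(1) le(1) K1(2)]
  note G2 = mero_cont_simple_pole[OF K2(1) le(1) K2(2)]
  note L3 = mero_cont_simple_pole[OF K3(1) le(2) K3(2)]
  \<comment> \<open>Both sides of the identity multiplied by (s - 1)/Gamma(s). This clears the poles
    at 1 of the series and the poles of Gamma, so both functions are entire.\<close>
  define lhs where "lhs s = cpow u (- s) * K1 s" for s
  define rhs where "rhs s = K2 s - 2 * \<i> * sin (of_real pi * s) * fl * K3 s
      + (s - 1) * rGamma s * (exp (2 * of_real pi * \<i> * (- s / 2)) * SI s)" for s
  have "lhs s = rhs s" if "Re s > 2" for s
  proof -
    have s1: "Re s > 1" using that by simp
    have "lhs s = (s - 1) * (cpow u (- s) * G_series V (dil fstar (- \<beta>)) (dil f (- \<alpha>)) r1 r2 s)"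
      unfolding lhs_def K1(2)[OF that, symmetric] by (rule mult.left_commute)
    also have "cpow u (- s) * G_series V (dil fstar (- \<beta>)) (dil f (- \<alpha>)) r1 r2 s =
        G_series z (dil f (\<alpha> * b)) (dil fstar (\<beta> * c)) R1 R2 s
        - 2 * \<i> * sin (of_real pi * s) * (fl * L_series F2 (- R2) s + rGamma s * SM s)"
      using G_series_transformation[OF k f fs det c a d assms(8,9) z that, folded u_def X_def, of \<beta> \<alpha>]
      unfolding X_eq[OF that, symmetric] by (simp only: V_def fl_def F1_def F2_def)
    also have "(s - 1) * \<dots> = K2 s - 2 * \<i> * sin (of_real pi * s) * fl * K3 s
      + (s - 1) * rGamma s * (- (2 * \<i> * sin (of_real pi * s)) * SM s)"
      unfolding K2(2)[OF that, symmetric] K3(2)[OF s1, symmetric] by (simp add: algebra_simps)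
    finally show ?thesis unfolding rhs_def rot[OF that] .
  qed
  \<comment> \<open>Any half-plane that contains s serves for the continuation from Re s >
    2.\<close>
  then have eq: "lhs s = rhs s" for s
  proof (intro halfplane_continuation[of lhs "Re s - 1" rhs 2 s])
    show "lhs holomorphic_on {w. Re w > Re s - 1}" "rhs holomorphic_on {w. Re w > Re s - 1}"
      unfolding lhs_def[abs_def] rhs_def[abs_def]
      by (intro holomorphic_intros K1(1)[THEN holomorphic_on_subset] K2(1)[THEN holomorphic_on_subset]
           K3(1)[THEN holomorphic_on_subset] SI_hol[THEN holomorphic_on_subset]; simp)+
  qed auto
  have SI_eq': "(\<Sum>j = 1..c. \<Sum>\<mu> = 0..k - 1. \<Sum>v = 0..k - 1.
              f (- \<alpha> * b * (\<mu> * c + j + \<lfloor>R1\<rfloor>))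
              * fstar (- \<beta> * c * (\<lfloor>R2 + of_int d * (of_int j - frac R1) / of_int c\<rfloor> - v))
              * I_loop \<gamma> k c d R1 \<rho> j \<mu> v z s) = SI s" for s
    by (simp only: SI_def co_def F1_def F2_def dil_def Il_def)
  show ?thesis
    unfolding SI_eq' G_def L_def u_def[symmetric] V_def[symmetric] fl_def[symmetric] F2_def[symmetric]
  proof (rule eq_by_continuationI)
    have m: "(\<lambda>s. cpow u (- s)) meromorphic_on UNIV" "(\<lambda>s. sin (of_real pi * s)) meromorphic_on UNIV"
      "(\<lambda>s. exp (2 * of_real pi * \<i> * (- s / 2))) meromorphic_on UNIV"
      by (intro entire_meromorphic holomorphic_intros; simp)+
    show "(\<lambda>s. cpow u (- s) * Gamma s * mero_cont 2 (G_series V (dil fstar (- \<beta>)) (dil f (- \<alpha>)) r1 r2) s) meromorphic_on UNIV"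
      by (intro meromorphic_intros m meromorphic_Gamma G1(1))
    show "(\<lambda>s. Gamma s * mero_cont 2 (G_series z (dil f (\<alpha> * b)) (dil fstar (\<beta> * c)) R1 R2) s
         - 2 * \<i> * Gamma s * sin (of_real pi * s) * fl * mero_cont 1 (L_series F2 (- R2)) s
         + exp (2 * of_real pi * \<i> * (- s / 2)) * SI s) meromorphic_on UNIV"
      by (intro meromorphic_intros m meromorphic_Gamma G2(1) L3(1) entire_meromorphic[OF SI_hol])
    show "insert 1 \<int>\<^sub>\<le>\<^sub>0 \<subseteq> (\<int> :: complex set)" by auto
    fix s :: complex assume s: "s \<notin> insert 1 \<int>\<^sub>\<le>\<^sub>0"
    \<comment> \<open>Off the exceptional set neither s - 1 nor \<open>rGamma s\<close> vanishes, so
      the multiplication can be undone.\<close>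
    then have s1: "s \<noteq> 1" and g: "Gamma s * rGamma s = 1"
      by (auto simp: rGamma_inverse_Gamma Gamma_eq_zero_iff)
    have "cpow u (- s) * Gamma s * (K1 s / (s - 1)) = Gamma s / (s - 1) * lhs s"
      by (simp add: lhs_def)
    also have "\<dots> = Gamma s / (s - 1) * (K2 s - 2 * \<i> * sin (of_real pi * s) * fl * K3 s)
        + (Gamma s * rGamma s) * ((s - 1) / (s - 1)) * (exp (2 * of_real pi * \<i> * (- s / 2)) * SI s)"
      unfolding eq rhs_def by (simp add: distrib_left)
    also have "\<dots> = Gamma s * (K2 s / (s - 1)) - 2 * \<i> * Gamma s * sin (of_real pi * s) * fl * (K3 s / (s - 1))
        + exp (2 * of_real pi * \<i> * (- s / 2)) * SI s"
      using s1 unfolding g by (simp add: right_diff_distrib)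
    finally show "cpow u (- s) * Gamma s * mero_cont 2 (G_series V (dil fstar (- \<beta>)) (dil f (- \<alpha>)) r1 r2) s =
        Gamma s * mero_cont 2 (G_series z (dil f (\<alpha> * b)) (dil fstar (\<beta> * c)) R1 R2) s
         - 2 * \<i> * Gamma s * sin (of_real pi * s) * fl * mero_cont 1 (L_series F2 (- R2)) s
         + exp (2 * of_real pi * \<i> * (- s / 2)) * SI s"
      using s1 by (simp only: G1(2) G2(2) L3(2) simp_thms)
  qed
qed

end
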